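(* Let $G$ be a countable group and let $\mu$ be a probability measure on $G$ with finite entropy $H(\mu)=-\sum_g\mu(g)\log\mu(g)$. A $\mu$-boundary $(B,\lambda)\cong(\Gamma_\xi,\nu_\xi)$ is the Poisson boundary of $(G,\mu)$ if and only if $\mathbf{h}(\mathbf{P}^{\gamma_\xi})=0$ for almost all conditional measures $\mathbf{P}^{\gamma_\xi}$, $\gamma_\xi\in\Gamma_\xi$, of the measure $\mathbf{P}$ with respect to $\Gamma_\xi$.
   Context: Random walks. The (right) random walk $(G,\mu)$ is the Markov chain on $G$ with transition probabilities $p(x,y)=\mu(x^{-1}y)$; thus $x_n=x_0h_1h_2\cdots h_n$ with independent $\mu$-distributed increments $h_i$. $G^{\mathbb{Z}_+}$ is the space of sample paths $\boldsymbol{x}=\{x_n\}_{n\ge 0}$, on which $G$ acts coordinatewise from the left. $\mathbf{P}_\theta$ is the Markov measure on $G^{\mathbb{Z}_+}$ with initial distribution $\theta$; $\mathbf{P}=\mathbf{P}_{\delta_e}$; $m$ is the counting measure on $G$; $T$ is the time shift $\{x_n\}\mapsto\{x_{n+1}\}$. The Poisson boundary $\Gamma$ is the space of ergodic components of $T$ in the Lebesgue space $(G^{\mathbb{Z}_+},\mathbf{P}_m)$: there is a projection $\mathrm{bnd}:G^{\mathbb{Z}_+}\to\Gamma$ such that the $\sigma$-algebra of $T$-invariant measurable sets coincides (mod 0) with the $\sigma$-algebra of $\mathrm{bnd}$-preimages of measurable subsets of $\Gamma$. The $G$-action descends to $\Gamma$, and $\Gamma$ is endowed with the harmonic measure $\nu=\mathrm{bnd}(\mathbf{P})$.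 A $\mu$-boundary is the quotient $(\Gamma_\xi,\nu_\xi)$ of $(\Gamma,\nu)$ by a $G$-invariant measurable partition $\xi$, and $\mathrm{bnd}_\xi:(G^{\mathbb{Z}_+},\mathbf{P})\to(\Gamma,\nu)\to(\Gamma_\xi,\nu_\xi)$ is the canonical projection. A $\mu$-boundary "is the Poisson boundary" (is maximal) if the quotient map $(\Gamma,\nu)\to(\Gamma_\xi,\nu_\xi)$ is an isomorphism mod 0. Conditional measures. $\mathbf{P}^{\gamma_\xi}$, $\gamma_\xi\in\Gamma_\xi$, is the canonical (Rohlin) system of conditional measures of $\mathbf{P}$ on the fibres of $\mathrm{bnd}_\xi$ (each regarded as a probability measure on $G^{\mathbb{Z}_+}$). Asymptotic entropy. For $g\in G$ put $C_g^n=\{\boldsymbol{x}\in G^{\mathbb{Z}_+}:x_n=g\}$. A probability measure $\Lambda$ on $G^{\mathbb{Z}_+}$ has asymptotic entropy $\mathbf{h}(\Lambda)$ if $-\frac1n\log\Lambda(C_{x_n}^n)\to\mathbf{h}(\Lambda)$ for $\Lambda$-a.e. $\boldsymbol{x}=\{x_n\}$ and in the space $L^1(\Lambda)$. *)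

theory Defs
  imports "HOL-Probability.Probability"
begin

section \<open>Random walks on a countable group\<close>

text \<open>
  The group is a type of class \<open>group_add\<close>, the (not necessarily commutative) groups of the
  library; hence the additive notation: \<open>g + h\<close> is the product, \<open>0\<close> the identity.
\<close>

definition has_finite_entropy :: "'g pmf \<Rightarrow> bool" where
  "has_finite_entropy \<mu> \<longleftrightarrow> (\<lambda>g. - (pmf \<mu> g * ln (pmf \<mu> g))) summable_on UNIV"

definition path_space :: "(nat \<Rightarrow> 'g) measure" where
  "path_space = Pi\<^sub>M UNIV (\<lambda>_. count_space UNIV)"

text \<open>\<open>walk x h\<close> is the path started at \<open>x\<close>; \<open>h n\<close> is the increment from time \<open>n\<close> to \<open>Suc n\<close>.\<close>

primrec walk :: "'g::group_add \<Rightarrow> (nat \<Rightarrow> 'g) \<Rightarrow> nat \<Rightarrow> 'g" where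
  "walk x h 0 = x"
| "walk x h (Suc n) = walk x h n + h n"

text \<open>
  The Markov measure with initial distribution \<open>\<theta>\<close>, which may be any sigma-finite measure
  defined on all subsets of the group.
\<close>

definition markov_measure :: "'g::{group_add,countable} pmf \<Rightarrow> 'g measure \<Rightarrow> (nat \<Rightarrow> 'g) measure" where
  "markov_measure \<mu> \<theta> =
     distr (\<theta> \<Otimes>\<^sub>M Pi\<^sub>M UNIV (\<lambda>_::nat. measure_pmf \<mu>)) path_space (\<lambda>(x, h). walk x h)"

definition walk_measure :: "'g::{group_add,countable} pmf \<Rightarrow> (nat \<Rightarrow> 'g) measure" where
  "walk_measure \<mu> = markov_measure \<mu> (measure_pmf (return_pmf 0))"

definition counting_walk_measure :: "'g::{group_add,countable} pmf \<Rightarrow> (nat \<Rightarrow> 'g) measure" where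
  "counting_walk_measure \<mu> = markov_measure \<mu> (count_space UNIV)"

definition time_shift :: "(nat \<Rightarrow> 'g) \<Rightarrow> nat \<Rightarrow> 'g" where
  "time_shift x = (\<lambda>n. x (Suc n))"

definition shift_invariant_sets :: "'g::{group_add,countable} pmf \<Rightarrow> (nat \<Rightarrow> 'g) set set" where
  "shift_invariant_sets \<mu> =
     {A \<in> sets (completion (counting_walk_measure \<mu>)). time_shift -` A = A}"


section \<open>Lebesgue spaces, measurable partitions and conditional measures\<close>

text \<open>The map \<open>f\<close> is unconstrained on the null set that is removed from its domain.\<close>

definition iso_mod0 :: "'a measure \<Rightarrow> 'b measure \<Rightarrow> ('a \<Rightarrow> 'b) \<Rightarrow> bool" where
  "iso_mod0 M N f \<longleftrightarrow>
     (\<exists>A\<in>null_sets M. \<exists>B\<in>null_sets N.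
        bij_betw f (space M - A) (space N - B) \<and>
        (\<forall>E. E \<subseteq> space M - A \<longrightarrow>
           (E \<in> sets M \<longleftrightarrow> f ` E \<in> sets N) \<and>
           (E \<in> sets M \<longrightarrow> emeasure N (f ` E) = emeasure M E)))"

text \<open>
  Lebesgue (Rokhlin) probability spaces. A Borel probability measure on the line is, after
  completion, isomorphic mod 0 to an interval with Lebesgue measure together with at most
  countably many atoms, and every such space arises in this way.
\<close>

definition lebesgue_space :: "'a measure \<Rightarrow> bool" where
  "lebesgue_space M \<longleftrightarrow>
     complete_measure M \<and> prob_space M \<and>
     (\<exists>(R::real measure) f. sets R = sets borel \<and> prob_space R \<and> iso_mod0 M (completion R) f)"

text \<open>Measurability in the sense of Rokhlin: a countable family \<open>B\<close> of measurable unions of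
  elements of the partition separates the elements of the partition.\<close>

definition measurable_partition :: "'a measure \<Rightarrow> 'a set set \<Rightarrow> bool" where
  "measurable_partition M \<xi> \<longleftrightarrow>
     partition_on (space M) \<xi> \<and>
     (\<exists>B::nat \<Rightarrow> 'a set.
        (\<forall>n. B n \<in> sets M \<and> (\<forall>C\<in>\<xi>. C \<subseteq> B n \<or> C \<inter> B n = {})) \<and>
        (\<forall>C\<in>\<xi>. \<forall>C'\<in>\<xi>. C \<noteq> C' \<longrightarrow> (\<exists>n.
           C \<subseteq> B n \<and> C' \<inter> B n = {} \<or> C \<inter> B n = {} \<and> C' \<subseteq> B n)))"

definition partition_proj :: "'a set set \<Rightarrow> 'a \<Rightarrow> 'a set" where
  "partition_proj \<xi> \<gamma> = (THE C. C \<in> \<xi> \<and> \<gamma> \<in> C)"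

text \<open>The points of the quotient are the elements of the partition.\<close>

definition quotient_measure :: "'a measure \<Rightarrow> 'a set set \<Rightarrow> 'a set measure" where
  "quotient_measure M \<xi> =
     distr M (sigma \<xi> {D. D \<subseteq> \<xi> \<and> \<Union>D \<in> sets M}) (partition_proj \<xi>)"

text \<open>
  \<open>\<kappa>\<close> is a canonical system of conditional measures of \<open>M\<close> on the fibres of \<open>q\<close>, where \<open>Q\<close> is the
  image of \<open>M\<close> under \<open>q\<close>. The fibres need to be measurable only for the completion of \<open>\<kappa> c\<close>.
\<close>

definition conditional_measures ::
    "'a measure \<Rightarrow> 'b measure \<Rightarrow> ('a \<Rightarrow> 'b) \<Rightarrow> ('b \<Rightarrow> 'a measure) \<Rightarrow> bool" where
  "conditional_measures M Q q \<kappa> \<longleftrightarrow>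
     (\<forall>c\<in>space Q. prob_space (\<kappa> c) \<and> sets (\<kappa> c) = sets M) \<and>
     (\<forall>A\<in>sets M. (\<lambda>c. emeasure (\<kappa> c) A) \<in> borel_measurable Q \<and>
        emeasure M A = (\<integral>\<^sup>+ c. emeasure (\<kappa> c) A \<partial>Q)) \<and>
     (AE c in Q. AE x in \<kappa> c. q x = c)"


section \<open>The Poisson boundary and its quotients\<close>

text \<open>
  The image of the completed Markov measure under \<open>bnd\<close>, completed again, so that it can be a
  Lebesgue space whether \<open>\<Gamma>\<close> carries a Borel or an already completed sigma-algebra.
\<close>

definition boundary_measure ::
    "'g::{group_add,countable} pmf \<Rightarrow> 'b measure \<Rightarrow> ((nat \<Rightarrow> 'g) \<Rightarrow> 'b) \<Rightarrow> 'g pmf \<Rightarrow> 'b measure" where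
  "boundary_measure \<mu> \<Gamma> bnd \<theta> =
     completion (distr (completion (markov_measure \<mu> (measure_pmf \<theta>))) \<Gamma> bnd)"

definition harmonic_measure ::
    "'g::{group_add,countable} pmf \<Rightarrow> 'b measure \<Rightarrow> ((nat \<Rightarrow> 'g) \<Rightarrow> 'b) \<Rightarrow> 'b measure" where
  "harmonic_measure \<mu> \<Gamma> bnd = boundary_measure \<mu> \<Gamma> bnd (return_pmf 0)"

text \<open>
  Only the space and the sigma-algebra of \<open>\<Gamma>\<close> matter. The image of the counting walk measure is
  in general not sigma-finite, so that \<open>\<Gamma>\<close> is a Lebesgue space is expressed by the images of
  the (absolutely continuous) walk measures with an initial probability distribution.
\<close>

definition poisson_boundary ::
    "'g::{group_add,countable} pmf \<Rightarrow> 'b measure \<Rightarrow> ((nat \<Rightarrow> 'g) \<Rightarrow> 'b) \<Rightarrow> ('g \<Rightarrow> 'b \<Rightarrow> 'b) \<Rightarrow> bool" where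
  "poisson_boundary \<mu> \<Gamma> bnd act \<longleftrightarrow>
     bnd \<in> completion (counting_walk_measure \<mu>) \<rightarrow>\<^sub>M \<Gamma> \<and>
     (\<forall>\<theta>. lebesgue_space (boundary_measure \<mu> \<Gamma> bnd \<theta>)) \<and>
     (\<forall>D\<in>sets \<Gamma>. \<exists>A\<in>shift_invariant_sets \<mu>.
        AE x in counting_walk_measure \<mu>. bnd x \<in> D \<longleftrightarrow> x \<in> A) \<and>
     (\<forall>A\<in>shift_invariant_sets \<mu>. \<exists>D\<in>sets \<Gamma>.
        AE x in counting_walk_measure \<mu>. bnd x \<in> D \<longleftrightarrow> x \<in> A) \<and>
     (\<forall>g. act g \<in> \<Gamma> \<rightarrow>\<^sub>M \<Gamma>) \<and>
     (\<forall>\<gamma>\<in>space \<Gamma>. act 0 \<gamma> = \<gamma> \<and> (\<forall>g h. act (g + h) \<gamma> = act g (act h \<gamma>))) \<and>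
     (\<forall>g. AE x in counting_walk_measure \<mu>. bnd (\<lambda>n. g + x n) = act g (bnd x))"

definition invariant_partition :: "('g \<Rightarrow> 'b \<Rightarrow> 'b) \<Rightarrow> 'b set set \<Rightarrow> bool" where
  "invariant_partition act \<xi> \<longleftrightarrow> (\<forall>g. \<forall>C\<in>\<xi>. act g ` C \<in> \<xi>)"

text \<open>
  \<open>(B, \<lambda>)\<close>, represented by the measure \<open>lam\<close>, is a \<open>\<mu>\<close>-boundary: \<open>\<phi>\<close> identifies it with the
  quotient of the Poisson boundary by the partition \<open>\<xi>\<close>. The action on \<open>B\<close> is the
  one transported along \<open>\<phi>\<close>.
\<close>

definition mu_boundary ::
    "'g::{group_add,countable} pmf \<Rightarrow> 'b measure \<Rightarrow> ((nat \<Rightarrow> 'g) \<Rightarrow> 'b) \<Rightarrow> ('g \<Rightarrow> 'b \<Rightarrow> 'b) \<Rightarrow>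
     'b set set \<Rightarrow> 'c measure \<Rightarrow> ('b set \<Rightarrow> 'c) \<Rightarrow> bool" where
  "mu_boundary \<mu> \<Gamma> bnd act \<xi> lam \<phi> \<longleftrightarrow>
     measurable_partition (harmonic_measure \<mu> \<Gamma> bnd) \<xi> \<and>
     invariant_partition act \<xi> \<and>
     iso_mod0 (quotient_measure (harmonic_measure \<mu> \<Gamma> bnd) \<xi>) lam \<phi>"

definition is_the_poisson_boundary ::
    "'g::{group_add,countable} pmf \<Rightarrow> 'b measure \<Rightarrow> ((nat \<Rightarrow> 'g) \<Rightarrow> 'b) \<Rightarrow>
     'b set set \<Rightarrow> 'c measure \<Rightarrow> ('b set \<Rightarrow> 'c) \<Rightarrow> bool" where
  "is_the_poisson_boundary \<mu> \<Gamma> bnd \<xi> lam \<phi> \<longleftrightarrow>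
     iso_mod0 (harmonic_measure \<mu> \<Gamma> bnd) lam (\<phi> \<circ> partition_proj \<xi>)"


section \<open>Asymptotic entropy\<close>

definition cylinder :: "nat \<Rightarrow> 'g \<Rightarrow> (nat \<Rightarrow> 'g) set" where
  "cylinder n g = {x. x n = g}"

definition entropy_rate :: "(nat \<Rightarrow> 'g) measure \<Rightarrow> nat \<Rightarrow> (nat \<Rightarrow> 'g) \<Rightarrow> real" where
  "entropy_rate L n x = - (1 / real n) * ln (measure L (cylinder n (x n)))"

definition has_asymptotic_entropy :: "(nat \<Rightarrow> 'g) measure \<Rightarrow> real \<Rightarrow> bool" where
  "has_asymptotic_entropy L h \<longleftrightarrow>
     (AE x in L. (\<lambda>n. entropy_rate L n x) \<longlonglongrightarrow> h) \<and>
     (\<forall>n. integrable L (entropy_rate L n)) \<and>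
     (\<lambda>n. \<integral>x. \<bar>entropy_rate L n x - h\<bar> \<partial>L) \<longlonglongrightarrow> 0"

end

theory Submission
  imports Defs
begin

text \<open>
  Fix the boundary quotient by \<open>\<xi>\<close> and let \<open>F\<close> be the sigma-algebra on path space that it
  generates, \<open>J\<close> the one generated by the whole Poisson boundary, both read modulo null sets of
  the walk measure \<open>P\<close>. Two facts reduce the theorem to a statement about these sigma-algebras.
  Since the Poisson boundary is a Lebesgue space, countably many sets separate its points, and
  therefore the quotient map is an isomorphism mod 0 exactly when \<open>F = J\<close> (\<open>iso_iff_sets_eq\<close>).
  And the conditional measures compute conditional expectations given \<open>F\<close>, so that
  \<open>-ln \<kappa> C {y. y n = x n}\<close>, with \<open>C\<close> the class of \<open>x\<close>, is the conditional information \<open>cond_info n x\<close>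
  of the position at time \<open>n\<close> given \<open>F\<close>. It remains to prove that \<open>cond_info n / n\<close> tends to 0 in the
  required senses if and only if \<open>F = J\<close> (\<open>zero_entropy_iff\<close>).

  Everything about \<open>F\<close> rests on one property, which expresses the invariance of \<open>\<xi>\<close>: on the event
  that the walk is at \<open>g\<close> at time \<open>a\<close>, a set in \<open>F\<close> is described by a set in \<open>F\<close> evaluated at the
  restarted walk, and conversely. It yields the cocycle identity for the densities
  \<open>dg\<nu>/d\<nu>\<close>, in logarithmic form \<open>cond_info_cocycle\<close>. By stationarity, the mean of
  \<open>cond_info n\<close> is \<open>H n - n * D\<close>, where \<open>H n\<close> is the entropy of the position at time \<open>n\<close> and the constant
  \<open>D = D 1\<close> is the information that \<open>F\<close> contains about the first step.

  Zero entropy forces \<open>F = J\<close>. If \<open>cond_info n / n\<close> tends to 0 almost surely, it does so in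
  mean, because it is dominated by averages of a stationary integrable sequence. Hence \<open>H n / n\<close> tends
  to the constant \<open>D\<close> of \<open>F\<close>, while for \<open>J\<close> the limit is at least the constant of \<open>J\<close>, which in turn is
  at least that of \<open>F\<close> because \<open>F\<close> is contained in \<open>J\<close>. So both sigma-algebras contain the same
  information about every position, and the equality case of Gibbs' inequality makes the
  conditional laws of every position agree. By the Markov property a set in \<open>J\<close> then has the same
  correlation with every cylinder as its conditional probability given \<open>F\<close>, so it belongs to \<open>F\<close>
  (\<open>zero_rate_imp_maximal\<close>).

  \<open>F = J\<close> forces zero entropy. The increment \<open>H (n + 1) - H n\<close> is the mutual information of the first step
  and the position at time \<open>n + 1\<close>. The posterior probability of the first step given
  the position at time \<open>n\<close> is a reversed martingale, and the point is that its limit, which is a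
  tail function, is measurable with respect to the shift-invariant sets. This is a form of the
  0-2 law: the separation \<open>\<Sum>y. a y ^ 2 / (a y + b y)\<close> of the laws \<open>a\<close>, \<open>b\<close> of the positions at times \<open>m\<close> and
  \<open>m + k\<close> decreases in \<open>m\<close>, and its decrement is a variance that controls how much the posterior depends
  on the time at which a site is visited. Hence the increments of \<open>H\<close> are asymptotically at most \<open>D\<close>, and the mean of
  \<open>cond_info n / n\<close> tends to 0 (\<open>maximal_imp_zero_rate\<close>).

  Convergence of the means to 0 is upgraded to almost sure convergence, both of
  \<open>cond_info n / n\<close> and of its conditional expectation given \<open>F\<close>, by a Hopf maximal inequality
  for the Markov operator that sends \<open>\<psi>\<close> to the conditional expectation of \<open>\<psi>\<close> at the restarted walk
  (\<open>subadditive_zero_limit\<close>). The second convergence is the convergence in mean under almost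
  every conditional measure; it does not follow from the almost sure one, as maximal functions of
  integrable functions need not be integrable.
\<close>

section \<open>Paths, restarts and the Markov property\<close>

lemma measurable_plus_count_space:
  fixes f g :: "'a \<Rightarrow> 'g::{plus,countable}"
  assumes f: "f \<in> M \<rightarrow>\<^sub>M count_space UNIV" and g: "g \<in> M \<rightarrow>\<^sub>M count_space UNIV"
  shows "(\<lambda>x. f x + g x) \<in> M \<rightarrow>\<^sub>M count_space UNIV"
proof (rule measurable_compose_countable[OF _ f])
  fix i
  show "(\<lambda>x. i + g x) \<in> M \<rightarrow>\<^sub>M count_space UNIV"
    by (rule measurable_compose[OF g]) simp
qed

lemma space_path_space [simp]: "space path_space = UNIV"
  by (simp add: path_space_def space_PiM)

lemma measurable_into_path_space:
  assumes "\<And>n. (\<lambda>x. f x n) \<in> M \<rightarrow>\<^sub>M count_space UNIV"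
  shows "f \<in> M \<rightarrow>\<^sub>M path_space"
  unfolding path_space_def by (rule measurable_PiM_single') (use assms in auto)

lemma measurable_coordinate: "(\<lambda>x. x n) \<in> path_space \<rightarrow>\<^sub>M count_space UNIV"
  unfolding path_space_def by measurable

text \<open>
  The path seen from its position at time \<open>a\<close>: the increments after \<open>a\<close>, summed up from the identity.
\<close>

definition restart :: "nat \<Rightarrow> (nat \<Rightarrow> 'g::group_add) \<Rightarrow> nat \<Rightarrow> 'g" where
  "restart a x = (\<lambda>n. - x a + x (a + n))"

lemma restart_restart: "restart a (restart b x) = restart (b + a) x"
  by (auto simp: restart_def fun_eq_iff minus_add add.assoc)

lemma measurable_walk:
  fixes f :: "'a \<Rightarrow> 'g::{group_add,countable}"
  assumes f: "f \<in> M \<rightarrow>\<^sub>M count_space UNIV" and g: "\<And>n. (\<lambda>x. g x n) \<in> M \<rightarrow>\<^sub>M count_space UNIV"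
  shows "(\<lambda>x. walk (f x) (g x)) \<in> M \<rightarrow>\<^sub>M path_space"
proof (rule measurable_into_path_space)
  fix n show "(\<lambda>x. walk (f x) (g x) n) \<in> M \<rightarrow>\<^sub>M count_space UNIV"
    by (induction n) (auto intro!: f g measurable_plus_count_space)
qed

lemma walk_eq_add: "walk g h = (\<lambda>n. g + walk 0 h n)"
proof
  fix n show "walk g h n = g + walk 0 h n"
    by (induction n) (auto simp: add.assoc)
qed

lemma measurable_restart: 
  "(restart a :: (nat \<Rightarrow> 'g::{group_add,countable}) \<Rightarrow> _) \<in> path_space \<rightarrow>\<^sub>M path_space"
proof (rule measurable_into_path_space)
  fix n
  show "(\<lambda>x::nat\<Rightarrow>'g. restart a x n) \<in> path_space \<rightarrow>\<^sub>M count_space UNIV"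
    unfolding restart_def
    by (intro measurable_plus_count_space measurable_coordinate
        measurable_compose[OF measurable_coordinate, of "\<lambda>y. - y"]) simp
qed

lemma measurable_translate:
  "(\<lambda>x n. g + x n :: 'g::{group_add,countable}) \<in> path_space \<rightarrow>\<^sub>M path_space"
  by (intro measurable_into_path_space measurable_plus_count_space measurable_coordinate) simp

lemma walk_cong: "(\<And>i. i < n \<Longrightarrow> h i = h' i) \<Longrightarrow> walk g h n = walk g h' n"
  by (induction n) auto

lemma restart_walk: "restart a (walk g h) = walk 0 (\<lambda>n. h (a + n))"
proof
  fix n show "restart a (walk g h) n = walk 0 (\<lambda>n. h (a + n)) n"
    by (induction n) (auto simp: restart_def add.assoc[symmetric])
qed

text \<open>
  A pointwise form of measurability with respect to the first \<open>a + 1\<close> coordinates.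
\<close>

definition determined_by_past :: "nat \<Rightarrow> (nat \<Rightarrow> 'g) set \<Rightarrow> bool" where
  "determined_by_past a E \<longleftrightarrow> (\<forall>x y. (\<forall>i\<le>a. x i = y i) \<longrightarrow> (x \<in> E \<longleftrightarrow> y \<in> E))"

lemma determined_by_past_cylinder: "i \<le> a \<Longrightarrow> determined_by_past a (cylinder i g)"
  by (simp add: determined_by_past_def cylinder_def)

lemma determined_by_past_UNIV: "determined_by_past a UNIV"
  by (simp add: determined_by_past_def)

locale random_walk =
  fixes \<mu> :: "'g::{group_add,countable} pmf"
begin

abbreviation "P \<equiv> walk_measure \<mu>"
abbreviation "Inc \<equiv> Pi\<^sub>M UNIV (\<lambda>_::nat. measure_pmf \<mu>)"

sublocale inc: sequence_space "measure_pmf \<mu>" ..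

lemma measurable_inc: "(\<lambda>h. h n) \<in> Inc \<rightarrow>\<^sub>M count_space UNIV"
proof -
  have "(\<lambda>h. h n) \<in> Inc \<rightarrow>\<^sub>M measure_pmf \<mu>" by (rule measurable_component_singleton) simp
  then show ?thesis by (subst measurable_cong_sets[OF refl, of _ "measure_pmf \<mu>"]) auto
qed

lemma measurable_walk_inc: "walk g \<in> Inc \<rightarrow>\<^sub>M path_space"
  by (rule measurable_walk) (auto intro: measurable_inc)

lemma sets_P [measurable_cong]: "sets P = sets path_space"
  by (simp add: walk_measure_def markov_measure_def)

lemma space_P [simp]: "space P = UNIV"
  by (simp add: walk_measure_def markov_measure_def)

lemma pair_walk: "(\<lambda>(x, h). walk x h) \<in> count_space UNIV \<Otimes>\<^sub>M Inc \<rightarrow>\<^sub>M path_space"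
  unfolding case_prod_beta
proof (rule measurable_walk)
  show "fst \<in> count_space UNIV \<Otimes>\<^sub>M Inc \<rightarrow>\<^sub>M count_space UNIV" by measurable
  fix n show "(\<lambda>x. snd x n) \<in> count_space UNIV \<Otimes>\<^sub>M Inc \<rightarrow>\<^sub>M count_space UNIV"
    by (rule measurable_compose[OF measurable_snd measurable_inc])
qed

lemma sets_pmf_pair: "sets (measure_pmf \<theta> \<Otimes>\<^sub>M Inc) = sets (count_space UNIV \<Otimes>\<^sub>M Inc)"
  by (intro sets_pair_measure_cong) auto

lemma P_eq: "P = distr Inc path_space (walk 0)"
proof (rule measure_eqI)
  show "sets P = sets (distr Inc path_space (walk 0))" by (simp add: sets_P)
  fix A assume A: "A \<in> sets P"
  then have A': "A \<in> sets path_space" by (simp add: sets_P)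
  have m: "(\<lambda>(x, h). walk x h) \<in> measure_pmf (return_pmf 0) \<Otimes>\<^sub>M Inc \<rightarrow>\<^sub>M path_space"
    using pair_walk by (subst measurable_cong_sets[OF sets_pmf_pair refl])
  have m2: "(\<lambda>(x, h). walk x h) -` A \<inter> space (measure_pmf (return_pmf (0::'g)) \<Otimes>\<^sub>M Inc) \<in> sets (measure_pmf (return_pmf 0) \<Otimes>\<^sub>M Inc)"
    by (rule measurable_sets[OF m A'])
  have "emeasure P A = emeasure (measure_pmf (return_pmf 0) \<Otimes>\<^sub>M Inc)
      ((\<lambda>(x, h). walk x h) -` A \<inter> space (measure_pmf (return_pmf (0::'g)) \<Otimes>\<^sub>M Inc))"
    unfolding walk_measure_def markov_measure_def by (rule emeasure_distr[OF m A'])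
  also have "\<dots> = (\<integral>\<^sup>+ g. emeasure Inc (Pair g -` ((\<lambda>(x, h). walk x h) -` A \<inter> space (measure_pmf (return_pmf (0::'g)) \<Otimes>\<^sub>M Inc))) \<partial>measure_pmf (return_pmf 0))"
    by (rule inc.emeasure_pair_measure_alt[OF m2])
  also have "\<dots> = emeasure Inc (walk 0 -` A \<inter> space Inc)"
    by (simp add: nn_integral_return space_pair_measure vimage_def Int_def)
  also have "\<dots> = emeasure (distr Inc path_space (walk 0)) A"
    by (rule emeasure_distr[OF measurable_walk_inc A', symmetric])
  finally show "emeasure P A = emeasure (distr Inc path_space (walk 0)) A" .
qed

sublocale P: prob_space P
  unfolding P_eq by (rule inc.prob_space_distr[OF measurable_walk_inc])

text \<open>
  The measure with initial distribution the counting measure is the sum of the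
  translates of \<open>P\<close>; this is how statements about the former are specialised to the latter.
\<close>

lemma AE_P_counting:
  assumes "AE x in counting_walk_measure \<mu>. R x"
  shows "AE x in P. R (\<lambda>n. g + x n)"
proof -
  interpret c: sigma_finite_measure "count_space UNIV :: 'g measure"
    by (rule sigma_finite_measure_count_space_countable) simp
  interpret pair_sigma_finite "count_space UNIV :: 'g measure" Inc ..
  from assms obtain B where B: "{x \<in> space (counting_walk_measure \<mu>). \<not> R x} \<subseteq> B" "B \<in> null_sets (counting_walk_measure \<mu>)"
    by (auto simp: eventually_ae_filter)
  have Bs: "B \<in> sets path_space" using B(2) by (auto simp: counting_walk_measure_def markov_measure_def)
  have sp: "space (counting_walk_measure \<mu>) = UNIV" by (simp add: counting_walk_measure_def markov_measure_def)
  have "AE x in counting_walk_measure \<mu>. x \<notin> B" using B(2) by (rule AE_not_in)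
  then have "AE z in count_space UNIV \<Otimes>\<^sub>M Inc. (\<lambda>(x, h). walk x h) z \<notin> B"
    unfolding counting_walk_measure_def markov_measure_def
    by (rule AE_distrD[OF pair_walk])
  then have "AE x in count_space UNIV. AE h in Inc. walk x h \<notin> B"
    by (drule_tac AE_pair) simp
  then have "AE h in Inc. walk g h \<notin> B" by (simp add: AE_count_space)
  then have 2: "AE h in Inc. (\<lambda>n. g + walk 0 h n) \<notin> B" by (simp add: walk_eq_add[of g])
  have "AE x in P. (\<lambda>n. g + x n) \<notin> B"
    unfolding P_eq
    by (subst AE_distr_iff[OF measurable_walk_inc])
      (use 2 measurable_sets[OF measurable_translate[of g] sets.compl_sets[OF Bs]] in \<open>auto simp: vimage_def\<close>)
  then show ?thesis by eventually_elim (use B(1) sp in auto)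
qed

text \<open>
  The Markov property. The increments are independent and identically distributed, so cutting their
  sequence at time \<open>a\<close> gives two independent pieces, the second distributed like the whole.
\<close>

lemma nn_integral_restart:
  assumes E: "E \<in> sets P" and dep: "determined_by_past a E"
    and \<psi>: "\<psi> \<in> borel_measurable P"
  shows "(\<integral>\<^sup>+x. indicator E x * \<psi> (restart a x) \<partial>P) = emeasure P E * (\<integral>\<^sup>+x. \<psi> x \<partial>P)"
proof -
  have \<psi>': "\<psi> \<in> borel_measurable path_space" using \<psi> by (simp add: measurable_cong_sets[OF sets_P refl])
  have E': "E \<in> sets path_space" using E by (simp add: sets_P)
  have wI: "walk 0 \<in> Inc \<rightarrow>\<^sub>M path_space" by (rule measurable_walk_inc)
  have IE: "(indicator E :: _ \<Rightarrow> ennreal) \<in> borel_measurable path_space" using E' by simp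
  let ?S = Inc
  have sc: "(\<lambda>(\<omega>, \<omega>'). comb_seq a \<omega> \<omega>') \<in> ?S \<Otimes>\<^sub>M ?S \<rightarrow>\<^sub>M ?S"
    by (rule measurable_comb_seq)
  have m1: "(\<lambda>x. indicator E x * \<psi> (restart a x)) \<in> borel_measurable path_space"
    using measurable_compose[OF measurable_restart[of a] \<psi>'] IE by auto
  have "(\<integral>\<^sup>+x. indicator E x * \<psi> (restart a x) \<partial>P)
      = (\<integral>\<^sup>+h. indicator E (walk 0 h) * \<psi> (restart a (walk 0 h)) \<partial>?S)"
    unfolding P_eq by (subst nn_integral_distr[OF wI]) (use m1 in auto)
  also have "\<dots> = (\<integral>\<^sup>+h. indicator E (walk 0 h) * \<psi> (restart a (walk 0 h)) \<partial>distr (?S \<Otimes>\<^sub>M ?S) ?S (\<lambda>(\<omega>, \<omega>'). comb_seq a \<omega> \<omega>'))"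
    by (subst inc.PiM_comb_seq) simp
  also have "\<dots> = (\<integral>\<^sup>+z. indicator E (walk 0 (comb_seq a (fst z) (snd z))) * \<psi> (restart a (walk 0 (comb_seq a (fst z) (snd z)))) \<partial>(?S \<Otimes>\<^sub>M ?S))"
    by (subst nn_integral_distr[OF sc]) (use measurable_compose[OF wI m1] in \<open>auto simp: case_prod_beta\<close>)
  also have "\<dots> = (\<integral>\<^sup>+z. indicator E (walk 0 (fst z)) * \<psi> (walk 0 (snd z)) \<partial>(?S \<Otimes>\<^sub>M ?S))"
  proof (rule nn_integral_cong)
    fix z :: "(nat \<Rightarrow> 'g) \<times> (nat \<Rightarrow> 'g)"
    have "walk 0 (comb_seq a (fst z) (snd z)) \<in> E \<longleftrightarrow> walk 0 (fst z) \<in> E"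
      by (rule dep[unfolded determined_by_past_def, rule_format], rule walk_cong) (auto simp: comb_seq_def)
    moreover have "restart a (walk 0 (comb_seq a (fst z) (snd z))) = walk 0 (snd z)"
      by (simp add: restart_walk comb_seq_def)
    ultimately show "indicator E (walk 0 (comb_seq a (fst z) (snd z))) * \<psi> (restart a (walk 0 (comb_seq a (fst z) (snd z))))
       = indicator E (walk 0 (fst z)) * \<psi> (walk 0 (snd z))"
      by (simp add: indicator_def)
  qed
  also have "\<dots> = (\<integral>\<^sup>+\<omega>. \<integral>\<^sup>+\<omega>'. indicator E (walk 0 \<omega>) * \<psi> (walk 0 \<omega>') \<partial>?S \<partial>?S)"
    using measurable_compose[OF wI IE] measurable_compose[OF wI \<psi>']
    by (subst inc.nn_integral_fst[symmetric]) (auto intro!: borel_measurable_times measurable_compose[OF measurable_fst] measurable_compose[OF measurable_snd])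
  also have "\<dots> = (\<integral>\<^sup>+\<omega>. indicator E (walk 0 \<omega>) * (\<integral>\<^sup>+x. \<psi> x \<partial>P) \<partial>?S)"
    using measurable_compose[OF wI \<psi>'] unfolding P_eq
    by (subst nn_integral_distr[OF wI]) (use \<psi>' in \<open>auto simp: nn_integral_cmult\<close>)
  also have "\<dots> = (\<integral>\<^sup>+\<omega>. indicator E (walk 0 \<omega>) \<partial>?S) * (\<integral>\<^sup>+x. \<psi> x \<partial>P)"
    using measurable_compose[OF wI IE] by (subst nn_integral_multc) auto
  also have "(\<integral>\<^sup>+\<omega>. indicator E (walk 0 \<omega>) \<partial>?S) = emeasure P E"
    using E' IE unfolding P_eq by (subst nn_integral_indicator[symmetric], simp, subst nn_integral_distr[OF wI]) simp_all
  finally show ?thesis .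
qed

end

section \<open>A maximal inequality and subadditive sequences with vanishing mean growth\<close>

primrec running_max :: "(nat \<Rightarrow> 'a \<Rightarrow> real) \<Rightarrow> nat \<Rightarrow> 'a \<Rightarrow> real" where
  "running_max R 0 x = R 0 x"
| "running_max R (Suc n) x = max (running_max R n x) (R (Suc n) x)"

lemma running_max_ge: "j \<le> n \<Longrightarrow> R j x \<le> running_max R n x"
  by (induction n) (auto simp: le_Suc_eq max_def intro: order_trans)

lemma running_max_attained: "\<exists>j\<le>n. running_max R n x = R j x"
proof (induction n)
  case (Suc n)
  then show ?case by (metis le_Suc_eq max_def order_refl running_max.simps(2))
qed simp

lemma integrable_running_max:
  "(\<And>j. integrable M (R j)) \<Longrightarrow> integrable M (running_max R n)"
proof (induction n)
  case 0 then show ?case by (simp add: running_max.simps[abs_def])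
next
  case (Suc n) then show ?case by (simp add: running_max.simps[abs_def] integrable_max)
qed

text \<open>
  The operators \<open>\<psi> \<mapsto> E[\<psi> \<circ> \<theta> j | F]\<close> form a semigroup by the last
  assumption: conditioning before the time change loses nothing. For \<open>F = M\<close> they are the
  composition operators of the semigroup \<open>\<theta>\<close>; for a sigma-algebra of a random walk they are the
  powers of the Markov operator of the conditioned walk.
\<close>

locale transfer_semigroup = prob_space M for M :: "'a measure" +
  fixes F :: "'a measure" and \<theta> :: "nat \<Rightarrow> 'a \<Rightarrow> 'a"
  assumes subalg: "subalgebra M F"
    and measurable_\<theta>: "\<And>j. \<theta> j \<in> M \<rightarrow>\<^sub>M M"
    and distr_\<theta>: "\<And>j. distr M M (\<theta> j) = M"
    and \<theta>_0: "AE x in M. \<theta> 0 x = x"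
    and \<theta>_\<theta>: "\<And>i j x. \<theta> i (\<theta> j x) = \<theta> (i + j) x"
    and transfer_cond_exp: "\<And>\<psi> j. integrable M \<psi> \<Longrightarrow> AE x in M. 0 \<le> \<psi> x \<Longrightarrow>
      AE x in M. real_cond_exp M F (\<lambda>x. real_cond_exp M F \<psi> (\<theta> j x)) x = real_cond_exp M F (\<lambda>x. \<psi> (\<theta> j x)) x"
begin

sublocale finite_measure_subalgebra M F
  by unfold_locales (rule subalg)

definition U :: "nat \<Rightarrow> ('a \<Rightarrow> real) \<Rightarrow> 'a \<Rightarrow> real" where
  "U j \<psi> = real_cond_exp M F (\<lambda>x. \<psi> (\<theta> j x))"

lemma integrable_\<theta>: "integrable M (\<psi> :: 'a \<Rightarrow> real) \<Longrightarrow> integrable M (\<lambda>x. \<psi> (\<theta> j x))"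
  using integrable_distr[OF measurable_\<theta>[of j], of \<psi>] by (simp add: distr_\<theta>)

lemma integral_\<theta>: "integrable M (\<psi> :: 'a \<Rightarrow> real) \<Longrightarrow> (\<integral>x. \<psi> (\<theta> j x) \<partial>M) = (\<integral>x. \<psi> x \<partial>M)"
  using integral_distr[OF measurable_\<theta>[of j], of \<psi>] by (simp add: distr_\<theta>)

lemma AE_\<theta>: "AE x in M. R x \<Longrightarrow> AE x in M. R (\<theta> j x)"
  using AE_distrD[OF measurable_\<theta>[of j], of R, unfolded distr_\<theta>] by simp

lemma integrable_U [intro]: "integrable M \<psi> \<Longrightarrow> integrable M (U j \<psi>)"
  unfolding U_def by (intro real_cond_exp_int integrable_\<theta>)

lemma integral_U: "integrable M \<psi> \<Longrightarrow> (\<integral>x. U j \<psi> x \<partial>M) = (\<integral>x. \<psi> x \<partial>M)"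
  unfolding U_def by (subst real_cond_exp_int(2)) (auto intro: integrable_\<theta> simp: integral_\<theta>)

lemma U_mono:
  assumes "AE x in M. \<psi> x \<le> \<phi> x" "integrable M \<psi>" "integrable M \<phi>"
  shows "AE x in M. U j \<psi> x \<le> U j \<phi> x"
  unfolding U_def by (intro real_cond_exp_mono integrable_\<theta> assms AE_\<theta>[OF assms(1)])

lemma U_nonneg:
  assumes "AE x in M. 0 \<le> \<psi> x" "integrable M \<psi>"
  shows "AE x in M. 0 \<le> U j \<psi> x"
  unfolding U_def using assms integrable_\<theta>[OF assms(2)]
  by (intro real_cond_exp_pos AE_\<theta>) auto

lemma U_diff_const:
  assumes "integrable M \<psi>"
  shows "AE x in M. U j (\<lambda>x. \<psi> x - c) x = U j \<psi> x - c"
proof -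
  have "AE x in M. real_cond_exp M F (\<lambda>x. \<psi> (\<theta> j x) - c) x
      = real_cond_exp M F (\<lambda>x. \<psi> (\<theta> j x)) x - real_cond_exp M F (\<lambda>x. c) x"
    by (rule real_cond_exp_diff) (simp_all add: integrable_\<theta> assms)
  moreover have "AE x in M. real_cond_exp M F (\<lambda>x. c) x = c"
    by (rule real_cond_exp_F_meas) auto
  ultimately show ?thesis unfolding U_def by eventually_elim simp
qed

lemma U_sum:
  assumes "\<And>i. integrable M (\<psi> i)"
  shows "AE x in M. U j (\<lambda>x. \<Sum>i\<in>I. \<psi> i x) x = (\<Sum>i\<in>I. U j (\<psi> i) x)"
  unfolding U_def by (intro real_cond_exp_sum integrable_\<theta> assms)

lemma U_U:
  assumes "integrable M \<psi>" "AE x in M. 0 \<le> \<psi> x"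
  shows "AE x in M. U i (U j \<psi>) x = U (i + j) \<psi> x"
  using transfer_cond_exp[OF integrable_\<theta>[OF assms(1)] AE_\<theta>[OF assms(2)], of j i]
  by (simp add: U_def \<theta>_\<theta> add.commute)

text \<open>
  Garsia's proof of Hopf's maximal inequality. Let \<open>m\<close> be the running maximum of
  \<open>T j - j * l\<close>, which is nonnegative. Where it is positive, one step of the recursion and the monotonicity of \<open>U k\<close> give
  \<open>m \<le> f - l + U k m\<close>; integration and the invariance of the integral under \<open>U k\<close> show that
  \<open>f - l\<close> has nonnegative integral there.
\<close>

lemma maximal_inequality_finite:
  assumes f: "integrable M f" "AE x in M. 0 \<le> f x" and T: "\<And>n. integrable M (T n)"
    and T0: "\<And>x. T 0 x = 0" and T_Suc: "\<And>n. AE x in M. T (Suc n) x = f x + U k (T n) x"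
  shows "l * prob {x \<in> space M. \<exists>j\<le>n. real j * l < T j x} \<le> (\<integral>x. f x \<partial>M)"
proof -
  define R where "R j x = T j x - real j * l" for j x
  let ?m = "running_max R n"
  have R: "integrable M (R j)" for j unfolding R_def using T by simp
  have m: "integrable M ?m" by (rule integrable_running_max[OF R])
  have m_ge0: "0 \<le> ?m x" for x using running_max_ge[of 0 n R x] by (simp add: R_def T0)
  define B where "B = {x \<in> space M. 0 < ?m x}"
  have B: "B \<in> sets M" unfolding B_def using m by measurable
  have B_eq: "B = {x \<in> space M. \<exists>j\<le>n. real j * l < T j x}"
  proof -
    have "0 < ?m x \<longleftrightarrow> (\<exists>j\<le>n. real j * l < T j x)" for x
      using running_max_attained[of n R x] running_max_ge[of _ n R x]
      by (auto simp: R_def) (metis diff_gt_0_iff_gt less_le_trans)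
    then show ?thesis by (auto simp: B_def)
  qed
  have step: "AE x in M. \<forall>j<n. R (Suc j) x \<le> f x - l + U k ?m x"
  proof -
    have "AE x in M. R (Suc j) x \<le> f x - l + U k ?m x" if "j < n" for j
    proof -
      \<comment> \<open>monotonicity replaces each stage by the running maximum\<close>
      have "AE x in M. U k (R j) x \<le> U k ?m x"
        by (rule U_mono) (use that R m running_max_ge[of j n R] in auto)
      moreover have "AE x in M. U k (R j) x = U k (T j) x - real j * l"
        unfolding R_def by (rule U_diff_const[OF T])
      ultimately show ?thesis using T_Suc[of j]
        by eventually_elim (simp add: R_def algebra_simps)
    qed
    then show ?thesis by (subst AE_all_countable) (auto intro: AE_impI)
  qed
  have Um_ge0: "AE x in M. 0 \<le> U k ?m x"
    by (rule U_nonneg[OF _ m]) (use m_ge0 in simp)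
  have le: "AE x in M. ?m x \<le> indicator B x * (f x - l) + U k ?m x"
    using step Um_ge0 AE_space
  proof eventually_elim
    case (elim x)
    show ?case
    proof (cases "x \<in> B")
      case True
      obtain j where j: "j \<le> n" "?m x = R j x" using running_max_attained by metis
      have "j \<noteq> 0" using True j by (intro notI) (auto simp: B_def R_def T0)
      then obtain i where "j = Suc i" by (cases j) auto
      then show ?thesis using True elim(1) j by auto
    next
      case False
      then have "?m x = 0" using m_ge0[of x] elim(3) by (auto simp: B_def)
      then show ?thesis using False elim(2) by simp
    qed
  qed
  have iB: "integrable M (\<lambda>x. indicator B x * (f x - l))"
    using integrable_mult_indicator[OF B, of "\<lambda>x. f x - l"] f by simp
  have iB2: "integrable M (\<lambda>x. f x - l * indicator B x)"
    by (intro Bochner_Integration.integrable_diff f(1) integrable_mult_right integrable_real_indicator B)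
      (simp add: less_top[symmetric])
  have "(\<integral>x. ?m x \<partial>M) \<le> (\<integral>x. indicator B x * (f x - l) + U k ?m x \<partial>M)"
    by (rule integral_mono_AE) (use m iB le in auto)
  also have "\<dots> = (\<integral>x. indicator B x * (f x - l) \<partial>M) + (\<integral>x. ?m x \<partial>M)"
    using m iB by (simp add: integral_U integrable_U)
  finally have "0 \<le> (\<integral>x. indicator B x * (f x - l) \<partial>M)" by simp
  also have "\<dots> \<le> (\<integral>x. f x - l * indicator B x \<partial>M)"
  proof (rule integral_mono_AE[OF iB iB2])
    show "AE x in M. indicator B x * (f x - l) \<le> f x - l * indicator B x"
      using f(2) by eventually_elim (simp add: indicator_def)
  qed
  also have "\<dots> = (\<integral>x. f x \<partial>M) - l * prob B"
    using B sets.sets_into_space[OF B]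
    by (subst Bochner_Integration.integral_diff[OF f(1)])
      (auto simp: less_top[symmetric] Int_absorb1 simp del: indicator_simps intro!: integrable_real_indicator integrable_mult_right)
  finally show ?thesis by (simp add: B_eq)
qed

lemma maximal_inequality:
  fixes k :: nat
  assumes f: "integrable M f" "AE x in M. 0 \<le> f x" "f \<in> borel_measurable F" and l: "0 < l"
  defines "T \<equiv> \<lambda>n x. \<Sum>i<n. U (k * i) f x"
  shows "prob {x \<in> space M. \<exists>j. real j * l < T j x} \<le> (\<integral>x. f x \<partial>M) / l"
proof -
  have T: "integrable M (T n)" for n
    unfolding T_def using f by (intro Bochner_Integration.integrable_sum integrable_U)
  have U0: "AE x in M. U 0 f x = f x"
  proof -
    have "AE x in M. real_cond_exp M F (\<lambda>x. f (\<theta> 0 x)) x = real_cond_exp M F f x"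
      by (rule real_cond_exp_cong) (use \<theta>_0 f integrable_\<theta>[OF f(1), of 0] in \<open>auto elim: eventually_mono\<close>)
    with real_cond_exp_F_meas[OF f(1,3)] show ?thesis by (auto simp: U_def)
  qed
  have T_Suc: "AE x in M. T (Suc n) x = f x + U k (T n) x" for n
  proof -
    have "AE x in M. U k (T n) x = (\<Sum>i<n. U k (U (k * i) f) x)"
      unfolding T_def by (rule U_sum) (use f in auto)
    moreover have "AE x in M. \<forall>i. U k (U (k * i) f) x = U (k + k * i) f x"
      using U_U[OF f(1,2)] by (subst AE_all_countable) auto
    ultimately show ?thesis using U0
      by eventually_elim (simp add: T_def sum.lessThan_Suc_shift del: sum.lessThan_Suc)
  qed
  let ?B = "\<lambda>n. {x \<in> space M. \<exists>j\<le>n. real j * l < T j x}"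
  have B: "?B n \<in> sets M" for n using T by measurable
  have "(\<lambda>n. prob (?B n)) \<longlonglongrightarrow> prob (\<Union>n. ?B n)"
  proof (rule finite_Lim_measure_incseq)
    show "range ?B \<subseteq> sets M" using B by blast
    show "incseq ?B" unfolding incseq_def using le_trans by blast
  qed
  moreover have "prob (?B n) \<le> (\<integral>x. f x \<partial>M) / l" for n
    using maximal_inequality_finite[where f = f and T = T and k = k and l = l and n = n, OF f(1,2) T _ T_Suc] l
    by (simp add: T_def field_simps)
  ultimately have "prob (\<Union>n. ?B n) \<le> (\<integral>x. f x \<partial>M) / l"
    by (intro LIMSEQ_le_const2) auto
  also have "(\<Union>n. ?B n) = {x \<in> space M. \<exists>j. real j * l < T j x}" by auto
  finally show ?thesis .
qed

lemma excess_integral_tendsto_0: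
  fixes f :: "'a \<Rightarrow> real"
  assumes f: "integrable M f" "AE x in M. 0 \<le> f x"
  shows "(\<lambda>L. \<integral>x. max (f x - real L) 0 \<partial>M) \<longlonglongrightarrow> 0"
proof -
  have "(\<lambda>L. \<integral>x. max (f x - real L) 0 \<partial>M) \<longlonglongrightarrow> (\<integral>x. 0 \<partial>M)"
  proof (rule integral_dominated_convergence[where w = f])
    show "AE x in M. (\<lambda>L. max (f x - real L) 0) \<longlonglongrightarrow> 0"
    proof (rule AE_I2)
      fix x
      obtain N :: nat where "f x \<le> real N" using real_arch_simple by blast
      then have "\<forall>\<^sub>F L in sequentially. max (f x - real L) 0 = 0"
        by (auto simp: eventually_sequentially max_def intro!: exI[of _ N])
      then show "(\<lambda>L. max (f x - real L) 0) \<longlonglongrightarrow> 0" by (rule tendsto_eventually)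
    qed
    show "AE x in M. norm (max (f x - real L) 0) \<le> f x" for L
      using f(2) by eventually_elim (auto simp: max_def)
  qed (use f in auto)
  then show ?thesis by simp
qed

text \<open>
  Subadditivity bounds \<open>a n\<close> by a sum of \<open>n div k\<close> images of \<open>a k\<close>, plus fewer than
  \<open>k\<close> images of \<open>a 1\<close>. The averages of the former exceed \<open>k * l\<close> somewhere with probability at most
  \<open>(\<integral>a k / k) / l\<close>, which is small for suitable \<open>k\<close>. The latter are split at a high level \<open>L\<close>: the
  bounded parts contribute at most \<open>k * L\<close>, and the excess \<open>q L\<close> of \<open>a 1\<close> over \<open>L\<close> has small integral, so
  that the maximal inequality applies to it as well.
\<close>

theorem subadditive_zero_limit:
  fixes a :: "nat \<Rightarrow> 'a \<Rightarrow> real"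
  assumes int: "\<And>n. integrable M (a n)" and meas: "\<And>n. a n \<in> borel_measurable F"
    and nonneg: "\<And>n. AE x in M. 0 \<le> a n x" and zero: "AE x in M. a 0 x = 0"
    and subadd: "\<And>i j. AE x in M. a (i + j) x \<le> a i x + U i (a j) x"
    and lim: "(\<lambda>n. (\<integral>x. a n x \<partial>M) / real n) \<longlonglongrightarrow> 0"
  shows "AE x in M. (\<lambda>n. a n x / real n) \<longlonglongrightarrow> 0"
proof -
  \<comment> \<open>the excess of the first term over a level\<close>
  define q where "q L x = max (a 1 x - real L) 0" for L :: nat and x
  have q: "integrable M (q L)" "AE x in M. 0 \<le> q L x" "q L \<in> borel_measurable F" for L
    unfolding q_def using int[of 1] meas[of 1] by auto
  define T where "T k f n x = (\<Sum>i<n. U (k * i) f x)" for k f n x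
  have AE_bound: "AE x in M. \<forall>n. a n x \<le> T k (a k) (n div k) x + real (k * L) + T 1 (q L) n x"
    if k: "0 < k" for k L
  proof -
    have "AE x in M. \<forall>i j. a (i + j) x \<le> a i x + U i (a j) x"
      using subadd by (simp add: AE_all_countable)
    moreover have "AE x in M. \<forall>j. U j (a 1) x \<le> real L + U j (q L) x"
    proof -
      have "AE x in M. U j (a 1) x \<le> real L + U j (q L) x" for j
      proof -
        have "AE x in M. U j (\<lambda>x. a 1 x - real L) x \<le> U j (q L) x"
          by (rule U_mono) (use q int in \<open>auto simp: q_def\<close>)
        with U_diff_const[OF int[of 1], of j "real L"] show ?thesis
          by eventually_elim simp
      qed
      then show ?thesis by (simp add: AE_all_countable)
    qed
    moreover have "AE x in M. \<forall>j. 0 \<le> U j (q L) x"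
      using U_nonneg[OF q(2,1)] by (simp add: AE_all_countable)
    ultimately show ?thesis using zero
    proof eventually_elim
      case (elim x)
      have 1: "a (k * m) x \<le> T k (a k) m x" for m
      proof (induction m)
        case (Suc m)
        have "a (k * m + k) x \<le> a (k * m) x + U (k * m) (a k) x" using elim(1) by blast
        with Suc show ?case by (simp add: T_def add.commute)
      qed (simp add: T_def elim(4))
      have 2: "a (b + r) x \<le> a b x + (\<Sum>j<r. real L + U (b + j) (q L) x)" for b r
      proof (induction r)
        case (Suc r)
        have "a (b + r + 1) x \<le> a (b + r) x + U (b + r) (a 1) x" using elim(1) by blast
        moreover have "U (b + r) (a 1) x \<le> real L + U (b + r) (q L) x" using elim(2) by blast
        ultimately show ?case using Suc by simp
      qed simp
      show ?case
      proof
        fix n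
        define b where "b = k * (n div k)"
        define r where "r = n mod k"
        have n: "n = b + r" by (simp add: b_def r_def)
        have "r < k" using k by (simp add: r_def)
        have "(\<Sum>j<r. U (b + j) (q L) x) = (\<Sum>j\<in>{b..<b + r}. U j (q L) x)"
          using sum.shift_bounds_nat_ivl[of "\<lambda>j. U j (q L) x" 0 b r]
          by (simp add: atLeast0LessThan add.commute)
        also have "\<dots> \<le> (\<Sum>j<n. U j (q L) x)"
          by (rule sum_mono2) (use elim(3) n in auto)
        finally have "(\<Sum>j<r. U (b + j) (q L) x) \<le> T 1 (q L) n x" by (simp add: T_def)
        moreover have "real r * real L \<le> real (k * L)" using \<open>r < k\<close> by (simp add: mult_right_mono)
        moreover have "a n x \<le> a b x + real r * real L + (\<Sum>j<r. U (b + j) (q L) x)"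
          using 2[of b r] by (simp add: n sum.distrib)
        moreover have "a b x \<le> T k (a k) (n div k) x" using 1 by (simp add: b_def)
        ultimately show "a n x \<le> T k (a k) (n div k) x + real (k * L) + T 1 (q L) n x" by linarith
      qed
    qed
  qed
  have ev: "AE x in M. \<forall>\<^sub>F n in sequentially. a n x \<le> 3 * l * real n" if l: "0 < l" for l
  proof -
    define N where "N = {x \<in> space M. \<not> (\<forall>\<^sub>F n in sequentially. a n x \<le> 3 * l * real n)}"
    have N: "N \<in> sets M" unfolding N_def eventually_sequentially using int by measurable
    have "prob N \<le> \<epsilon>" if \<epsilon>: "0 < \<epsilon>" for \<epsilon>
    proof -
      have "\<forall>\<^sub>F n in sequentially. (\<integral>x. a n x \<partial>M) / real n < \<epsilon> / 2 * l"
        using lim \<epsilon> l by (intro order_tendstoD) auto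
      then obtain k where k: "(\<integral>x. a k x \<partial>M) / real k < \<epsilon> / 2 * l" "0 < k"
        using eventually_gt_at_top[of "0::nat"]
        by (metis (mono_tags, lifting) eventually_conj eventually_happens' sequentially_bot)
      have "\<forall>\<^sub>F L in sequentially. (\<integral>x. q L x \<partial>M) < \<epsilon> / 2 * l"
        using excess_integral_tendsto_0[OF int nonneg, of 1] \<epsilon> l unfolding q_def
        by (intro order_tendstoD) auto
      then obtain L where L: "(\<integral>x. q L x \<partial>M) < \<epsilon> / 2 * l"
        by (metis (mono_tags, lifting) eventually_happens' sequentially_bot)
      let ?B1 = "{x \<in> space M. \<exists>j. real j * (real k * l) < T k (a k) j x}"
      let ?B2 = "{x \<in> space M. \<exists>j. real j * l < T 1 (q L) j x}"
      have T_meas: "T k f j \<in> borel_measurable M" if "integrable M f" for k f j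
        unfolding T_def using integrable_U[OF that] by (intro borel_measurable_sum) auto
      note [measurable] = T_meas[OF int] T_meas[OF q(1)]
      have Bs: "?B1 \<in> sets M" "?B2 \<in> sets M" by measurable
      have "prob ?B1 \<le> (\<integral>x. a k x \<partial>M) / (real k * l)"
        unfolding T_def by (rule maximal_inequality) (use int nonneg meas k l in auto)
      also have "\<dots> \<le> \<epsilon> / 2" using k l by (simp add: field_simps)
      finally have 1: "prob ?B1 \<le> \<epsilon> / 2" .
      have "prob ?B2 \<le> (\<integral>x. q L x \<partial>M) / l"
        unfolding T_def by (rule maximal_inequality) (use q l in auto)
      also have "\<dots> \<le> \<epsilon> / 2" using L l by (simp add: field_simps)
      finally have 2: "prob ?B2 \<le> \<epsilon> / 2" .
      have "AE x in M. x \<in> N \<longrightarrow> x \<in> ?B1 \<union> ?B2"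
        using AE_bound[OF k(2), of L] AE_space
      proof eventually_elim
        case (elim x)
        show ?case
        proof (rule ccontr)
          assume "\<not> ?thesis"
          then have xN: "x \<in> N" and x1: "\<And>j. T k (a k) j x \<le> real j * (real k * l)"
            and x2: "\<And>j. T 1 (q L) j x \<le> real j * l"
            using elim(2) by (auto simp: not_less)
          have "a n x \<le> 3 * l * real n" if n: "real n \<ge> real (k * L) / l" for n
          proof -
            have "real (n div k) * real k \<le> real n"
              by (metis div_times_less_eq_dividend of_nat_le_iff of_nat_mult)
            then have "real (n div k) * (real k * l) \<le> real n * l"
              using l by (simp add: mult.assoc[symmetric] mult_right_mono)
            moreover have "real (k * L) \<le> real n * l" using n l by (simp add: field_simps)
            ultimately show ?thesis using elim(1)[rule_format, of n] x1[of "n div k"] x2[of n]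
              by (simp add: algebra_simps)
          qed
          moreover obtain n0 :: nat where "real (k * L) / l \<le> real n0" using real_arch_simple by blast
          ultimately have "\<forall>n\<ge>n0. a n x \<le> 3 * l * real n" by (meson of_nat_le_iff order_trans)
          then show False using xN by (auto simp: N_def eventually_sequentially)
        qed
      qed
      then have "prob N \<le> prob (?B1 \<union> ?B2)"
        by (rule finite_measure_mono_AE) (use Bs in auto)
      also have "\<dots> \<le> prob ?B1 + prob ?B2" by (rule measure_Un_le[OF Bs])
      finally show ?thesis using 1 2 by simp
    qed
    then have "prob N = 0"
      using field_le_epsilon[of "prob N" 0] measure_nonneg[of M N] by (simp add: order_antisym)
    then have "AE x in M. x \<notin> N" using N by (intro AE_not_in null_setsI) (auto simp: emeasure_eq_measure)
    with AE_space show ?thesis by eventually_elim (auto simp: N_def)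
  qed
  have "AE x in M. \<forall>i::nat. \<forall>\<^sub>F n in sequentially. a n x \<le> 3 * (1 / real (Suc i)) * real n"
    unfolding AE_all_countable by (intro allI ev) simp
  moreover have "AE x in M. \<forall>n. 0 \<le> a n x" using nonneg by (simp add: AE_all_countable)
  ultimately show ?thesis
  proof eventually_elim
    case (elim x)
    show ?case
    proof (rule LIMSEQ_I)
      fix r :: real assume r: "0 < r"
      obtain i :: nat where i: "3 / r < real (Suc i)"
        by (metis lessI less_trans of_nat_less_iff reals_Archimedean2)
      have "\<forall>\<^sub>F n in sequentially. 0 < n \<and> a n x \<le> 3 * (1 / real (Suc i)) * real n"
        using elim(1) by (intro eventually_conj eventually_gt_at_top) auto
      then obtain n0 where n0: "\<And>n. n \<ge> n0 \<Longrightarrow> 0 < n \<and> a n x \<le> 3 * (1 / real (Suc i)) * real n"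
        by (auto simp: eventually_sequentially)
      have "norm (a n x / real n - 0) < r" if "n \<ge> n0" for n
      proof -
        have "a n x / real n \<le> 3 / real (Suc i)" using n0[OF that] by (simp add: field_simps)
        also have "\<dots> < r" using i r by (simp add: field_simps)
        finally show ?thesis using elim(2) by simp
      qed
      then show "\<exists>n0. \<forall>n\<ge>n0. norm (a n x / real n - 0) < r" by blast
    qed
  qed
qed

end

section \<open>Laws of the positions and their entropy\<close>

context random_walk begin

definition p :: "nat \<Rightarrow> 'g \<Rightarrow> real" where
  "p n g = measure P (cylinder n g)"

lemma cylinder_sets [measurable]: "cylinder n g \<in> sets P"
proof -
  have "(\<lambda>x. x n) -` {g} \<inter> space path_space \<in> sets path_space"
    by (rule measurable_sets[OF measurable_coordinate]) simp
  then show ?thesis by (simp add: sets_P cylinder_def vimage_def)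
qed

lemma measurable_coord_P [measurable]: "(\<lambda>x. x n) \<in> P \<rightarrow>\<^sub>M count_space UNIV"
  using measurable_coordinate by (simp add: measurable_cong_sets[OF sets_P refl])

lemma measurable_restart_P [measurable]: "restart a \<in> P \<rightarrow>\<^sub>M P"
  using measurable_restart by (simp add: measurable_cong_sets[OF sets_P sets_P])

lemma measurable_at_coord:
  assumes "\<And>g. h g \<in> P \<rightarrow>\<^sub>M N"
  shows "(\<lambda>x. h (x n) x) \<in> P \<rightarrow>\<^sub>M N"
  by (rule measurable_compose_countable[OF assms measurable_coord_P])

lemma AE_at_coord:
  assumes "\<And>g. AE x in P. x n = g \<longrightarrow> R g x"
  shows "AE x in P. R (x n) x"
proof -
  have "AE x in P. \<forall>g. x n = g \<longrightarrow> R g x" unfolding AE_all_countable using assms by blast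
  then show ?thesis by eventually_elim simp
qed

lemma emeasure_cylinder: "emeasure P (cylinder n g) = ennreal (p n g)"
  by (simp add: p_def P.emeasure_eq_measure)

lemma p_nonneg [simp]: "0 \<le> p n g" by (simp add: p_def)

lemma p_le_1 [simp]: "p n g \<le> 1" by (simp add: p_def)

lemma nn_integral_split:
  assumes "\<And>g. h g \<in> borel_measurable P"
  shows "(\<integral>\<^sup>+x. h (x n) x \<partial>P) = (\<integral>\<^sup>+g. (\<integral>\<^sup>+x. h g x * indicator (cylinder n g) x \<partial>P) \<partial>count_space UNIV)"
proof -
  have "(\<integral>\<^sup>+x. h (x n) x \<partial>P) = (\<integral>\<^sup>+x. (\<integral>\<^sup>+g. h g x * indicator (cylinder n g) x \<partial>count_space UNIV) \<partial>P)"
  proof (rule nn_integral_cong)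
    fix x :: "nat \<Rightarrow> 'g"
    have "(\<integral>\<^sup>+g. h g x * indicator (cylinder n g) x \<partial>count_space UNIV)
        = (\<integral>\<^sup>+g. h (x n) x * indicator {x n} g \<partial>count_space UNIV)"
      by (rule nn_integral_cong) (auto simp: cylinder_def indicator_def)
    then show "h (x n) x = (\<integral>\<^sup>+g. h g x * indicator (cylinder n g) x \<partial>count_space UNIV)"
      by (simp add: nn_integral_cmult)
  qed
  also have "\<dots> = (\<integral>\<^sup>+g. (\<integral>\<^sup>+x. h g x * indicator (cylinder n g) x \<partial>P) \<partial>count_space UNIV)"
    by (rule nn_integral_count_space_nn_integral) (use assms in \<open>auto intro!: borel_measurable_times_ennreal\<close>)
  finally show ?thesis .
qed

lemma nn_integral_p: "(\<integral>\<^sup>+g. ennreal (p n g) \<partial>count_space UNIV) = 1"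
  using nn_integral_split[of "\<lambda>_ _. 1" n] by (simp add: emeasure_cylinder P.emeasure_space_1[simplified])

lemma AE_p_pos: "AE x in P. 0 < p n (x n)"
proof (rule AE_at_coord[where R = "\<lambda>g _. 0 < p n g"])
  fix g
  show "AE x in P. x n = g \<longrightarrow> 0 < p n g"
  proof (cases "p n g = 0")
    case True
    then have "AE x in P. x \<notin> cylinder n g"
      by (intro AE_not_in null_setsI) (auto simp: emeasure_cylinder)
    then show ?thesis by eventually_elim (auto simp: cylinder_def)
  qed (auto simp: less_le)
qed

lemma emeasure_restart:
  assumes E: "E \<in> sets P" and dep: "determined_by_past a E"
    and B: "B \<in> sets P"
  shows "emeasure P (E \<inter> restart a -` B) = emeasure P E * emeasure P B"
proof -
  have "restart a -` B \<in> sets P" using measurable_sets[OF measurable_restart_P B] by simp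
  then have "emeasure P (E \<inter> restart a -` B) = (\<integral>\<^sup>+x. indicator (E \<inter> restart a -` B) x \<partial>P)"
    using E by simp
  also have "\<dots> = (\<integral>\<^sup>+x. indicator E x * indicator B (restart a x) \<partial>P)"
    by (rule nn_integral_cong) (auto simp: indicator_def)
  also have "\<dots> = emeasure P E * emeasure P B"
    using nn_integral_restart[where E = E and a = a and \<psi> = "indicator B", OF E dep] B by simp
  finally show ?thesis .
qed

lemma nn_integral_restart_cylinder:
  assumes "\<psi> \<in> borel_measurable P"
  shows "(\<integral>\<^sup>+x. \<psi> (restart a x) * indicator (cylinder a g) x \<partial>P) = ennreal (p a g) * (\<integral>\<^sup>+x. \<psi> x \<partial>P)"
  using nn_integral_restart[where E = "cylinder a g" and a = a, OF cylinder_sets determined_by_past_cylinder[OF order_refl] assms]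
  by (simp add: emeasure_cylinder mult.commute)

lemma distr_restart: "distr P P (restart a) = P"
proof (rule measure_eqI)
  fix A assume "A \<in> sets (distr P P (restart a))"
  then show "emeasure (distr P P (restart a)) A = emeasure P A"
    using emeasure_restart[where E = UNIV and a = a and B = A, OF sets.top[of P, simplified] determined_by_past_UNIV]
    by (simp add: emeasure_distr P.emeasure_space_1[simplified])
qed simp

lemma AE_restart: "AE x in P. R x \<Longrightarrow> AE x in P. R (restart a x)"
  using AE_distrD[OF measurable_restart_P[of a], of R, unfolded distr_restart] by simp

lemma emeasure_two_cylinders:
  "emeasure P (cylinder a g \<inter> cylinder (a + b) (g + h)) = ennreal (p a g * p b h)"
proof -
  have "cylinder a g \<inter> cylinder (a + b) (g + h) = cylinder a g \<inter> restart a -` cylinder b h"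
    by (auto simp: cylinder_def restart_def add.assoc[symmetric])
  then show ?thesis
    using emeasure_restart[where E = "cylinder a g" and a = a and B = "cylinder b h", OF cylinder_sets determined_by_past_cylinder[OF order_refl] cylinder_sets]
    by (simp add: emeasure_cylinder ennreal_mult)
qed

lemma p_add_ge: "p a g * p b h \<le> p (a + b) (g + h)"
proof -
  have "ennreal (p a g * p b h) \<le> emeasure P (cylinder (a + b) (g + h))"
    unfolding emeasure_two_cylinders[symmetric] by (rule emeasure_mono) auto
  then show ?thesis by (simp add: emeasure_cylinder)
qed

lemma p_restart_ge: "p a (x a) * p b (restart a x b) \<le> p (a + b) (x (a + b))"
  using p_add_ge[of a "x a" b "restart a x b"] by (simp add: restart_def add.assoc[symmetric])

lemma p_0: "p 0 0 = 1"
proof -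
  have "emeasure P (cylinder 0 0) = emeasure Inc (walk 0 -` cylinder 0 0 \<inter> space Inc)"
    using cylinder_sets unfolding P_eq sets_P by (intro emeasure_distr measurable_walk_inc) (simp add: sets_P)
  also have "walk 0 -` cylinder 0 (0::'g) \<inter> space Inc = space Inc" by (auto simp: cylinder_def)
  finally show ?thesis using inc.emeasure_space_1 by (simp add: emeasure_cylinder)
qed

lemma AE_start: "AE x in P. x 0 = 0"
proof -
  have "AE x in P. x \<in> cylinder 0 0"
    by (rule P.AE_prob_1) (use p_0 in \<open>simp add: p_def\<close>)
  then show ?thesis by (simp add: cylinder_def)
qed

lemma p_1: "p 1 g = pmf \<mu> g"
proof -
  have "emeasure P (cylinder 1 g) = emeasure Inc (walk 0 -` cylinder 1 g \<inter> space Inc)"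
    using cylinder_sets unfolding P_eq sets_P by (intro emeasure_distr measurable_walk_inc) (simp add: sets_P)
  also have "walk 0 -` cylinder 1 g \<inter> space Inc = (\<lambda>h. h 0) -` {g} \<inter> space Inc"
    by (auto simp: cylinder_def)
  also have "emeasure Inc \<dots> = emeasure (distr Inc (measure_pmf \<mu>) (\<lambda>h. h 0)) {g}"
    using measurable_component_singleton[of 0 UNIV "\<lambda>_. measure_pmf \<mu>"] by (intro emeasure_distr[symmetric]) simp_all
  also have "\<dots> = ennreal (pmf \<mu> g)" by (simp add: inc.PiM_component emeasure_pmf_single)
  finally show ?thesis by (simp add: emeasure_cylinder)
qed

text \<open>
  The information content of the position at time \<open>n\<close>; its mean \<open>H n\<close> is the entropy of that position.
\<close>

definition info :: "nat \<Rightarrow> (nat \<Rightarrow> 'g) \<Rightarrow> real" where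
  "info n x = - ln (p n (x n))"

lemma info_measurable [measurable]: "info n \<in> borel_measurable P"
  unfolding info_def by (rule measurable_at_coord) simp

lemma info_nonneg: "0 \<le> info n x"
  unfolding info_def by (cases "p n (x n) = 0") (auto simp: less_le)

end

locale finite_entropy_walk = random_walk +
  assumes finite_entropy: "has_finite_entropy \<mu>"
begin

text \<open>
  This is where the finite entropy of the step distribution enters.
\<close>

lemma integrable_info_1: "integrable P (info 1)"
proof (rule integrableI_nonneg)
  have ps: "0 \<le> - (pmf \<mu> g * ln (pmf \<mu> g))" for g
    using mult_nonneg_nonpos[of "pmf \<mu> g" "ln (pmf \<mu> g)"] pmf_le_1[of \<mu> g]
    by (cases "pmf \<mu> g = 0") (auto simp: less_le ln_le_zero_iff)
  have "(\<integral>\<^sup>+x. ennreal (info 1 x) \<partial>P) = (\<integral>\<^sup>+g. (\<integral>\<^sup>+x. ennreal (- ln (p 1 g)) * indicator (cylinder 1 g) x \<partial>P) \<partial>count_space UNIV)"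
    unfolding info_def by (rule nn_integral_split[of "\<lambda>g x. ennreal (- ln (p 1 g))"]) simp
  also have "\<dots> = (\<integral>\<^sup>+g. ennreal (- (pmf \<mu> g * ln (pmf \<mu> g))) \<partial>count_space UNIV)"
  proof (rule nn_integral_cong)
    fix g
    have "0 \<le> - ln (pmf \<mu> g)" using pmf_le_1[of \<mu> g] by (cases "pmf \<mu> g = 0") (auto simp: less_le ln_le_zero_iff)
    then show "(\<integral>\<^sup>+x. ennreal (- ln (p 1 g)) * indicator (cylinder 1 g) x \<partial>P) = ennreal (- (pmf \<mu> g * ln (pmf \<mu> g)))"
      by (simp add: nn_integral_cmult nn_integral_multc emeasure_cylinder p_1 ennreal_mult[symmetric] mult.commute del: One_nat_def)
  qed
  also have "\<dots> < \<infinity>"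
  proof -
    have "Infinite_Sum.abs_summable_on (\<lambda>g. - (pmf \<mu> g * ln (pmf \<mu> g))) UNIV"
      using finite_entropy ps unfolding has_finite_entropy_def by (subst summable_on_iff_abs_summable_on_real[symmetric]) auto
    then have "integrable (count_space UNIV) (\<lambda>g. - (pmf \<mu> g * ln (pmf \<mu> g)))"
      by (simp only: abs_summable_equivalent abs_summable_on_def)
    then have "(\<integral>\<^sup>+g. ennreal (norm (- (pmf \<mu> g * ln (pmf \<mu> g)))) \<partial>count_space UNIV) < \<infinity>"
      by (simp add: integrable_iff_bounded)
    then show ?thesis using ps by (simp add: abs_of_nonpos)
  qed
  finally show "(\<integral>\<^sup>+x. ennreal (info 1 x) \<partial>P) < \<infinity>" .
qed (auto simp: info_nonneg)

lemma info_subadditive: "AE x in P. info (a + b) x \<le> info a x + info b (restart a x)"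
  using AE_p_pos[of a] AE_restart[OF AE_p_pos[of b], of a]
proof eventually_elim
  case (elim x)
  have "ln (p a (x a) * p b (restart a x b)) \<le> ln (p (a + b) (x (a + b)))"
    using elim p_restart_ge[of a x b] mult_pos_pos[of "p a (x a)" "p b (restart a x b)"]
    by (subst ln_le_cancel_iff) linarith+
  then show ?case using elim by (simp add: info_def ln_mult)
qed

lemma integrable_restart: "integrable P (\<psi> :: _ \<Rightarrow> real) \<Longrightarrow> integrable P (\<lambda>x. \<psi> (restart a x))"
  using integrable_distr[OF measurable_restart_P, of a \<psi>] by (simp add: distr_restart)

lemma integral_restart: "integrable P (\<psi> :: _ \<Rightarrow> real) \<Longrightarrow> (\<integral>x. \<psi> (restart a x) \<partial>P) = (\<integral>x. \<psi> x \<partial>P)"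
  using integral_distr[OF measurable_restart_P, of \<psi> a] by (simp add: distr_restart)

lemma info_0: "AE x in P. info 0 x = 0"
  using AE_start by eventually_elim (simp add: info_def p_0)

lemma integrable_info: "integrable P (info n)"
proof (induction n)
  case 0
  have "integrable P (info 0) = integrable P (\<lambda>x. 0 :: real)"
    by (rule integrable_cong_AE) (use info_0 in auto)
  then show ?case by simp
next
  case (Suc n)
  show ?case
  proof (rule Bochner_Integration.integrable_bound)
    show "integrable P (\<lambda>x. info n x + info 1 (restart n x))"
      using Suc integrable_restart[OF integrable_info_1] by simp
    show "AE x in P. norm (info (Suc n) x) \<le> norm (info n x + info 1 (restart n x))"
      using info_subadditive[of n 1] by eventually_elim (simp add: info_nonneg)
  qed simp
qed

definition H :: "nat \<Rightarrow> real" where "H n = (\<integral>x. info n x \<partial>P)"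

end

section \<open>Conditioning on a restart-compatible sigma-algebra\<close>

text \<open>
  The sigma-algebra \<open>F\<close> stands for the sets that a boundary quotient \<open>q\<close> can describe. On
  \<open>{x. x a = g}\<close> the boundary point of the path is \<open>g\<close> times that of the restarted path; the two
  assumptions are the resulting correspondence between events about \<open>q\<close> at the two paths.
\<close>

locale conditioned_walk = finite_entropy_walk +
  fixes F :: "(nat \<Rightarrow> 'a::{group_add,countable}) measure"
  assumes subalg: "subalgebra P F"
    and trace_restart: "\<And>A a g. A \<in> sets F \<Longrightarrow> 0 < p a g \<Longrightarrow>
      \<exists>A'\<in>sets F. AE x in P. x a = g \<longrightarrow> (x \<in> A \<longleftrightarrow> restart a x \<in> A')"
    and restart_trace: "\<And>A' a g. A' \<in> sets F \<Longrightarrow> 0 < p a g \<Longrightarrow>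
      \<exists>A\<in>sets F. AE x in P. x a = g \<longrightarrow> (x \<in> A \<longleftrightarrow> restart a x \<in> A')"
begin

sublocale cond: finite_measure_subalgebra P F
  by unfold_locales (rule subalg)

lemma sets_F_P: "A \<in> sets F \<Longrightarrow> A \<in> sets P"
  using subalg by (auto simp: subalgebra_def)

lemma measurable_F_P: "f \<in> F \<rightarrow>\<^sub>M N \<Longrightarrow> f \<in> P \<rightarrow>\<^sub>M N"
  by (rule measurable_from_subalg[OF subalg])

lemma space_F [simp]: "space F = UNIV"
  using subalg by (simp add: subalgebra_def)

lemma restart_sections:
  assumes A: "A \<in> sets F"
  shows "\<exists>A'. (\<forall>g. A' g \<in> sets F) \<and> (AE x in P. x \<in> A \<longleftrightarrow> restart a x \<in> A' (x a))"
proof -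
  have "\<exists>A'\<in>sets F. 0 < p a g \<longrightarrow> (AE x in P. x a = g \<longrightarrow> (x \<in> A \<longleftrightarrow> restart a x \<in> A'))" for g
    using trace_restart[OF A, of a g] by (cases "0 < p a g") auto
  then have "\<exists>A'. \<forall>g. A' g \<in> sets F \<and> (0 < p a g \<longrightarrow> (AE x in P. x a = g \<longrightarrow> (x \<in> A \<longleftrightarrow> restart a x \<in> A' g)))"
    by (intro choice) blast
  then obtain A' where A': "\<And>g. A' g \<in> sets F"
    "\<And>g. 0 < p a g \<Longrightarrow> AE x in P. x a = g \<longrightarrow> (x \<in> A \<longleftrightarrow> restart a x \<in> A' g)" by blast
  have "AE x in P. x \<in> A \<longleftrightarrow> restart a x \<in> A' (x a)"
  proof (rule AE_at_coord[where R = "\<lambda>g x. x \<in> A \<longleftrightarrow> restart a x \<in> A' g"])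
    fix g
    show "AE x in P. x a = g \<longrightarrow> (x \<in> A \<longleftrightarrow> restart a x \<in> A' g)"
    proof (cases "0 < p a g")
      case False
      then show ?thesis using AE_p_pos[of a] by (auto elim!: eventually_mono)
    qed (rule A'(2))
  qed
  with A'(1) show ?thesis by blast
qed

text \<open>
  The function version of the second compatibility assumption: on \<open>{x. x a = g}\<close>, evaluating an
  \<open>F\<close>-measurable function at the restarted path is again \<open>F\<close>-measurable.
\<close>

lemma measurable_restart_trace:
  fixes u :: "_ \<Rightarrow> ennreal"
  assumes u: "u \<in> borel_measurable F" and pos: "0 < p a g"
  shows "\<exists>v\<in>borel_measurable F. AE x in P. x a = g \<longrightarrow> v x = u (restart a x)"
  using u
proof (induction rule: borel_measurable_induct)
  case (cong f g)
  then show ?case by simp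
next
  case (set A')
  obtain A where A: "A \<in> sets F" "AE x in P. x a = g \<longrightarrow> (x \<in> A \<longleftrightarrow> restart a x \<in> A')"
    using restart_trace[OF set pos] by blast
  show ?case
    by (rule bexI[of _ "indicator A"]) (use A in \<open>auto simp: indicator_def elim: eventually_mono\<close>)
next
  case (mult u c)
  then obtain v where v: "v \<in> borel_measurable F" "AE x in P. x a = g \<longrightarrow> v x = u (restart a x)" by blast
  show ?case by (rule bexI[of _ "\<lambda>x. c * v x"]) (use v in \<open>auto elim: eventually_mono\<close>)
next
  case (add u1 u2)
  then obtain v1 v2 where v: "v1 \<in> borel_measurable F" "AE x in P. x a = g \<longrightarrow> v1 x = u1 (restart a x)"
    "v2 \<in> borel_measurable F" "AE x in P. x a = g \<longrightarrow> v2 x = u2 (restart a x)" by blast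
  have "AE x in P. x a = g \<longrightarrow> v1 x + v2 x = u1 (restart a x) + u2 (restart a x)"
    using v(2,4) by eventually_elim simp
  then show ?case by (intro bexI[of _ "\<lambda>x. v1 x + v2 x"]) (use v(1,3) in \<open>simp_all add: add.commute\<close>)
next
  case (seq u)
  have "\<exists>v. \<forall>i. v i \<in> borel_measurable F \<and> (AE x in P. x a = g \<longrightarrow> v i x = u i (restart a x))"
    by (rule choice) (use seq in blast)
  then obtain v where v: "\<And>i. v i \<in> borel_measurable F" "\<And>i. AE x in P. x a = g \<longrightarrow> v i x = u i (restart a x)"
    by blast
  have "AE x in P. \<forall>i. x a = g \<longrightarrow> v i x = u i (restart a x)" using v(2) by (simp only: AE_all_countable) blast
  then have "AE x in P. x a = g \<longrightarrow> (SUP i. v i x) = (SUP i. u i (restart a x))" by eventually_elim simp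
  then show ?case by (intro bexI[of _ "\<lambda>x. SUP i. v i x"]) (use v(1) in \<open>simp_all add: image_comp comp_def\<close>)
qed

definition cpe :: "nat \<Rightarrow> 'a \<Rightarrow> (nat \<Rightarrow> 'a) \<Rightarrow> ennreal" where
  "cpe n g = nn_cond_exp P F (indicator (cylinder n g))"

text \<open>
  The conditional probability of being at \<open>g\<close> at time \<open>n\<close>, made real-valued; the two versions
  differ on a null set at most.
\<close>

definition cp :: "nat \<Rightarrow> 'a \<Rightarrow> (nat \<Rightarrow> 'a) \<Rightarrow> real" where
  "cp n g x = enn2real (cpe n g x)"

text \<open>
  The conditional probability of the position that the path actually occupies at time \<open>n\<close>.
\<close>

definition \<phi> :: "nat \<Rightarrow> (nat \<Rightarrow> 'a) \<Rightarrow> real" where "\<phi> n x = cp n (x n) x"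

definition cond_info :: "nat \<Rightarrow> (nat \<Rightarrow> 'a) \<Rightarrow> real" where "cond_info n x = - ln (\<phi> n x)"

lemma cpe_meas [measurable]: "cpe n g \<in> borel_measurable F"
  by (simp add: cpe_def)

lemma cpe_meas_P [measurable]: "cpe n g \<in> borel_measurable P"
  by (simp add: cpe_def)

lemma cp_meas [measurable]: "cp n g \<in> borel_measurable F"
  unfolding cp_def by measurable

lemma cp_meas_P [measurable]: "cp n g \<in> borel_measurable P"
  unfolding cp_def by measurable

lemma \<phi>_meas [measurable]: "\<phi> n \<in> borel_measurable P"
  unfolding \<phi>_def by (rule measurable_at_coord) simp

lemma cond_info_meas [measurable]: "cond_info n \<in> borel_measurable P"
  unfolding cond_info_def by measurable

lemma cpe_le_1: "AE x in P. cpe n g x \<le> 1"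
proof -
  have "AE x in P. cpe n g x \<le> nn_cond_exp P F (\<lambda>_. 1) x"
    unfolding cpe_def by (rule cond.nn_cond_exp_mono) (auto simp: indicator_def)
  moreover have "AE x in P. 1 = nn_cond_exp P F (\<lambda>_. 1) x"
    by (rule cond.nn_cond_exp_F_meas) simp
  ultimately show ?thesis by eventually_elim simp
qed

lemma ennreal_cp: "AE x in P. ennreal (cp n g x) = cpe n g x"
  using cpe_le_1[of n g] by eventually_elim (simp add: cp_def le_less_trans[OF _ ennreal_one_less_top])

lemma cp_nonneg [simp]: "0 \<le> cp n g x" by (simp add: cp_def)

lemma cp_le_1: "AE x in P. cp n g x \<le> 1"
  using cpe_le_1[of n g] ennreal_cp[of n g] by eventually_elim (metis ennreal_le_1)

lemma cpe_integral:
  assumes "h \<in> borel_measurable F"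
  shows "(\<integral>\<^sup>+x. h x * cpe n g x \<partial>P) = (\<integral>\<^sup>+x. h x * indicator (cylinder n g) x \<partial>P)"
  unfolding cpe_def by (rule cond.nn_cond_exp_intg[OF assms]) simp

lemma cp_integral:
  assumes "h \<in> borel_measurable F"
  shows "(\<integral>\<^sup>+x. h x * ennreal (cp n g x) \<partial>P) = (\<integral>\<^sup>+x. h x * indicator (cylinder n g) x \<partial>P)"
proof -
  have "(\<integral>\<^sup>+x. h x * ennreal (cp n g x) \<partial>P) = (\<integral>\<^sup>+x. h x * cpe n g x \<partial>P)"
    by (rule nn_integral_cong_AE) (use ennreal_cp[of n g] in \<open>auto elim: eventually_mono\<close>)
  then show ?thesis using cpe_integral[OF assms] by simp
qed

lemma \<phi>_pos: "AE x in P. 0 < \<phi> n x"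
  unfolding \<phi>_def
proof (rule AE_at_coord[where R = "\<lambda>g x. 0 < cp n g x"])
  fix g
  let ?h = "\<lambda>x. indicator {x. cp n g x = 0} x :: ennreal"
  have "{x. cp n g x = 0} \<in> sets F" using measurable_sets[OF cp_meas, of "{0}" n g] by (simp add: vimage_def)
  then have h: "?h \<in> borel_measurable F" by simp
  have "(\<integral>\<^sup>+x. ?h x * indicator (cylinder n g) x \<partial>P) = (\<integral>\<^sup>+x. ?h x * ennreal (cp n g x) \<partial>P)"
    by (rule cp_integral[OF h, symmetric])
  also have "\<dots> = (\<integral>\<^sup>+x. 0 \<partial>P)" by (rule nn_integral_cong) (auto simp: indicator_def)
  finally have "(\<integral>\<^sup>+x. ?h x * indicator (cylinder n g) x \<partial>P) = 0" by simp
  then have "AE x in P. ?h x * indicator (cylinder n g) x = 0"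
    by (rule nn_integral_0_iff_AE[THEN iffD1, rotated]) (use measurable_F_P[OF h] in measurable)
  then show "AE x in P. x n = g \<longrightarrow> 0 < cp n g x"
    by eventually_elim (auto simp: cylinder_def indicator_def less_le split: if_splits)
qed

lemma \<phi>_le_1: "AE x in P. \<phi> n x \<le> 1"
  unfolding \<phi>_def
proof (rule AE_at_coord[where R = "\<lambda>g x. cp n g x \<le> 1"])
  fix g show "AE x in P. x n = g \<longrightarrow> cp n g x \<le> 1" using cp_le_1[of n g] by eventually_elim simp
qed

lemma cond_info_nonneg: "AE x in P. 0 \<le> cond_info n x"
  using \<phi>_pos[of n] \<phi>_le_1[of n] by eventually_elim (simp add: cond_info_def)

text \<open>
  Given the position at time \<open>n\<close>, the sets in \<open>F\<close> are independent of the past.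
\<close>

lemma emeasure_past_Int:
  assumes A: "A \<in> sets F" and pos: "0 < p n g"
  shows "\<exists>A'\<in>sets F. \<forall>E\<in>sets P. determined_by_past n E \<longrightarrow> E \<subseteq> cylinder n g \<longrightarrow>
    emeasure P (E \<inter> A) = emeasure P E * emeasure P A'"
proof -
  obtain A' where A': "A' \<in> sets F" "AE x in P. x n = g \<longrightarrow> (x \<in> A \<longleftrightarrow> restart n x \<in> A')"
    using trace_restart[OF A pos] by blast
  have A'P: "A' \<in> sets P" by (rule sets_F_P[OF A'(1)])
  have "emeasure P (E \<inter> A) = emeasure P E * emeasure P A'"
    if E: "E \<in> sets P" "determined_by_past n E" "E \<subseteq> cylinder n g" for E
  proof -
    have "emeasure P (E \<inter> A) = emeasure P (E \<inter> restart n -` A')"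
      by (rule emeasure_eq_AE)
        (use A'(2) sets_F_P[OF A] E measurable_sets[OF measurable_restart_P A'P, of n]
          in \<open>auto simp: cylinder_def elim!: eventually_mono\<close>)
    also have "\<dots> = emeasure P E * emeasure P A'" by (rule emeasure_restart[OF E(1,2) A'P])
    finally show ?thesis .
  qed
  with A'(1) show ?thesis by blast
qed

text \<open>
  By that independence, an event \<open>E\<close> of the past that fixes the position at time \<open>n\<close> is seen from
  \<open>F\<close> as a constant multiple of this position.
\<close>

lemma cond_exp_past:
  assumes E: "E \<in> sets P" "determined_by_past n E" "E \<subseteq> cylinder n g" and pos: "0 < p n g"
  shows "AE x in P. ennreal (p n g) * nn_cond_exp P F (indicator E) x = emeasure P E * cpe n g x"
proof -
  have *: "AE x in P. ennreal (p n g) * nn_cond_exp P F (indicator E) x = nn_cond_exp P F (\<lambda>x. ennreal (p n g) * indicator E x) x"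
    by (rule cond.nn_cond_exp_prod) (use E in auto)
  have "AE x in P. emeasure P E * cpe n g x = nn_cond_exp P F (\<lambda>x. ennreal (p n g) * indicator E x) x"
  proof (rule cond.nn_cond_exp_charact)
    fix B assume B: "B \<in> sets F"
    have BP: "B \<in> sets P" by (rule sets_F_P[OF B])
    obtain B' where key: "\<And>E. E \<in> sets P \<Longrightarrow> determined_by_past n E \<Longrightarrow> E \<subseteq> cylinder n g \<Longrightarrow>
      emeasure P (E \<inter> B) = emeasure P E * emeasure P B'"
      using emeasure_past_Int[OF B pos] by blast
    have "(\<integral>\<^sup>+x\<in>B. emeasure P E * cpe n g x \<partial>P) = (\<integral>\<^sup>+x. (emeasure P E * indicator B x) * cpe n g x \<partial>P)"
      by (simp add: mult_ac)
    also have "\<dots> = (\<integral>\<^sup>+x. (emeasure P E * indicator B x) * indicator (cylinder n g) x \<partial>P)"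
      by (rule cpe_integral) (use B in simp)
    also have "\<dots> = (\<integral>\<^sup>+x. emeasure P E * indicator (cylinder n g \<inter> B) x \<partial>P)"
      by (rule nn_integral_cong) (auto simp: indicator_def)
    also have "\<dots> = emeasure P E * emeasure P (cylinder n g \<inter> B)"
      using BP by (simp add: nn_integral_cmult)
    also have "\<dots> = ennreal (p n g) * emeasure P (E \<inter> B)"
      using key[OF E] key[OF cylinder_sets determined_by_past_cylinder[OF order_refl] subset_refl]
      by (simp add: emeasure_cylinder mult_ac)
    also have "\<dots> = (\<integral>\<^sup>+x. ennreal (p n g) * indicator (E \<inter> B) x \<partial>P)"
      using BP E(1) by (simp add: nn_integral_cmult)
    also have "\<dots> = (\<integral>\<^sup>+x\<in>B. ennreal (p n g) * indicator E x \<partial>P)"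
      by (rule nn_integral_cong) (auto simp: indicator_def)
    finally show "(\<integral>\<^sup>+x\<in>B. ennreal (p n g) * indicator E x \<partial>P) = (\<integral>\<^sup>+x\<in>B. emeasure P E * cpe n g x \<partial>P)" by simp
  next
    show "(\<lambda>x. ennreal (p n g) * indicator E x) \<in> borel_measurable P" using E(1) by simp
  qed simp
  with * show ?thesis by eventually_elim simp
qed

text \<open>
  In terms of the densities \<open>\<rho>\<^sub>n = \<phi> n / p n\<close>, which are \<open>dg\<nu>/d\<nu>\<close> at the boundary point
  for \<open>g\<close> the position at time \<open>n\<close>, this is the chain rule
  \<open>\<rho>\<^sub>a\<^sub>+\<^sub>b = \<rho>\<^sub>a * (\<rho>\<^sub>b \<circ> restart a)\<close>. Both sides compute the conditional probability of the
  event \<open>K\<close> of being at \<open>g\<close> at time \<open>a\<close> and at \<open>g + h\<close> at time \<open>a + b\<close>: first by restarting at time \<open>a\<close>, then by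
  conditional independence from the past at time \<open>a + b\<close>.
\<close>

lemma \<phi>_cocycle:
  "AE x in P. \<phi> (a + b) x * (p a (x a) * p b (restart a x b)) = p (a + b) (x (a + b)) * (\<phi> a x * \<phi> b (restart a x))"
proof -
  have *: "AE x in P. x a = g \<longrightarrow> restart a x b = h \<longrightarrow>
    cp (a + b) (g + h) x * (p a g * p b h) = p (a + b) (g + h) * (cp a g x * cp b h (restart a x))" for g h
  proof (cases "0 < p a g \<and> 0 < p b h")
    case False
    then have "p a g = 0 \<or> p b h = 0" using p_nonneg[of a g] p_nonneg[of b h] by linarith
    then show ?thesis
    proof
      assume "p a g = 0"
      then show ?thesis using AE_p_pos[of a] by (auto elim!: eventually_mono)
    next
      assume "p b h = 0"
      then show ?thesis using AE_restart[OF AE_p_pos[of b], of a] by (auto elim!: eventually_mono)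
    qed
  next
    case True
    obtain v where v: "v \<in> borel_measurable F" "AE x in P. x a = g \<longrightarrow> v x = cpe b h (restart a x)"
      using measurable_restart_trace[OF cpe_meas] True by blast
    note [measurable] = v(1) measurable_F_P[OF v(1)]
    \<comment> \<open>both factorisations below are conditional probabilities of this event\<close>
    let ?K = "cylinder a g \<inter> cylinder (a + b) (g + h)"
    let ?pab = "ennreal (p (a + b) (g + h))" and ?c = "ennreal (p a g * p b h)"
    have coord: "x (a + b) = x a + restart a x b" for x :: "nat \<Rightarrow> 'a"
      by (simp add: restart_def add.assoc[symmetric])
    have K_eq: "?K = cylinder a g \<inter> restart a -` cylinder b h"
      by (auto simp: cylinder_def restart_def add.assoc[symmetric])
    have "AE x in P. v x * cpe a g x = nn_cond_exp P F (indicator ?K) x"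
    proof (rule cond.nn_cond_exp_charact)
      fix A assume A: "A \<in> sets F"
      obtain A' where A': "A' \<in> sets F" "AE x in P. x a = g \<longrightarrow> (x \<in> A \<longleftrightarrow> restart a x \<in> A')"
        using trace_restart[OF A] True by blast
      have A'P: "A' \<in> sets P" and AP: "A \<in> sets P" using sets_F_P A A' by auto
      have "emeasure P (?K \<inter> A) = emeasure P (cylinder a g \<inter> restart a -` (cylinder b h \<inter> A'))"
        by (rule emeasure_eq_AE)
          (use A'(2) AP measurable_sets[OF measurable_restart_P, of "cylinder b h \<inter> A'" a] A'P
            in \<open>auto simp: K_eq cylinder_def coord elim!: eventually_mono\<close>)
      also have "\<dots> = ennreal (p a g) * emeasure P (cylinder b h \<inter> A')"
        by (subst emeasure_restart[OF cylinder_sets determined_by_past_cylinder[OF order_refl]])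
          (use A'P in \<open>auto simp: emeasure_cylinder\<close>)
      also have "emeasure P (cylinder b h \<inter> A') = (\<integral>\<^sup>+x. indicator A' x * indicator (cylinder b h) x \<partial>P)"
        using A'P by (simp add: indicator_inter_arith[symmetric] Int_commute)
      also have "\<dots> = (\<integral>\<^sup>+x. indicator A' x * cpe b h x \<partial>P)"
        by (rule cpe_integral[symmetric]) (use A' in simp)
      also have "ennreal (p a g) * \<dots> = (\<integral>\<^sup>+x. (indicator A' (restart a x) * cpe b h (restart a x)) * indicator (cylinder a g) x \<partial>P)"
        by (rule nn_integral_restart_cylinder[symmetric]) (use A'P in simp)
      also have "\<dots> = (\<integral>\<^sup>+x. (indicator A x * v x) * indicator (cylinder a g) x \<partial>P)"
        by (rule nn_integral_cong_AE) (use A'(2) v(2) in \<open>eventually_elim, auto simp: indicator_def cylinder_def\<close>)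
      also have "\<dots> = (\<integral>\<^sup>+x. (indicator A x * v x) * cpe a g x \<partial>P)"
        by (rule cpe_integral[symmetric]) (use A v in simp)
      also have "\<dots> = (\<integral>\<^sup>+x\<in>A. v x * cpe a g x \<partial>P)"
        by (rule nn_integral_cong) (simp add: mult_ac)
      finally show "(\<integral>\<^sup>+x\<in>A. indicator ?K x \<partial>P) = (\<integral>\<^sup>+x\<in>A. v x * cpe a g x \<partial>P)"
        using AP by (simp add: indicator_inter_arith[symmetric])
    qed measurable
    moreover have "AE x in P. ?pab * nn_cond_exp P F (indicator ?K) x = ?c * cpe (a + b) (g + h) x"
    proof -
      have pos: "0 < p (a + b) (g + h)"
        using True p_add_ge[of a g b h] mult_pos_pos[of "p a g" "p b h"] by linarith
      have "determined_by_past (a + b) ?K" by (simp add: determined_by_past_def cylinder_def)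
      from cond_exp_past[OF _ this _ pos] show ?thesis by (simp add: emeasure_two_cylinders)
    qed
    ultimately show ?thesis
      using v(2) ennreal_cp[of "a + b" "g + h"] ennreal_cp[of a g] AE_restart[OF ennreal_cp[of b h], of a]
    proof eventually_elim
      case (elim x)
      show ?case
      proof (intro impI)
        assume xa: "x a = g" "restart a x b = h"
        have "?c * cpe (a + b) (g + h) x = ?pab * (v x * cpe a g x)" unfolding elim(1) by (rule elim(2)[symmetric])
        then have "?c * ennreal (cp (a + b) (g + h) x) = ?pab * (ennreal (cp b h (restart a x)) * ennreal (cp a g x))"
          using elim(3-6) xa by simp
        then have "ennreal (p a g * p b h * cp (a + b) (g + h) x) = ennreal (p (a + b) (g + h) * (cp b h (restart a x) * cp a g x))"
          by (simp add: ennreal_mult)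
        then have "p a g * p b h * cp (a + b) (g + h) x = p (a + b) (g + h) * (cp b h (restart a x) * cp a g x)"
          by (subst (asm) ennreal_inj) auto
        then show "cp (a + b) (g + h) x * (p a g * p b h) = p (a + b) (g + h) * (cp a g x * cp b h (restart a x))"
          by (simp add: mult_ac)
      qed
    qed
  qed
  have "AE x in P. \<forall>g h. x a = g \<longrightarrow> restart a x b = h \<longrightarrow>
    cp (a + b) (g + h) x * (p a g * p b h) = p (a + b) (g + h) * (cp a g x * cp b h (restart a x))"
    unfolding AE_all_countable using * by blast
  then show ?thesis
  proof eventually_elim
    case (elim x)
    have "x a + restart a x b = x (a + b)" by (simp add: restart_def add.assoc[symmetric])
    with elim[rule_format, OF refl refl] show ?case by (simp add: \<phi>_def)
  qed
qed

lemma cond_info_cocycle: "AE x in P. cond_info (a + b) x + (info a x + info b (restart a x)) = info (a + b) x + (cond_info a x + cond_info b (restart a x))"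
  using \<phi>_cocycle[of a b] \<phi>_pos[of "a + b"] \<phi>_pos[of a] AE_restart[OF \<phi>_pos[of b], of a]
    AE_p_pos[of a] AE_p_pos[of "a + b"] AE_restart[OF AE_p_pos[of b], of a]
proof eventually_elim
  case (elim x)
  have "ln (\<phi> (a + b) x * (p a (x a) * p b (restart a x b))) = ln (p (a + b) (x (a + b)) * (\<phi> a x * \<phi> b (restart a x)))"
    using elim(1) by simp
  then show ?case using elim(2-) by (simp add: ln_mult cond_info_def info_def)
qed

lemma cond_info_subadditive: "AE x in P. cond_info (a + b) x \<le> cond_info a x + cond_info b (restart a x)"
  using cond_info_cocycle[of a b] info_subadditive[of a b] by eventually_elim simp

text \<open>
  Weighting by \<open>1 / \<phi> n\<close> cancels the conditional law of the position, up to the set where it vanishes.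
\<close>

lemma nn_integral_density_ratio:
  assumes r: "\<And>g. r g \<in> borel_measurable F" and r0: "\<And>g x. 0 \<le> r g x"
    and sub: "(\<integral>\<^sup>+g. (\<integral>\<^sup>+x. ennreal (r g x) \<partial>P) \<partial>count_space UNIV) \<le> 1"
  shows "(\<integral>\<^sup>+x. ennreal (r (x n) x / \<phi> n x) \<partial>P) \<le> 1"
proof -
  note [measurable] = r measurable_F_P[OF r]
  have "(\<integral>\<^sup>+x. ennreal (r (x n) x / \<phi> n x) \<partial>P)
      = (\<integral>\<^sup>+g. (\<integral>\<^sup>+x. ennreal (r g x / cp n g x) * indicator (cylinder n g) x \<partial>P) \<partial>count_space UNIV)"
    unfolding \<phi>_def by (rule nn_integral_split[of "\<lambda>g x. ennreal (r g x / cp n g x)"]) measurable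
  also have "\<dots> = (\<integral>\<^sup>+g. (\<integral>\<^sup>+x. ennreal (r g x / cp n g x) * ennreal (cp n g x) \<partial>P) \<partial>count_space UNIV)"
    by (intro nn_integral_cong cp_integral[symmetric]) measurable
  also have "\<dots> \<le> (\<integral>\<^sup>+g. (\<integral>\<^sup>+x. ennreal (r g x) \<partial>P) \<partial>count_space UNIV)"
  proof (intro nn_integral_mono)
    fix g x
    show "ennreal (r g x / cp n g x) * ennreal (cp n g x) \<le> ennreal (r g x)"
      using r0[of g x] by (cases "cp n g x = 0") (auto simp: ennreal_mult[symmetric])
  qed
  finally show ?thesis using sub by simp
qed

text \<open>
  Gibbs' inequality for the conditional law of the position against a competing family \<open>r\<close> of
  subprobability densities. With \<open>u\<close> the ratio of the two, \<open>u - 1 - ln u\<close> is nonnegative and vanishes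
  only at \<open>u = 1\<close>, while the mean of \<open>u\<close> is at most 1. This yields integrability, the
  inequality and its equality case.
\<close>

lemma gibbs_inequality:
  assumes r: "\<And>g. r g \<in> borel_measurable F" and r0: "\<And>g x. 0 \<le> r g x"
    and sub: "(\<integral>\<^sup>+g. (\<integral>\<^sup>+x. ennreal (r g x) \<partial>P) \<partial>count_space UNIV) \<le> 1"
    and pos: "AE x in P. 0 < r (x n) x" and int: "integrable P (\<lambda>x. - ln (r (x n) x))"
  shows "integrable P (cond_info n)" "(\<integral>x. cond_info n x \<partial>P) \<le> (\<integral>x. - ln (r (x n) x) \<partial>P)"
    "(\<integral>x. cond_info n x \<partial>P) = (\<integral>x. - ln (r (x n) x) \<partial>P) \<Longrightarrow> AE x in P. r (x n) x = \<phi> n x"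
proof -
  define u where "u x = r (x n) x / \<phi> n x" for x
  have rm: "(\<lambda>x. r (x n) x) \<in> borel_measurable P"
    by (rule measurable_at_coord) (rule measurable_F_P[OF r])
  have u_meas: "u \<in> borel_measurable P" unfolding u_def using rm by measurable
  have u_pos: "AE x in P. 0 < u x" using pos \<phi>_pos[of n] by eventually_elim (simp add: u_def)
  have nn: "(\<integral>\<^sup>+x. ennreal (u x) \<partial>P) \<le> 1" unfolding u_def by (rule nn_integral_density_ratio[OF r r0 sub])
  have u_int: "integrable P u"
    by (rule integrableI_nonneg) (use u_meas u_pos nn in \<open>auto elim: eventually_mono intro: le_less_trans\<close>)
  have u_le: "(\<integral>x. u x \<partial>P) \<le> 1"
  proof -
    have "ennreal (\<integral>x. u x \<partial>P) = (\<integral>\<^sup>+x. ennreal (u x) \<partial>P)"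
      by (rule nn_integral_eq_integral[symmetric, OF u_int]) (use u_pos in \<open>auto elim: eventually_mono\<close>)
    then show ?thesis using nn by (metis ennreal_le_1)
  qed
  have ln_u: "AE x in P. ln (u x) = ln (r (x n) x) + cond_info n x"
    using pos \<phi>_pos[of n] by eventually_elim (simp add: u_def ln_div cond_info_def)
  have le: "AE x in P. cond_info n x \<le> u x - 1 + - ln (r (x n) x)"
    using ln_u u_pos by eventually_elim (use ln_le_minus_one in force)
  show f_int: "integrable P (cond_info n)"
  proof (rule Bochner_Integration.integrable_bound)
    show "integrable P (\<lambda>x. u x - 1 + - ln (r (x n) x))"
      by (intro Bochner_Integration.integrable_add Bochner_Integration.integrable_diff u_int int) simp
    show "AE x in P. norm (cond_info n x) \<le> norm (u x - 1 + - ln (r (x n) x))"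
      using le cond_info_nonneg[of n] by eventually_elim simp
  qed simp
  have int_eq: "(\<integral>x. u x - 1 - (cond_info n x - - ln (r (x n) x)) \<partial>P) = (\<integral>x. u x \<partial>P) - 1 - ((\<integral>x. cond_info n x \<partial>P) - (\<integral>x. - ln (r (x n) x) \<partial>P))"
  proof -
    have "(\<integral>x. u x - 1 - (cond_info n x - - ln (r (x n) x)) \<partial>P) = (\<integral>x. u x - 1 \<partial>P) - (\<integral>x. cond_info n x - - ln (r (x n) x) \<partial>P)"
      by (intro Bochner_Integration.integral_diff Bochner_Integration.integrable_diff u_int f_int int) simp
    also have "(\<integral>x. u x - 1 \<partial>P) = (\<integral>x. u x \<partial>P) - 1"
      using u_int by (subst Bochner_Integration.integral_diff) (auto simp: P.prob_space[simplified])
    also have "(\<integral>x. cond_info n x - - ln (r (x n) x) \<partial>P) = (\<integral>x. cond_info n x \<partial>P) - (\<integral>x. - ln (r (x n) x) \<partial>P)"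
      by (rule Bochner_Integration.integral_diff[OF f_int int])
    finally show ?thesis .
  qed
  have nn': "AE x in P. 0 \<le> u x - 1 - (cond_info n x - - ln (r (x n) x))"
    using le by eventually_elim simp
  have "0 \<le> (\<integral>x. u x - 1 - (cond_info n x - - ln (r (x n) x)) \<partial>P)"
    by (rule integral_nonneg_AE[OF nn'])
  then show "(\<integral>x. cond_info n x \<partial>P) \<le> (\<integral>x. - ln (r (x n) x) \<partial>P)"
    using int_eq u_le by simp
  assume eq: "(\<integral>x. cond_info n x \<partial>P) = (\<integral>x. - ln (r (x n) x) \<partial>P)"
  have "(\<integral>x. u x - 1 - (cond_info n x - - ln (r (x n) x)) \<partial>P) = 0"
    using int_eq eq u_le \<open>0 \<le> (\<integral>x. u x - 1 - (cond_info n x - - ln (r (x n) x)) \<partial>P)\<close> by simp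
  moreover have "integrable P (\<lambda>x. u x - 1 - (cond_info n x - - ln (r (x n) x)))"
    by (intro Bochner_Integration.integrable_diff u_int f_int int) simp
  ultimately have "AE x in P. u x - 1 - (cond_info n x - - ln (r (x n) x)) = 0"
    using integral_nonneg_eq_0_iff_AE[OF _ nn'] by blast
  then show "AE x in P. r (x n) x = \<phi> n x"
    using ln_u u_pos \<phi>_pos[of n]
  proof eventually_elim
    case (elim x)
    have "ln (u x) = u x - 1" using elim(1,2) by simp
    then have "u x = 1" using elim(3) by (intro ln_eq_minus_one)
    then show ?case using elim(4) by (simp add: u_def)
  qed
qed

lemma integrable_cond_info: "integrable P (cond_info n)" and integral_cond_info_le: "(\<integral>x. cond_info n x \<partial>P) \<le> H n"
proof -
  have *: "(\<integral>\<^sup>+g. (\<integral>\<^sup>+x. ennreal (p n g) \<partial>P) \<partial>count_space UNIV) \<le> 1"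
    using nn_integral_p[of n] by (simp add: P.emeasure_space_1[simplified])
  have **: "integrable P (\<lambda>x. - ln (p n (x n)))" using integrable_info[of n] by (simp add: info_def[abs_def])
  show "integrable P (cond_info n)"
    by (rule gibbs_inequality(1)[where r = "\<lambda>g x. p n g"]) (use * ** AE_p_pos[of n] in auto)
  show "(\<integral>x. cond_info n x \<partial>P) \<le> H n"
    unfolding H_def info_def by (rule gibbs_inequality(2)[where r = "\<lambda>g x. p n g"]) (use * ** AE_p_pos[of n] in auto)
qed

text \<open>
  The mutual information of \<open>F\<close> and the position at time \<open>n\<close>. The cocycle identity makes it linear in \<open>n\<close>.
\<close>

definition D :: "nat \<Rightarrow> real" where "D n = H n - (\<integral>x. cond_info n x \<partial>P)"

lemma D_add: "D (a + b) = D a + D b"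
proof -
  have "(\<integral>x. cond_info (a + b) x + (info a x + info b (restart a x)) \<partial>P) = (\<integral>x. info (a + b) x + (cond_info a x + cond_info b (restart a x)) \<partial>P)"
    by (rule integral_cong_AE) (use cond_info_cocycle[of a b] in measurable)
  then show ?thesis
    by (simp add: integrable_cond_info integrable_info integrable_restart integral_restart D_def H_def)
qed

lemma D_eq: "D n = real n * D 1"
proof (induction n)
  case 0 show ?case using D_add[of 0 0] by simp
next
  case (Suc n) then show ?case using D_add[of n 1] by (simp add: algebra_simps)
qed

lemma cond_info_0: "AE x in P. cond_info 0 x = 0"
proof -
  have "H 0 = 0" unfolding H_def using info_0 by (subst integral_cong_AE[of _ _ "\<lambda>_. 0"]) auto
  then have "(\<integral>x. cond_info 0 x \<partial>P) = 0" using D_eq[of 0] by (simp add: D_def)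
  then show ?thesis using integral_nonneg_eq_0_iff_AE[OF integrable_cond_info cond_info_nonneg, of 0] by simp
qed

lemma ennreal_real_cond_exp:
  assumes "integrable P \<psi>" "AE x in P. 0 \<le> \<psi> x"
  shows "AE x in P. ennreal (real_cond_exp P F \<psi> x) = nn_cond_exp P F (\<lambda>x. ennreal (\<psi> x)) x"
proof -
  have [measurable]: "\<psi> \<in> borel_measurable P" using assms(1) by auto
  have "AE x in P. nn_cond_exp P F (\<lambda>x. ennreal (- \<psi> x)) x = nn_cond_exp P F (\<lambda>x. 0) x"
    by (rule cond.nn_cond_exp_cong) (use assms(2) in \<open>auto simp: ennreal_neg elim!: eventually_mono\<close>)
  moreover have "AE x in P. 0 = nn_cond_exp P F (\<lambda>x. 0) x" by (rule cond.nn_cond_exp_F_meas) simp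
  moreover have "AE x in P. nn_cond_exp P F (\<lambda>x. ennreal (\<psi> x)) x \<noteq> \<infinity>"
  proof (rule nn_integral_PInf_AE)
    have "(\<integral>\<^sup>+x. nn_cond_exp P F (\<lambda>x. ennreal (\<psi> x)) x \<partial>P) = (\<integral>\<^sup>+x. ennreal (\<psi> x) \<partial>P)"
      using cond.nn_cond_exp_intg[of "\<lambda>_. 1" "\<lambda>x. ennreal (\<psi> x)"] by simp
    also have "\<dots> < \<infinity>" using assms by (simp add: nn_integral_eq_integral)
    finally show "(\<integral>\<^sup>+x. nn_cond_exp P F (\<lambda>x. ennreal (\<psi> x)) x \<partial>P) \<noteq> \<infinity>" by simp
  qed simp
  ultimately show ?thesis
    by eventually_elim (auto simp: real_cond_exp_def less_top)
qed

text \<open>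
  Disintegration over the position at time \<open>a\<close>. The sets \<open>A'\<close> do not depend on the integrand, so
  that an integrand may be replaced by its conditional expectation.
\<close>

lemma nn_set_integral_restart:
  assumes A: "A \<in> sets F"
  shows "\<exists>A'. (\<forall>g. A' g \<in> sets F) \<and> (\<forall>\<psi>\<in>borel_measurable P. (\<integral>\<^sup>+x\<in>A. \<psi> (restart a x) \<partial>P)
    = (\<integral>\<^sup>+g. ennreal (p a g) * (\<integral>\<^sup>+x. indicator (A' g) x * \<psi> x \<partial>P) \<partial>count_space UNIV))"
proof -
  obtain A' where A': "\<And>g. A' g \<in> sets F" "AE x in P. x \<in> A \<longleftrightarrow> restart a x \<in> A' (x a)"
    using restart_sections[OF A] by blast
  have "(\<integral>\<^sup>+x\<in>A. \<psi> (restart a x) \<partial>P)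
    = (\<integral>\<^sup>+g. ennreal (p a g) * (\<integral>\<^sup>+x. indicator (A' g) x * \<psi> x \<partial>P) \<partial>count_space UNIV)"
    if \<psi>: "\<psi> \<in> borel_measurable P" for \<psi> :: "_ \<Rightarrow> ennreal"
  proof -
    have m: "(\<lambda>x. \<psi> (restart a x)) \<in> borel_measurable P" by (rule measurable_compose[OF measurable_restart_P \<psi>])
    have "(\<integral>\<^sup>+x\<in>A. \<psi> (restart a x) \<partial>P)
      = (\<integral>\<^sup>+g. (\<integral>\<^sup>+x. (\<psi> (restart a x) * indicator A x) * indicator (cylinder a g) x \<partial>P) \<partial>count_space UNIV)"
      by (rule nn_integral_split) (use m sets_F_P[OF A] in \<open>auto intro!: borel_measurable_times_ennreal\<close>)
    also have "\<dots> = (\<integral>\<^sup>+g. ennreal (p a g) * (\<integral>\<^sup>+x. indicator (A' g) x * \<psi> x \<partial>P) \<partial>count_space UNIV)"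
    proof (rule nn_integral_cong)
      fix g
      have m': "(\<lambda>x. indicator (A' g) x * \<psi> x) \<in> borel_measurable P"
        using sets_F_P[OF A'(1)] \<psi> by (intro borel_measurable_times_ennreal borel_measurable_indicator)
      have "(\<integral>\<^sup>+x. (\<psi> (restart a x) * indicator A x) * indicator (cylinder a g) x \<partial>P)
        = (\<integral>\<^sup>+x. (indicator (A' g) (restart a x) * \<psi> (restart a x)) * indicator (cylinder a g) x \<partial>P)"
        by (rule nn_integral_cong_AE)
          (use A'(2) in \<open>eventually_elim, auto simp: indicator_def cylinder_def\<close>)
      also have "\<dots> = ennreal (p a g) * (\<integral>\<^sup>+x. indicator (A' g) x * \<psi> x \<partial>P)"
        by (rule nn_integral_restart_cylinder[OF m'])
      finally show "(\<integral>\<^sup>+x. (\<psi> (restart a x) * indicator A x) * indicator (cylinder a g) x \<partial>P)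
        = ennreal (p a g) * (\<integral>\<^sup>+x. indicator (A' g) x * \<psi> x \<partial>P)" .
    qed
    finally show ?thesis .
  qed
  with A'(1) show ?thesis by blast
qed

text \<open>
  The semigroup property of the conditioned walk.
\<close>

lemma nn_cond_exp_restart:
  assumes \<psi>: "\<psi> \<in> borel_measurable P"
  shows "AE x in P. nn_cond_exp P F (\<lambda>x. nn_cond_exp P F \<psi> (restart a x)) x = nn_cond_exp P F (\<lambda>x. \<psi> (restart a x)) x"
proof (rule AE_symmetric, rule cond.nn_cond_exp_charact)
  have m: "(\<lambda>x. \<phi> (restart a x)) \<in> borel_measurable P" if "\<phi> \<in> borel_measurable P" for \<phi> :: "_ \<Rightarrow> ennreal"
    by (rule measurable_compose[OF measurable_restart_P that])
  show "(\<lambda>x. nn_cond_exp P F \<psi> (restart a x)) \<in> borel_measurable P" by (rule m) simp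
  fix A assume A: "A \<in> sets F"
  obtain A' where A': "\<And>g. A' g \<in> sets F" and eq: "\<And>\<psi>. \<psi> \<in> borel_measurable P \<Longrightarrow> (\<integral>\<^sup>+x\<in>A. \<psi> (restart a x) \<partial>P)
    = (\<integral>\<^sup>+g. ennreal (p a g) * (\<integral>\<^sup>+x. indicator (A' g) x * \<psi> x \<partial>P) \<partial>count_space UNIV)"
    using nn_set_integral_restart[OF A, of a] by blast
  have "(\<integral>\<^sup>+x\<in>A. nn_cond_exp P F \<psi> (restart a x) \<partial>P)
    = (\<integral>\<^sup>+g. ennreal (p a g) * (\<integral>\<^sup>+x. indicator (A' g) x * nn_cond_exp P F \<psi> x \<partial>P) \<partial>count_space UNIV)"
    by (rule eq) simp
  also have "\<dots> = (\<integral>\<^sup>+g. ennreal (p a g) * (\<integral>\<^sup>+x. indicator (A' g) x * \<psi> x \<partial>P) \<partial>count_space UNIV)"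
    by (intro nn_integral_cong arg_cong2[where f = "(*)"] refl cond.nn_cond_exp_intg \<psi>) (use A' in simp)
  also have "\<dots> = (\<integral>\<^sup>+x\<in>A. \<psi> (restart a x) \<partial>P)" by (rule eq[OF \<psi>, symmetric])
  also have "\<dots> = (\<integral>\<^sup>+x. indicator A x * \<psi> (restart a x) \<partial>P)" by (simp add: mult.commute)
  also have "\<dots> = (\<integral>\<^sup>+x. indicator A x * nn_cond_exp P F (\<lambda>x. \<psi> (restart a x)) x \<partial>P)"
    by (rule cond.nn_cond_exp_intg[symmetric]) (use A m[OF \<psi>] in auto)
  also have "\<dots> = (\<integral>\<^sup>+x\<in>A. nn_cond_exp P F (\<lambda>x. \<psi> (restart a x)) x \<partial>P)" by (simp add: mult.commute)
  finally show "(\<integral>\<^sup>+x\<in>A. nn_cond_exp P F \<psi> (restart a x) \<partial>P) = (\<integral>\<^sup>+x\<in>A. nn_cond_exp P F (\<lambda>x. \<psi> (restart a x)) x \<partial>P)" .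
qed simp

lemma restart_0: "AE x in P. restart 0 x = x"
  using AE_start by eventually_elim (simp add: restart_def)

sublocale trans: transfer_semigroup P F restart
proof
  fix \<psi> :: "(nat \<Rightarrow> 'a) \<Rightarrow> real" and j assume \<psi>: "integrable P \<psi>" "AE x in P. 0 \<le> \<psi> x"
  have [measurable]: "\<psi> \<in> borel_measurable P" using \<psi> by auto
  have \<psi>': "integrable P (\<lambda>x. \<psi> (restart j x))" "AE x in P. 0 \<le> \<psi> (restart j x)"
    using integrable_restart[OF \<psi>(1)] AE_restart[OF \<psi>(2)] by auto
  let ?E = "real_cond_exp P F \<psi>"
  have E: "integrable P ?E" "AE x in P. 0 \<le> ?E x"
    using cond.real_cond_exp_int(1)[OF \<psi>(1)] cond.real_cond_exp_pos[OF \<psi>(2)] by auto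
  have E': "integrable P (\<lambda>x. ?E (restart j x))" "AE x in P. 0 \<le> ?E (restart j x)"
    using integrable_restart[OF E(1)] AE_restart[OF E(2)] by auto
  have n1: "AE x in P. 0 \<le> real_cond_exp P F (\<lambda>x. ?E (restart j x)) x"
    by (rule cond.real_cond_exp_pos[OF E'(2)]) (use E'(1) in auto)
  have n2: "AE x in P. 0 \<le> real_cond_exp P F (\<lambda>x. \<psi> (restart j x)) x"
    by (rule cond.real_cond_exp_pos[OF \<psi>'(2)]) (use \<psi>'(1) in auto)
  have "AE x in P. nn_cond_exp P F (\<lambda>x. ennreal (?E (restart j x))) x
      = nn_cond_exp P F (\<lambda>x. nn_cond_exp P F (\<lambda>x. ennreal (\<psi> x)) (restart j x)) x"
    by (rule cond.nn_cond_exp_cong)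
      (use AE_restart[OF ennreal_real_cond_exp[OF \<psi>]] in \<open>auto intro!: measurable_compose[OF measurable_restart_P]\<close>)
  moreover have "AE x in P. nn_cond_exp P F (\<lambda>x. nn_cond_exp P F (\<lambda>x. ennreal (\<psi> x)) (restart j x)) x
     = nn_cond_exp P F (\<lambda>x. ennreal (\<psi> (restart j x))) x"
    by (rule nn_cond_exp_restart) measurable
  ultimately show "AE x in P. real_cond_exp P F (\<lambda>x. ?E (restart j x)) x = real_cond_exp P F (\<lambda>x. \<psi> (restart j x)) x"
    using ennreal_real_cond_exp[OF E'] ennreal_real_cond_exp[OF \<psi>'] n1 n2
    by eventually_elim (metis ennreal_inj)
qed (auto simp: subalg distr_restart restart_restart add.commute restart_0)

lemma transfer_full: "transfer_semigroup P P restart"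
proof
  show "subalgebra P P" by (simp add: subalgebra_def)
  then interpret full: finite_measure_subalgebra P P by unfold_locales
  fix \<psi> :: "(nat \<Rightarrow> 'a) \<Rightarrow> real" and j assume \<psi>: "integrable P \<psi>"
  have "AE x in P. real_cond_exp P P \<psi> x = \<psi> x"
    by (rule full.real_cond_exp_F_meas) (use \<psi> in auto)
  then show "AE x in P. real_cond_exp P P (\<lambda>x. real_cond_exp P P \<psi> (restart j x)) x = real_cond_exp P P (\<lambda>x. \<psi> (restart j x)) x"
    by (intro full.real_cond_exp_cong AE_restart) (use \<psi> in \<open>auto intro!: measurable_compose[OF measurable_restart_P]\<close>)
qed (auto simp: distr_restart restart_restart add.commute restart_0)

lemma cond_info_rate_zero:
  assumes lim: "(\<lambda>n. (\<integral>x. cond_info n x \<partial>P) / real n) \<longlonglongrightarrow> 0"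
  shows "AE x in P. (\<lambda>n. cond_info n x / real n) \<longlonglongrightarrow> 0"
proof -
  interpret full: transfer_semigroup P P restart by (rule transfer_full)
  show ?thesis
  proof (rule full.subadditive_zero_limit)
    fix i j
    have "AE x in P. full.U i (cond_info j) x = cond_info j (restart i x)"
      unfolding full.U_def by (rule full.real_cond_exp_F_meas)
        (use integrable_restart[OF integrable_cond_info] in \<open>auto intro: borel_measurable_integrable\<close>)
    with cond_info_subadditive[of i j] show "AE x in P. cond_info (i + j) x \<le> cond_info i x + full.U i (cond_info j) x"
      by eventually_elim simp
  qed (use integrable_cond_info cond_info_nonneg cond_info_0 lim in auto)
qed

text \<open>
  The conditional mean of \<open>cond_info n\<close> given \<open>F\<close> is the entropy of the position at time \<open>n\<close> under the
  conditional measure; this is what convergence in mean under that measure requires.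
\<close>

lemma expected_cond_info_rate_zero:
  assumes lim: "(\<lambda>n. (\<integral>x. cond_info n x \<partial>P) / real n) \<longlonglongrightarrow> 0"
  shows "AE x in P. (\<lambda>n. real_cond_exp P F (cond_info n) x / real n) \<longlonglongrightarrow> 0"
proof (rule trans.subadditive_zero_limit)
  show "AE x in P. real_cond_exp P F (cond_info 0) x = 0"
  proof -
    have "AE x in P. real_cond_exp P F (cond_info 0) x = real_cond_exp P F (\<lambda>_. 0) x"
      by (rule cond.real_cond_exp_cong) (use cond_info_0 in auto)
    moreover have "AE x in P. real_cond_exp P F (\<lambda>_. 0) x = 0" by (rule cond.real_cond_exp_F_meas) auto
    ultimately show ?thesis by eventually_elim simp
  qed
  show "AE x in P. 0 \<le> real_cond_exp P F (cond_info n) x" for n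
    by (rule cond.real_cond_exp_pos[OF cond_info_nonneg]) simp
  show "integrable P (real_cond_exp P F (cond_info n))" for n by (rule cond.real_cond_exp_int[OF integrable_cond_info])
  show "(\<lambda>n. (\<integral>x. real_cond_exp P F (cond_info n) x \<partial>P) / real n) \<longlonglongrightarrow> 0"
    using lim by (simp add: cond.real_cond_exp_int[OF integrable_cond_info])
  fix i j
  have ir: "integrable P (\<lambda>x. cond_info j (restart i x))" by (rule integrable_restart[OF integrable_cond_info])
  have "AE x in P. real_cond_exp P F (cond_info (i + j)) x \<le> real_cond_exp P F (\<lambda>x. cond_info i x + cond_info j (restart i x)) x"
    by (rule cond.real_cond_exp_mono[OF cond_info_subadditive]) (use integrable_cond_info ir in auto)
  moreover have "AE x in P. real_cond_exp P F (\<lambda>x. cond_info i x + cond_info j (restart i x)) x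
     = real_cond_exp P F (cond_info i) x + real_cond_exp P F (\<lambda>x. cond_info j (restart i x)) x"
    by (rule cond.real_cond_exp_add[OF integrable_cond_info ir])
  moreover have "AE x in P. trans.U i (real_cond_exp P F (cond_info j)) x = real_cond_exp P F (\<lambda>x. cond_info j (restart i x)) x"
    unfolding trans.U_def by (rule trans.transfer_cond_exp[OF integrable_cond_info cond_info_nonneg])
  ultimately show "AE x in P. real_cond_exp P F (cond_info (i + j)) x \<le> real_cond_exp P F (cond_info i) x + trans.U i (real_cond_exp P F (cond_info j)) x"
    by eventually_elim simp
qed simp

lemma cond_info_le_sum: "AE x in P. cond_info n x \<le> (\<Sum>i<n. cond_info 1 (restart i x))"
proof (induction n)
  case 0 show ?case using cond_info_0 by eventually_elim simp
next
  case (Suc n)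
  then show ?case using cond_info_subadditive[of n 1] by eventually_elim simp
qed

text \<open>
  Subadditivity bounds \<open>cond_info n / n\<close> by averages along the restarts of the integrable function
  \<open>cond_info 1\<close>. Cutting the latter at a level \<open>L\<close> leaves a bounded part, for which
  dominated convergence applies, and averages of an excess of small mean.
\<close>

lemma integral_rate_zero:
  assumes ae: "AE x in P. (\<lambda>n. cond_info n x / real n) \<longlonglongrightarrow> 0"
  shows "(\<lambda>n. (\<integral>x. cond_info n x \<partial>P) / real n) \<longlonglongrightarrow> 0"
proof (rule LIMSEQ_I)
  fix \<epsilon> :: real assume \<epsilon>: "0 < \<epsilon>"
  define q where "q L x = max (cond_info 1 x - real L) 0" for L :: nat and x
  have q: "integrable P (q L)" for L unfolding q_def using integrable_cond_info[of 1] by auto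
  have "\<forall>\<^sub>F L in sequentially. (\<integral>x. q L x \<partial>P) < \<epsilon> / 2"
    unfolding q_def using trans.excess_integral_tendsto_0[OF integrable_cond_info cond_info_nonneg, of 1] \<epsilon> by (intro order_tendstoD) auto
  then obtain L where L: "(\<integral>x. q L x \<partial>P) < \<epsilon> / 2"
    by (metis (mono_tags, lifting) eventually_happens' sequentially_bot)
  let ?m = "\<lambda>n x. min (cond_info n x / real n) (real L)"
  have "(\<lambda>n. \<integral>x. ?m n x \<partial>P) \<longlonglongrightarrow> (\<integral>x. 0 \<partial>P)"
  proof (rule integral_dominated_convergence[where w = "\<lambda>_. real L"])
    show "AE x in P. (\<lambda>n. ?m n x) \<longlonglongrightarrow> 0"
      using ae
    proof eventually_elim
      case (elim x)
      show ?case using tendsto_min[OF elim tendsto_const[of "real L"]] by simp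
    qed
    show "AE x in P. norm (?m n x) \<le> real L" for n using cond_info_nonneg[of n] by eventually_elim auto
  qed auto
  then have "\<forall>\<^sub>F n in sequentially. (\<integral>x. ?m n x \<partial>P) < \<epsilon> / 2" using \<epsilon> by (intro order_tendstoD) auto
  then obtain n0 where n0: "\<And>n. n \<ge> n0 \<Longrightarrow> (\<integral>x. ?m n x \<partial>P) < \<epsilon> / 2" by (auto simp: eventually_sequentially)
  have "(\<integral>x. cond_info n x \<partial>P) / real n < \<epsilon>" if n: "n \<ge> max 1 n0" for n
  proof -
    have m: "integrable P (?m n)" using integrable_cond_info[of n] by auto
    have qs: "integrable P (\<lambda>x. (\<Sum>i<n. q L (restart i x)) / real n)"
      by (intro integrable_divide Bochner_Integration.integrable_sum integrable_restart q)
    have "(\<integral>x. cond_info n x \<partial>P) / real n = (\<integral>x. cond_info n x / real n \<partial>P)" by simp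
    also have "\<dots> \<le> (\<integral>x. ?m n x + (\<Sum>i<n. q L (restart i x)) / real n \<partial>P)"
    proof (rule integral_mono_AE)
      show "AE x in P. cond_info n x / real n \<le> ?m n x + (\<Sum>i<n. q L (restart i x)) / real n"
        using cond_info_le_sum[of n]
      proof eventually_elim
        case (elim x)
        have q0: "0 \<le> (\<Sum>i<n. q L (restart i x))" by (intro sum_nonneg) (simp add: q_def)
        have "(\<Sum>i<n. cond_info 1 (restart i x)) \<le> (\<Sum>i<n. real L + q L (restart i x))"
          by (intro sum_mono) (simp add: q_def)
        then have "cond_info n x \<le> real n * real L + (\<Sum>i<n. q L (restart i x))"
          using elim by (simp add: sum.distrib)
        then have "cond_info n x / real n \<le> real L + (\<Sum>i<n. q L (restart i x)) / real n"
          using n by (simp add: field_simps)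
        moreover have "0 \<le> (\<Sum>i<n. q L (restart i x)) / real n" using q0 by simp
        ultimately show ?case by (simp add: min_def)
      qed
    qed (use integrable_cond_info m qs in auto)
    also have "\<dots> = (\<integral>x. ?m n x \<partial>P) + (\<integral>x. q L x \<partial>P)"
      using n m qs by (simp add: integrable_restart q integral_restart)
    finally show ?thesis using L n0[of n] n by simp
  qed
  moreover have "0 \<le> (\<integral>x. cond_info n x \<partial>P)" for n by (rule integral_nonneg_AE[OF cond_info_nonneg])
  ultimately show "\<exists>n0. \<forall>n\<ge>n0. norm ((\<integral>x. cond_info n x \<partial>P) / real n - 0) < \<epsilon>"
    by (intro exI[of _ "max 1 n0"]) simp
qed

end

section \<open>Zero conditional entropy leaves no room for a larger sigma-algebra\<close>

text \<open>
  Together with the empty set, these sets form an intersection-stable generator of the sigma-algebra on path space.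
\<close>

definition prefix_set :: "'g list \<Rightarrow> (nat \<Rightarrow> 'g) set" where
  "prefix_set l = {x. \<forall>i<length l. x i = l ! i}"

lemma prefix_set_Int: "prefix_set l \<inter> prefix_set m \<in> insert {} (range prefix_set)"
proof -
  have *: "prefix_set l \<inter> prefix_set m \<in> insert {} (range prefix_set)" if le: "length l \<le> length m" for l m :: "'a list"
  proof (cases "\<forall>i<length l. l ! i = m ! i")
    case True
    then have "prefix_set l \<inter> prefix_set m = prefix_set m" using le by (auto simp: prefix_set_def)
    then show ?thesis by auto
  next
    case False
    then have "prefix_set l \<inter> prefix_set m = {}" using le by (fastforce simp: prefix_set_def)
    then show ?thesis by auto
  qed
  show ?thesis
    using *[of l m] *[of m l] linear[of "length l" "length m"] unfolding Int_commute[of "prefix_set m"] by blast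
qed

lemma prefix_set_sets: "prefix_set l \<in> sets (path_space :: (nat \<Rightarrow> 'g::countable) measure)"
proof -
  have c: "(\<lambda>x. x i) -` {l ! i} \<in> sets (path_space :: (nat \<Rightarrow> 'g) measure)" for i
    using measurable_sets[OF measurable_coordinate, of "{l ! i}" i] by simp
  have "(\<Inter>i\<in>{..<length l}. (\<lambda>x. x i) -` {l ! i}) \<in> sets (path_space :: (nat \<Rightarrow> 'g) measure)"
    using sets.top[of path_space] by (cases "l = []") (auto intro!: sets.finite_INT c)
  also have "(\<Inter>i\<in>{..<length l}. (\<lambda>x. x i) -` {l ! i}) = prefix_set l"
    by (auto simp: prefix_set_def)
  finally show ?thesis .
qed

lemma sets_path_space_prefix:
  "sets (path_space :: (nat \<Rightarrow> 'g::countable) measure) = sigma_sets UNIV (insert {} (range prefix_set))"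
proof
  have "insert {} (range prefix_set) \<subseteq> sets (path_space :: (nat \<Rightarrow> 'g) measure)" using prefix_set_sets by auto
  then show "sigma_sets UNIV (insert {} (range prefix_set)) \<subseteq> sets (path_space :: (nat \<Rightarrow> 'g) measure)"
    using sets.sigma_sets_subset[of "insert {} (range prefix_set)" path_space] by simp
  interpret sigma_algebra UNIV "sigma_sets UNIV (insert {} (range (prefix_set :: 'g list \<Rightarrow> _)))"
    by (rule sigma_algebra_sigma_sets) auto
  have "sets (path_space :: (nat \<Rightarrow> 'g) measure)
    = sigma_sets UNIV {{x. x i \<in> A} |i A. True}"
    unfolding path_space_def sets_PiM_single by (simp add: PiE_UNIV_domain) 
  also have "\<dots> \<subseteq> sigma_sets UNIV (insert {} (range prefix_set))"
  proof (rule sigma_sets_mono, safe)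
    fix i and A :: "'g set"
    have "{x. x i \<in> A} = (\<Union>l\<in>{l. length l = Suc i \<and> l ! i \<in> A}. prefix_set l)"
    proof safe
      fix x assume "x i \<in> A"
      then show "x \<in> (\<Union>l\<in>{l. length l = Suc i \<and> l ! i \<in> A}. prefix_set l)"
        by (intro UN_I[of "map x [0..<Suc i]"]) (auto simp: prefix_set_def nth_append simp del: upt_Suc)
    next
      fix x l assume "length l = Suc i" "l ! i \<in> A" "x \<in> prefix_set l"
      then show "x i \<in> A" by (auto simp: prefix_set_def)
    qed
    also have "\<dots> \<in> sigma_sets UNIV (insert {} (range prefix_set))"
      by (rule countable_UN') (auto intro: sigma_sets.Basic)
    finally show "{x. x i \<in> A} \<in> sigma_sets UNIV (insert {} (range prefix_set))" .
  qed
  finally show "sets (path_space :: (nat \<Rightarrow> 'g) measure) \<subseteq> sigma_sets UNIV (insert {} (range prefix_set))" .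
qed

locale nested_walks = F: conditioned_walk \<mu> F + J: conditioned_walk \<mu> J for \<mu> F J +
  assumes nested: "sets F \<subseteq> sets J"
begin

abbreviation "P \<equiv> walk_measure \<mu>"

lemma measurable_F_J: "h \<in> F \<rightarrow>\<^sub>M N \<Longrightarrow> h \<in> J \<rightarrow>\<^sub>M N"
  using nested by (auto simp: measurable_def)

lemma F_density_sum:
  "(\<integral>\<^sup>+g. (\<integral>\<^sup>+x. ennreal (F.cp n g x) \<partial>P) \<partial>count_space UNIV) \<le> 1"
  using F.cp_integral[of "\<lambda>_. 1" n] F.nn_integral_p[of n] by (simp add: F.emeasure_cylinder)

lemma
  shows integral_cond_info_mono: "(\<integral>x. J.cond_info n x \<partial>P) \<le> (\<integral>x. F.cond_info n x \<partial>P)"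
    and \<phi>_eq: "(\<integral>x. J.cond_info n x \<partial>P) = (\<integral>x. F.cond_info n x \<partial>P) \<Longrightarrow> AE x in P. F.\<phi> n x = J.\<phi> n x"
proof -
  have i: "integrable P (\<lambda>x. - ln (F.cp n (x n) x))"
    using F.integrable_cond_info[of n] by (simp add: F.cond_info_def[abs_def] F.\<phi>_def)
  have pos: "AE x in P. 0 < F.cp n (x n) x" using F.\<phi>_pos[of n] by (simp add: F.\<phi>_def)
  show "(\<integral>x. J.cond_info n x \<partial>P) \<le> (\<integral>x. F.cond_info n x \<partial>P)"
    unfolding F.cond_info_def F.\<phi>_def
    by (rule J.gibbs_inequality(2)[where r = "F.cp n", OF measurable_F_J[OF F.cp_meas] F.cp_nonneg F_density_sum pos i])
  show "AE x in P. F.\<phi> n x = J.\<phi> n x" if "(\<integral>x. J.cond_info n x \<partial>P) = (\<integral>x. F.cond_info n x \<partial>P)"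
    unfolding F.\<phi>_def
    by (rule J.gibbs_inequality(3)[where r = "F.cp n", OF measurable_F_J[OF F.cp_meas] F.cp_nonneg F_density_sum pos i])
      (use that in \<open>simp add: F.cond_info_def[abs_def] F.\<phi>_def\<close>)
qed

text \<open>
  Agreement along the path gives \<open>F.cp n g = J.cp n g\<close> wherever \<open>J.cp n g\<close> is positive. Elsewhere
  \<open>F.cp n g\<close> can only be larger, which the equality of the means excludes.
\<close>

lemma cp_eq:
  assumes "AE x in P. F.\<phi> n x = J.\<phi> n x"
  shows "AE x in P. F.cp n g x = J.cp n g x"
proof -
  have mF: "F.cp n g \<in> borel_measurable J" by (rule measurable_F_J[OF F.cp_meas])
  have "(\<integral>\<^sup>+x. ennreal \<bar>F.cp n g x - J.cp n g x\<bar> * ennreal (J.cp n g x) \<partial>P)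
    = (\<integral>\<^sup>+x. ennreal \<bar>F.cp n g x - J.cp n g x\<bar> * indicator (cylinder n g) x \<partial>P)"
    by (rule J.cp_integral) (use mF in measurable)
  also have "\<dots> = (\<integral>\<^sup>+x. 0 \<partial>P)"
    by (rule nn_integral_cong_AE)
      (use assms in \<open>auto simp: F.\<phi>_def J.\<phi>_def cylinder_def indicator_def elim!: eventually_mono\<close>)
  finally have "(\<integral>\<^sup>+x. ennreal \<bar>F.cp n g x - J.cp n g x\<bar> * ennreal (J.cp n g x) \<partial>P) = 0" by simp
  then have "AE x in P. ennreal \<bar>F.cp n g x - J.cp n g x\<bar> * ennreal (J.cp n g x) = 0"
    by (rule nn_integral_0_iff_AE[THEN iffD1, rotated])
      (auto intro!: borel_measurable_times_ennreal measurable_compose[OF _ measurable_ennreal] borel_measurable_abs borel_measurable_diff)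
  then have nn: "AE x in P. 0 \<le> F.cp n g x - J.cp n g x"
  proof eventually_elim
    case (elim x)
    then have "\<bar>F.cp n g x - J.cp n g x\<bar> \<le> 0 \<or> J.cp n g x \<le> 0" by (simp add: ennreal_eq_0_iff)
    then show ?case using F.cp_nonneg[of n g x] by linarith
  qed
  have intF: "integrable P (F.cp n g)"
    by (rule F.P.integrable_const_bound[where B = 1]) (use F.cp_le_1[of n g] in \<open>auto elim!: eventually_mono\<close>)
  have intJ: "integrable P (J.cp n g)"
    by (rule F.P.integrable_const_bound[where B = 1]) (use J.cp_le_1[of n g] in \<open>auto elim!: eventually_mono\<close>)
  have "ennreal (\<integral>x. F.cp n g x \<partial>P) = ennreal (\<integral>x. J.cp n g x \<partial>P)"
    using F.cp_integral[of "\<lambda>_. 1" n g] J.cp_integral[of "\<lambda>_. 1" n g]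
    by (simp add: nn_integral_eq_integral[OF intF, symmetric] nn_integral_eq_integral[OF intJ, symmetric])
  then have "(\<integral>x. F.cp n g x \<partial>P) = (\<integral>x. J.cp n g x \<partial>P)"
    by (subst (asm) ennreal_inj) (auto intro!: integral_nonneg_AE)
  then have "(\<integral>x. F.cp n g x - J.cp n g x \<partial>P) = 0" using intF intJ by simp
  then have "AE x in P. F.cp n g x - J.cp n g x = 0"
    using integral_nonneg_eq_0_iff_AE[OF Bochner_Integration.integrable_diff[OF intF intJ] nn] by simp
  then show ?thesis by eventually_elim simp
qed

text \<open>
  The growth rate of \<open>H\<close> is \<open>F.D 1\<close> by assumption and at least \<open>J.D 1\<close>, because conditional
  entropies given \<open>J\<close> are nonnegative. Since \<open>F.D 1 \<le> J.D 1\<close> by the inclusion, all these numbers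
  are equal, and so are the conditional entropies of every position.
\<close>

lemma zero_rate_imp_cp_eq:
  assumes lim: "(\<lambda>n. (\<integral>x. F.cond_info n x \<partial>P) / real n) \<longlonglongrightarrow> 0"
  shows "AE x in P. F.cp n g x = J.cp n g x"
proof -
  have eq: "F.H n / real n = (\<integral>x. F.cond_info n x \<partial>P) / real n + F.D 1" if "0 < n" for n
    using F.D_eq[of n] that by (simp add: F.D_def field_simps)
  have lim': "(\<lambda>n. (\<integral>x. F.cond_info n x \<partial>P) / real n + F.D 1) \<longlonglongrightarrow> 0 + F.D 1"
    by (intro tendsto_intros lim)
  have "\<forall>\<^sub>F n in sequentially. F.H n / real n = (\<integral>x. F.cond_info n x \<partial>P) / real n + F.D 1"
    using eventually_gt_at_top[of 0] by eventually_elim (rule eq)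
  from tendsto_cong[OF this, of "F.D 1"] lim' have "(\<lambda>n. F.H n / real n) \<longlonglongrightarrow> F.D 1" by simp
  moreover have "J.D 1 \<le> F.H n / real n" if "0 < n" for n
  proof -
    have "0 \<le> (\<integral>x. J.cond_info n x \<partial>P)" by (rule integral_nonneg_AE[OF J.cond_info_nonneg])
    then have "real n * J.D 1 \<le> F.H n" using J.D_eq[of n] by (simp add: J.D_def)
    then show ?thesis using that by (simp add: field_simps)
  qed
  ultimately have "J.D 1 \<le> F.D 1"
    by (intro LIMSEQ_le_const) (auto intro!: exI[of _ 1])
  moreover have "F.D 1 \<le> J.D 1" using integral_cond_info_mono[of 1] by (simp add: F.D_def J.D_def)
  ultimately have "F.D 1 = J.D 1" by simp
  then have "F.D n = J.D n" by (simp add: F.D_eq[of n] J.D_eq[of n])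
  then have "(\<integral>x. J.cond_info n x \<partial>P) = (\<integral>x. F.cond_info n x \<partial>P)" by (simp add: F.D_def J.D_def)
  then show ?thesis by (intro cp_eq \<phi>_eq)
qed

text \<open>
  Let \<open>w\<close> be the conditional probability of \<open>A\<close> given \<open>F\<close>. An event \<open>E\<close> that prescribes the path up to time
  \<open>n\<close> is seen from \<open>F\<close> and from \<open>J\<close> as the same multiple of the position at time \<open>n\<close>, whose conditional
  probabilities given \<open>F\<close> and \<open>J\<close> agree. Hence \<open>w\<close> and the indicator of \<open>A\<close> have the same integral over
  every such \<open>E\<close>, and so they coincide almost everywhere.
\<close>

theorem zero_rate_imp_maximal:
  assumes lim: "(\<lambda>n. (\<integral>x. F.cond_info n x \<partial>P) / real n) \<longlonglongrightarrow> 0" and A: "A \<in> sets J"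
  shows "\<exists>B\<in>sets F. AE x in P. x \<in> A \<longleftrightarrow> x \<in> B"
proof -
  define w where "w = nn_cond_exp P F (indicator A)"
  have w: "w \<in> borel_measurable F" "w \<in> borel_measurable P" unfolding w_def by simp_all
  have AP: "A \<in> sets P" by (rule J.sets_F_P[OF A])
  have cpe_eq: "AE x in P. F.cpe n g x = J.cpe n g x" for n g
    using zero_rate_imp_cp_eq[OF lim, of n g] F.ennreal_cp[of n g] J.ennreal_cp[of n g] by eventually_elim simp
  have prefix: "(\<integral>\<^sup>+x. w x * indicator E x \<partial>P) = emeasure P (A \<inter> E)"
    if E: "E \<in> sets P" "determined_by_past n E" "E \<subseteq> cylinder n g" for E n g
  proof (cases "0 < F.p n g")
    case False
    then have "F.p n g = 0" using F.p_nonneg[of n g] by linarith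
    then have "emeasure P E = 0"
      using emeasure_mono[OF E(3), of P] by (simp add: F.emeasure_cylinder)
    then have "AE x in P. x \<notin> E" using E(1) by (intro AE_not_in null_setsI) auto
    moreover have "emeasure P (A \<inter> E) = 0"
      using emeasure_mono[of "A \<inter> E" E P] E(1) \<open>emeasure P E = 0\<close> by simp
    moreover have "(\<integral>\<^sup>+x. w x * indicator E x \<partial>P) = (\<integral>\<^sup>+x. 0 \<partial>P)"
      by (rule nn_integral_cong_AE) (use calculation(1) in \<open>auto elim!: eventually_mono\<close>)
    ultimately show ?thesis by simp
  next
    case True
    let ?p = "ennreal (F.p n g)" and ?e = "emeasure P E"
    let ?c = "nn_cond_exp P F (indicator E)"
    have ce: "AE x in P. ?p * ?c x = ?e * F.cpe n g x" by (rule F.cond_exp_past[OF E True])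
    have "?p * (\<integral>\<^sup>+x. w x * indicator E x \<partial>P) = ?p * (\<integral>\<^sup>+x. w x * ?c x \<partial>P)"
      by (subst F.cond.nn_cond_exp_intg[OF w(1)]) (use E in auto)
    also have "\<dots> = ?p * (\<integral>\<^sup>+x. ?c x * w x \<partial>P)" by (simp add: mult.commute)
    also have "\<dots> = ?p * (\<integral>\<^sup>+x. ?c x * indicator A x \<partial>P)"
      unfolding w_def by (subst F.cond.nn_cond_exp_intg) (use AP in auto)
    also have "\<dots> = (\<integral>\<^sup>+x. ?p * ?c x * indicator A x \<partial>P)"
      using AP by (subst nn_integral_cmult[symmetric]) (auto simp: mult_ac)
    also have "\<dots> = (\<integral>\<^sup>+x. ?e * indicator A x * J.cpe n g x \<partial>P)"
      by (rule nn_integral_cong_AE) (use ce cpe_eq[of n g] in \<open>eventually_elim, simp add: mult_ac\<close>)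
    also have "\<dots> = (\<integral>\<^sup>+x. indicator A x * (?e * J.cpe n g x) \<partial>P)" by (simp add: mult_ac)
    also have "\<dots> = (\<integral>\<^sup>+x. indicator A x * (?p * nn_cond_exp P J (indicator E) x) \<partial>P)"
      by (rule nn_integral_cong_AE) (use J.cond_exp_past[OF E True] in \<open>eventually_elim, simp\<close>)
    also have "\<dots> = (\<integral>\<^sup>+x. (?p * indicator A x) * nn_cond_exp P J (indicator E) x \<partial>P)"
      by (simp add: mult_ac)
    also have "\<dots> = (\<integral>\<^sup>+x. (?p * indicator A x) * indicator E x \<partial>P)"
      by (rule J.cond.nn_cond_exp_intg) (use A E in auto)
    also have "\<dots> = (\<integral>\<^sup>+x. ?p * indicator (A \<inter> E) x \<partial>P)"
      by (rule nn_integral_cong) (auto simp: indicator_def)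
    also have "\<dots> = ?p * emeasure P (A \<inter> E)" using AP E(1) by (simp add: nn_integral_cmult)
    finally show ?thesis using True by (subst (asm) ennreal_mult_cancel_left) auto
  qed
  have all: "(\<integral>\<^sup>+x. w x * indicator E x \<partial>P) = emeasure P (A \<inter> E)" if "E \<in> sets P" for E
  proof -
    have "density P w = density P (indicator A)"
    proof (rule measure_eqI_generator_eq[where E = "insert {} (range prefix_set)" and \<Omega> = UNIV and A = "\<lambda>_. prefix_set []"])
      show "Int_stable (insert {} (range (prefix_set :: 'a list \<Rightarrow> _)))"
      proof (rule Int_stableI)
        fix a b :: "(nat \<Rightarrow> 'a) set"
        assume "a \<in> insert {} (range prefix_set)" "b \<in> insert {} (range prefix_set)"
        then show "a \<inter> b \<in> insert {} (range prefix_set)" using prefix_set_Int by auto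
      qed
      fix X :: "(nat \<Rightarrow> 'a) set"
      assume "X \<in> insert {} (range prefix_set)"
      then consider "X = {}" | l where "X = prefix_set l" by auto
      then show "emeasure (density P w) X = emeasure (density P (indicator A)) X"
      proof cases
        case 2
        have XP: "X \<in> sets P" using prefix_set_sets[of l] by (simp add: F.sets_P 2)
        have "(\<integral>\<^sup>+x. w x * indicator X x \<partial>P) = emeasure P (A \<inter> X)"
        proof (cases l)
          case Nil
          then have X: "X = UNIV" by (simp add: 2 prefix_set_def)
          have "(\<integral>\<^sup>+x. 1 * w x \<partial>P) = (\<integral>\<^sup>+x. 1 * indicator A x \<partial>P)"
            unfolding w_def by (rule F.cond.nn_cond_exp_intg) (use AP in auto)
          then show ?thesis using AP by (simp add: X)
        next
          case (Cons g m)
          show ?thesis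
            by (rule prefix[of X "length l - 1" "last l"])
              (use XP Cons in \<open>auto simp: 2 determined_by_past_def prefix_set_def cylinder_def last_conv_nth less_Suc_eq_le\<close>)
        qed
        then show ?thesis
          using XP AP w by (simp add: emeasure_density indicator_inter_arith[symmetric])
      qed simp
    next
      show "sets (density P w) = sigma_sets UNIV (insert {} (range prefix_set))"
        "sets (density P (indicator A)) = sigma_sets UNIV (insert {} (range prefix_set))"
        by (simp_all add: F.sets_P sets_path_space_prefix)
      have 1: "prefix_set [] = (UNIV :: (nat \<Rightarrow> 'a) set)" by (simp add: prefix_set_def)
      show "range (\<lambda>_. prefix_set []) \<subseteq> insert {} (range (prefix_set :: 'a list \<Rightarrow> _))" by auto
      show "(\<Union>i. prefix_set ([] :: 'a list)) = UNIV" by (simp add: 1)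
      fix i :: nat
      have "(\<integral>\<^sup>+x. 1 * w x \<partial>P) = (\<integral>\<^sup>+x. 1 * indicator A x \<partial>P)"
        unfolding w_def by (rule F.cond.nn_cond_exp_intg) (use AP in auto)
      then show "emeasure (density P w) (prefix_set []) \<noteq> \<infinity>"
        using w AP sets.top[of P] by (simp add: emeasure_density 1 less_top[symmetric])
    qed auto
    then have "emeasure (density P w) E = emeasure (density P (indicator A)) E" by simp
    then show ?thesis using that AP w by (simp add: emeasure_density indicator_inter_arith[symmetric])
  qed
  have "subalgebra P P" by (simp add: subalgebra_def)
  then interpret full: finite_measure_subalgebra P P by unfold_locales
  have "AE x in P. w x = nn_cond_exp P P (indicator A) x"
    by (rule full.nn_cond_exp_charact)
      (use all AP w in \<open>auto simp: indicator_inter_arith[symmetric]\<close>)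
  moreover have "AE x in P. indicator A x = nn_cond_exp P P (indicator A) x"
    by (rule full.nn_cond_exp_F_meas) (use AP in simp)
  ultimately have "AE x in P. x \<in> A \<longleftrightarrow> x \<in> w -` {1}"
    by eventually_elim (auto simp: indicator_def split: if_splits)
  moreover have "w -` {1} \<in> sets F" using measurable_sets[OF w(1), of "{1}"] by simp
  ultimately show ?thesis by blast
qed

end

section \<open>The posterior law of the first step is asymptotically independent of time\<close>

context random_walk begin

lemma p_sum_first_step: "(\<integral>\<^sup>+g. ennreal (p a g * p b (- g + y)) \<partial>count_space UNIV) = ennreal (p (a + b) y)"
proof -
  have "ennreal (p (a + b) y) = (\<integral>\<^sup>+x. indicator (cylinder (a + b) y) x \<partial>P)"
    by (simp add: emeasure_cylinder)
  also have "\<dots> = (\<integral>\<^sup>+g. (\<integral>\<^sup>+x. indicator (cylinder (a + b) y) x * indicator (cylinder a g) x \<partial>P) \<partial>count_space UNIV)"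
    by (rule nn_integral_split) simp
  also have "\<dots> = (\<integral>\<^sup>+g. ennreal (p a g * p b (- g + y)) \<partial>count_space UNIV)"
  proof (rule nn_integral_cong)
    fix g
    have "emeasure P (cylinder a g \<inter> cylinder (a + b) y) = ennreal (p a g * p b (- g + y))"
      using emeasure_two_cylinders[of a g b "- g + y"] by (simp add: add.assoc[symmetric])
    then show "(\<integral>\<^sup>+x. indicator (cylinder (a + b) y) x * indicator (cylinder a g) x \<partial>P) = ennreal (p a g * p b (- g + y))"
      by (simp add: indicator_inter_arith[symmetric] Int_commute)
  qed
  finally show ?thesis by simp
qed

lemma nn_integral_translate: "(\<integral>\<^sup>+y. h (- g + y) \<partial>count_space UNIV) = (\<integral>\<^sup>+y. h (y :: 'g) \<partial>count_space UNIV)"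
proof (rule nn_integral_bij_count_space)
  show "bij_betw (\<lambda>y. - g + y) UNIV UNIV"
    by (rule bij_betw_byWitness[where f' = "\<lambda>y. g + y"]) (auto simp: add.assoc[symmetric])
qed

text \<open>
  The conditional probability that the first step was \<open>g\<close>, given the position \<open>y\<close> at time \<open>n\<close>. At
  sites of probability zero its value is 0.
\<close>

definition posterior :: "'g \<Rightarrow> nat \<Rightarrow> 'g \<Rightarrow> real" where
  "posterior g n y = p 1 g * p (n - 1) (- g + y) / p n y"

lemma posterior_nonneg [simp]: "0 \<le> posterior g n y" by (simp add: posterior_def)

lemma first_step_le: "1 \<le> n \<Longrightarrow> p 1 g * p (n - 1) (- g + y) \<le> p n y"
  using p_add_ge[of 1 g "n - 1" "- g + y"] by (simp add: add.assoc[symmetric])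

lemma posterior_le_1: "1 \<le> n \<Longrightarrow> posterior g n y \<le> 1"
  using first_step_le[of n g y] p_nonneg[of n y] by (cases "p n y = 0") (auto simp: posterior_def less_le)

lemma posterior_mult: "1 \<le> n \<Longrightarrow> posterior g n y * p n y = p 1 g * p (n - 1) (- g + y)"
proof (cases "p n y = 0")
  case True
  moreover assume "1 \<le> n"
  ultimately have "p 1 g * p (n - 1) (- g + y) \<le> 0" using first_step_le[of n g y] by simp
  moreover have "0 \<le> p 1 g * p (n - 1) (- g + y)" by simp
  ultimately have "p 1 g * p (n - 1) (- g + y) = 0" by (rule order_antisym)
  then show ?thesis using True by simp
qed (simp add: posterior_def)

text \<open>
  The posterior is the conditional expectation of the indicator of the first step being \<open>g\<close>, given all
  that happens from time \<open>n\<close> on.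
\<close>

lemma posterior_integral_restart:
  assumes n: "1 \<le> n" and \<psi>: "\<And>y. \<psi> y \<in> borel_measurable P"
  shows "(\<integral>\<^sup>+x. ennreal (posterior g n (x n)) * \<psi> (x n) (restart n x) \<partial>P)
    = (\<integral>\<^sup>+x. indicator (cylinder 1 g) x * \<psi> (x n) (restart n x) \<partial>P)"
proof -
  have m: "(\<lambda>x. \<psi> y (restart n x)) \<in> borel_measurable P" for y
    by (rule measurable_compose[OF measurable_restart_P \<psi>])
  have "(\<integral>\<^sup>+x. ennreal (posterior g n (x n)) * \<psi> (x n) (restart n x) \<partial>P)
    = (\<integral>\<^sup>+y. (\<integral>\<^sup>+x. (ennreal (posterior g n y) * \<psi> y (restart n x)) * indicator (cylinder n y) x \<partial>P) \<partial>count_space UNIV)"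
    by (rule nn_integral_split[of "\<lambda>y x. ennreal (posterior g n y) * \<psi> y (restart n x)"]) (use m in simp)
  also have "\<dots> = (\<integral>\<^sup>+y. (\<integral>\<^sup>+x. (indicator (cylinder 1 g) x * \<psi> y (restart n x)) * indicator (cylinder n y) x \<partial>P) \<partial>count_space UNIV)"
  proof (rule nn_integral_cong)
    fix y
    have e: "emeasure P (cylinder 1 g \<inter> cylinder n y) = ennreal (p 1 g * p (n - 1) (- g + y))"
      using emeasure_two_cylinders[of 1 g "n - 1" "- g + y"] n by (simp add: add.assoc[symmetric])
    have "(\<integral>\<^sup>+x. (ennreal (posterior g n y) * \<psi> y (restart n x)) * indicator (cylinder n y) x \<partial>P)
      = ennreal (p n y) * (\<integral>\<^sup>+x. ennreal (posterior g n y) * \<psi> y x \<partial>P)"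
      by (rule nn_integral_restart_cylinder) (use \<psi> in simp)
    also have "\<dots> = ennreal (posterior g n y * p n y) * (\<integral>\<^sup>+x. \<psi> y x \<partial>P)"
      using \<psi> by (simp add: nn_integral_cmult nn_integral_multc ennreal_mult mult_ac)
    also have "\<dots> = emeasure P (cylinder 1 g \<inter> cylinder n y) * (\<integral>\<^sup>+x. \<psi> y x \<partial>P)"
      by (simp only: e posterior_mult[OF n])
    also have "\<dots> = (\<integral>\<^sup>+x. indicator (cylinder 1 g \<inter> cylinder n y) x * \<psi> y (restart n x) \<partial>P)"
      by (rule nn_integral_restart[symmetric]) (use n \<psi> in \<open>auto simp: determined_by_past_def cylinder_def\<close>)
    also have "\<dots> = (\<integral>\<^sup>+x. (indicator (cylinder 1 g) x * \<psi> y (restart n x)) * indicator (cylinder n y) x \<partial>P)"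
      by (rule nn_integral_cong) (auto simp: indicator_def)
    finally show "(\<integral>\<^sup>+x. (ennreal (posterior g n y) * \<psi> y (restart n x)) * indicator (cylinder n y) x \<partial>P)
      = (\<integral>\<^sup>+x. (indicator (cylinder 1 g) x * \<psi> y (restart n x)) * indicator (cylinder n y) x \<partial>P)" .
  qed
  also have "\<dots> = (\<integral>\<^sup>+x. indicator (cylinder 1 g) x * \<psi> (x n) (restart n x) \<partial>P)"
    by (rule nn_integral_split[of "\<lambda>y x. indicator (cylinder 1 g) x * \<psi> y (restart n x)", symmetric]) (use m in simp)
  finally show ?thesis .
qed

lemma coord_restart: "n \<le> m \<Longrightarrow> x n + restart n x (m - n) = (x m :: 'g)"
  by (simp add: restart_def add.assoc[symmetric])

lemma posterior_integral:
  assumes "1 \<le> n" "n \<le> m"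
  shows "(\<integral>\<^sup>+x. ennreal (posterior g n (x n)) * h (x m) \<partial>P) = (\<integral>\<^sup>+x. indicator (cylinder 1 g) x * h (x m) \<partial>P)"
  using posterior_integral_restart[OF assms(1), of "\<lambda>y z. h (y + z (m - n))" g]
    measurable_compose[OF measurable_coord_P, of "\<lambda>z. h (_ + z)" borel] assms(2)
  by (simp add: coord_restart)

lemma integrable_posterior: "1 \<le> n \<Longrightarrow> integrable P (\<lambda>x. posterior g n (x n))"
  by (rule P.integrable_const_bound[where B = 1])
    (auto simp: posterior_le_1 intro: measurable_compose[OF measurable_coord_P])

text \<open>
  Along the path the posteriors form a reversed martingale, whose increments are orthogonal to later values.
\<close>

lemma posterior_L2:
  assumes "1 \<le> n" "n \<le> m"
  shows "(\<integral>x. (posterior g n (x n) - posterior g m (x m))\<^sup>2 \<partial>P) = (\<integral>x. (posterior g n (x n))\<^sup>2 \<partial>P) - (\<integral>x. (posterior g m (x m))\<^sup>2 \<partial>P)"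
proof -
  have m1: "1 \<le> m" using assms by simp
  have meas: "(\<lambda>x. posterior g i (x i)) \<in> borel_measurable P" for i
    by (rule measurable_compose[OF measurable_coord_P]) simp
  have i: "integrable P (\<lambda>x. posterior g i (x i) * posterior g j (x j))" if "1 \<le> i" "1 \<le> j" for i j
    by (rule P.integrable_const_bound[where B = 1])
      (use that meas in \<open>auto simp: posterior_le_1 abs_mult intro!: mult_le_one\<close>)
  have "(\<integral>\<^sup>+x. ennreal (posterior g n (x n) * posterior g m (x m)) \<partial>P) = (\<integral>\<^sup>+x. ennreal (posterior g m (x m) * posterior g m (x m)) \<partial>P)"
    using posterior_integral[OF assms, of g "\<lambda>y. ennreal (posterior g m y)"] posterior_integral[OF m1 order_refl, of g "\<lambda>y. ennreal (posterior g m y)"]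
    by (simp add: ennreal_mult)
  then have eq: "(\<integral>x. posterior g n (x n) * posterior g m (x m) \<partial>P) = (\<integral>x. posterior g m (x m) * posterior g m (x m) \<partial>P)"
    using i assms m1 by (simp add: nn_integral_eq_integral)
  have "(\<integral>x. (posterior g n (x n) - posterior g m (x m))\<^sup>2 \<partial>P)
    = (\<integral>x. posterior g n (x n) * posterior g n (x n) - 2 * (posterior g n (x n) * posterior g m (x m)) + posterior g m (x m) * posterior g m (x m) \<partial>P)"
    by (rule Bochner_Integration.integral_cong) (auto simp: power2_eq_square algebra_simps)
  also have "\<dots> = (\<integral>x. posterior g n (x n) * posterior g n (x n) \<partial>P) - 2 * (\<integral>x. posterior g n (x n) * posterior g m (x m) \<partial>P) + (\<integral>x. posterior g m (x m) * posterior g m (x m) \<partial>P)"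
    using i assms m1 by simp
  also have "\<dots> = (\<integral>x. (posterior g n (x n))\<^sup>2 \<partial>P) - (\<integral>x. (posterior g m (x m))\<^sup>2 \<partial>P)"
    using eq by (simp add: power2_eq_square)
  finally show ?thesis .
qed

text \<open>
  Let a fair coin choose between the times \<open>m\<close> and \<open>m + k\<close>. Up to a factor, this is the second
  moment of the conditional probability of time \<open>m\<close> given the position at the chosen time.
\<close>

definition separation :: "nat \<Rightarrow> nat \<Rightarrow> ennreal" where
  "separation k m = (\<integral>\<^sup>+y. ennreal ((p m y)\<^sup>2 / (p m y + p (m + k) y)) \<partial>count_space UNIV)"

text \<open>
  The squared difference between the conditional probabilities of the earlier of the two times, with
  and without knowledge of the first step \<open>g\<close>, weighted by the law of first step and position at the random time.
\<close>

definition gap :: "nat \<Rightarrow> nat \<Rightarrow> 'g \<Rightarrow> 'g \<Rightarrow> real" where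
  "gap k m g y = p 1 g * ((p m (- g + y) + p (m + k) (- g + y)) *
     (p m (- g + y) / (p m (- g + y) + p (m + k) (- g + y)) - p (Suc m) y / (p (Suc m) y + p (Suc m + k) y))\<^sup>2)"

lemma gap_nonneg [simp]: "0 \<le> gap k m g y" by (simp add: gap_def)

lemma separation_le_1: "separation k m \<le> 1"
proof -
  have "separation k m \<le> (\<integral>\<^sup>+y. ennreal (p m y) \<partial>count_space UNIV)"
    unfolding separation_def
  proof (intro nn_integral_mono ennreal_leI)
    fix y
    show "(p m y)\<^sup>2 / (p m y + p (m + k) y) \<le> p m y"
    proof (cases "p m y = 0")
      case False
      then have "0 < p m y" using p_nonneg[of m y] by linarith
      then show ?thesis using p_nonneg[of "m + k" y]
        by (simp add: pos_divide_le_eq power2_eq_square mult_left_mono add_pos_nonneg)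
    qed simp
  qed
  then show ?thesis by (simp add: nn_integral_p)
qed

text \<open>
  If the first step is known, the times \<open>m + 1\<close> and \<open>m + 1 + k\<close> of the walk are the times \<open>m\<close> and
  \<open>m + k\<close> of a translate of the walk, so the second moment is then that of \<open>m\<close>. Forgetting the first step
  decreases it by a conditional variance, which is the double sum.
\<close>

lemma separation_decrease: "separation k m = (\<integral>\<^sup>+y. \<integral>\<^sup>+g. ennreal (gap k m g y) \<partial>count_space UNIV \<partial>count_space UNIV) + separation k (Suc m)"
proof -
  let ?C = "count_space (UNIV :: 'g set)"
  define a where "a y = p (Suc m) y" for y
  define s where "s y = p (Suc m) y + p (Suc m + k) y" for y
  define ag where "ag g y = p m (- g + y)" for g y
  define sg where "sg g y = p m (- g + y) + p (m + k) (- g + y)" for g y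
  have nn: "0 \<le> a y" "0 \<le> s y" "0 \<le> ag g y" "0 \<le> sg g y" "ag g y \<le> sg g y" "a y \<le> s y" "0 \<le> p 1 g" for g y
    by (simp_all add: a_def s_def ag_def sg_def)
  have gap: "gap k m g y = p 1 g * (sg g y * (ag g y / sg g y - a y / s y)\<^sup>2)" for g y
    by (simp add: gap_def a_def s_def ag_def sg_def)
  have sum_ag: "(\<integral>\<^sup>+g. ennreal (p 1 g * ag g y) \<partial>?C) = ennreal (a y)" for y
    using p_sum_first_step[of 1 m y] by (simp add: ag_def a_def)
  have sum_sg: "(\<integral>\<^sup>+g. ennreal (p 1 g * sg g y) \<partial>?C) = ennreal (s y)" for y
  proof -
    have "(\<integral>\<^sup>+g. ennreal (p 1 g * sg g y) \<partial>?C) = (\<integral>\<^sup>+g. ennreal (p 1 g * p m (- g + y)) + ennreal (p 1 g * p (m + k) (- g + y)) \<partial>?C)"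
      by (rule nn_integral_cong) (simp add: sg_def distrib_left)
    also have "\<dots> = ennreal (s y)"
      using p_sum_first_step[of 1 m y] p_sum_first_step[of 1 "m + k" y]
      by (subst nn_integral_add) (auto simp: s_def)
    finally show ?thesis .
  qed
  have pt: "p 1 g * ((ag g y)\<^sup>2 / sg g y) + (a y / s y)\<^sup>2 * (p 1 g * sg g y) = gap k m g y + 2 * (a y / s y) * (p 1 g * ag g y)" for g y
  proof (cases "sg g y = 0")
    case True
    then have "ag g y = 0" using nn(3,5)[of g y] by linarith
    then show ?thesis using True by (simp add: gap)
  next
    case False
    have "q * (v\<^sup>2 / G) + w\<^sup>2 * (q * G) = q * (G * (v / G - w)\<^sup>2) + 2 * w * (q * v)" if "G \<noteq> 0" for q v G w :: real
      using that by (simp add: field_simps power2_eq_square)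
    from this[OF False] show ?thesis unfolding gap .
  qed
  have row: "(\<integral>\<^sup>+g. ennreal (p 1 g * ((ag g y)\<^sup>2 / sg g y)) \<partial>?C) + ennreal ((a y)\<^sup>2 / s y)
      = (\<integral>\<^sup>+g. ennreal (gap k m g y) \<partial>?C) + 2 * ennreal ((a y)\<^sup>2 / s y)" for y
  proof -
    have 1: "ennreal ((a y)\<^sup>2 / s y) = ennreal ((a y / s y)\<^sup>2) * ennreal (s y)"
      using nn by (cases "s y = 0") (auto simp: ennreal_mult[symmetric] power2_eq_square)
    have 2: "2 * ennreal ((a y)\<^sup>2 / s y) = ennreal (2 * (a y / s y)) * ennreal (a y)"
      using nn by (cases "s y = 0") (auto simp: ennreal_mult[symmetric] power2_eq_square mult_ac ennreal_numeral[symmetric] simp del: ennreal_numeral)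
    have "(\<integral>\<^sup>+g. ennreal (p 1 g * ((ag g y)\<^sup>2 / sg g y)) \<partial>?C) + ennreal ((a y)\<^sup>2 / s y)
      = (\<integral>\<^sup>+g. ennreal (p 1 g * ((ag g y)\<^sup>2 / sg g y)) + ennreal ((a y / s y)\<^sup>2) * ennreal (p 1 g * sg g y) \<partial>?C)"
      unfolding 1 by (subst nn_integral_add) (auto simp: nn_integral_cmult sum_sg simp del: One_nat_def)
    also have "\<dots> = (\<integral>\<^sup>+g. ennreal (gap k m g y) + ennreal (2 * (a y / s y)) * ennreal (p 1 g * ag g y) \<partial>?C)"
    proof (rule nn_integral_cong)
      fix g
      have "ennreal (p 1 g * ((ag g y)\<^sup>2 / sg g y)) + ennreal ((a y / s y)\<^sup>2) * ennreal (p 1 g * sg g y)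
        = ennreal (p 1 g * ((ag g y)\<^sup>2 / sg g y) + (a y / s y)\<^sup>2 * (p 1 g * sg g y))"
        using nn by (simp add: ennreal_mult[symmetric])
      also have "\<dots> = ennreal (gap k m g y) + ennreal (2 * (a y / s y)) * ennreal (p 1 g * ag g y)"
        unfolding pt using nn by (simp add: ennreal_mult[symmetric])
      finally show "ennreal (p 1 g * ((ag g y)\<^sup>2 / sg g y)) + ennreal ((a y / s y)\<^sup>2) * ennreal (p 1 g * sg g y)
        = ennreal (gap k m g y) + ennreal (2 * (a y / s y)) * ennreal (p 1 g * ag g y)" .
    qed
    also have "\<dots> = (\<integral>\<^sup>+g. ennreal (gap k m g y) \<partial>?C) + 2 * ennreal ((a y)\<^sup>2 / s y)"
      unfolding 2 by (subst nn_integral_add) (auto simp: nn_integral_cmult sum_ag simp del: One_nat_def)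
    finally show ?thesis .
  qed
  have VS: "separation k (Suc m) = (\<integral>\<^sup>+y. ennreal ((a y)\<^sup>2 / s y) \<partial>?C)" by (simp add: separation_def a_def s_def)
  have "(\<integral>\<^sup>+y. \<integral>\<^sup>+g. ennreal (p 1 g * ((ag g y)\<^sup>2 / sg g y)) \<partial>?C \<partial>?C)
    = (\<integral>\<^sup>+g. \<integral>\<^sup>+y. ennreal (p 1 g * ((ag g y)\<^sup>2 / sg g y)) \<partial>?C \<partial>?C)"
    by (rule nn_integral_count_space_nn_integral) auto
  also have "\<dots> = (\<integral>\<^sup>+g. ennreal (p 1 g) * separation k m \<partial>?C)"
  proof (rule nn_integral_cong)
    fix g
    have "(\<integral>\<^sup>+y. ennreal (p 1 g * ((ag g y)\<^sup>2 / sg g y)) \<partial>?C) = ennreal (p 1 g) * (\<integral>\<^sup>+y. ennreal ((ag g y)\<^sup>2 / sg g y) \<partial>?C)"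
      using nn by (subst nn_integral_cmult[symmetric]) (auto simp: ennreal_mult[symmetric])
    also have "(\<integral>\<^sup>+y. ennreal ((ag g y)\<^sup>2 / sg g y) \<partial>?C) = separation k m"
      unfolding ag_def sg_def separation_def
      by (rule nn_integral_translate[of "\<lambda>y. ennreal ((p m y)\<^sup>2 / (p m y + p (m + k) y))"])
    finally show "(\<integral>\<^sup>+y. ennreal (p 1 g * ((ag g y)\<^sup>2 / sg g y)) \<partial>?C) = ennreal (p 1 g) * separation k m" .
  qed
  also have "\<dots> = separation k m" by (simp add: nn_integral_multc nn_integral_p)
  finally have X: "(\<integral>\<^sup>+y. \<integral>\<^sup>+g. ennreal (p 1 g * ((ag g y)\<^sup>2 / sg g y)) \<partial>?C \<partial>?C) = separation k m" .
  have "separation k m + separation k (Suc m) = (\<integral>\<^sup>+y. (\<integral>\<^sup>+g. ennreal (p 1 g * ((ag g y)\<^sup>2 / sg g y)) \<partial>?C) + ennreal ((a y)\<^sup>2 / s y) \<partial>?C)"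
    unfolding VS X[symmetric] by (rule nn_integral_add[symmetric]) auto
  also have "\<dots> = (\<integral>\<^sup>+y. (\<integral>\<^sup>+g. ennreal (gap k m g y) \<partial>?C) + 2 * ennreal ((a y)\<^sup>2 / s y) \<partial>?C)"
    by (simp only: row)
  also have "\<dots> = (\<integral>\<^sup>+y. \<integral>\<^sup>+g. ennreal (gap k m g y) \<partial>?C \<partial>?C) + 2 * separation k (Suc m)"
    unfolding VS by (subst nn_integral_add) (auto simp: nn_integral_cmult)
  finally have "separation k (Suc m) + separation k m = separation k (Suc m) + ((\<integral>\<^sup>+y. \<integral>\<^sup>+g. ennreal (gap k m g y) \<partial>?C \<partial>?C) + separation k (Suc m))"
    by (simp add: mult_2 add_ac)
  moreover have "separation k (Suc m) \<noteq> top" using separation_le_1[of k "Suc m"] by (auto simp: top_unique)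
  ultimately show ?thesis by (simp add: ennreal_add_left_cancel)
qed

text \<open>
  The decrements telescope and their sum is bounded.
\<close>

lemma gap_tendsto_0: "(\<lambda>m. \<integral>\<^sup>+y. \<integral>\<^sup>+g. ennreal (gap k m g y) \<partial>count_space UNIV \<partial>count_space UNIV) \<longlonglongrightarrow> 0"
proof -
  define Q where "Q m = (\<integral>\<^sup>+y. \<integral>\<^sup>+g. ennreal (gap k m g y) \<partial>count_space UNIV \<partial>count_space UNIV)" for m
  have tele: "(\<Sum>m<n. Q m) + separation k n = separation k 0" for n
  proof (induction n)
    case (Suc n)
    then show ?case using separation_decrease[of k n] by (simp add: add.assoc Q_def)
  qed simp
  have "(\<Sum>m<n. Q m) + 0 \<le> 1" for n
  proof -
    have "(\<Sum>m<n. Q m) + 0 \<le> (\<Sum>m<n. Q m) + separation k n" by (intro add_left_mono) simp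
    also have "\<dots> \<le> 1" using separation_le_1[of k 0] tele[of n] by simp
    finally show ?thesis .
  qed
  then have "(\<Sum>m. Q m) + 0 \<le> 1" by (rule ennreal_suminf_bound_add)
  then have "(\<Sum>m. Q m) \<le> 1" by simp
  then have fin: "(\<Sum>m. Q m) < top" by (rule le_less_trans) simp
  then have "Q m < top" for m by (rule ennreal_suminf_lessD)
  then have eq: "ennreal (enn2real (Q m)) = Q m" for m by simp
  have "summable (\<lambda>m. enn2real (Q m))"
    by (rule summable_suminf_not_top) (use fin in \<open>simp_all add: eq\<close>)
  then have "(\<lambda>m. enn2real (Q m)) \<longlonglongrightarrow> 0" by (rule summable_LIMSEQ_zero)
  then have "(\<lambda>m. ennreal (enn2real (Q m))) \<longlonglongrightarrow> ennreal 0" by (intro tendsto_ennrealI)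
  then show ?thesis unfolding eq by (simp add: Q_def)
qed

lemma abs_le_square: "0 < (\<delta>::real) \<Longrightarrow> \<bar>e\<bar> \<le> \<delta> + e\<^sup>2 / \<delta>"
proof (cases "\<bar>e\<bar> \<le> \<delta>")
  case True
  assume "0 < \<delta>" with True show ?thesis by (simp add: add_increasing2)
next
  case False
  assume \<delta>: "0 < \<delta>"
  have "\<bar>e\<bar> * \<delta> \<le> \<bar>e\<bar> * \<bar>e\<bar>" using False by (intro mult_left_mono) auto
  then have "\<bar>e\<bar> \<le> e\<^sup>2 / \<delta>" using \<delta> by (simp add: field_simps power2_eq_square)
  then show ?thesis using \<delta> by simp
qed

text \<open>
  By Bayes' rule, \<open>posterior\<close> depends on the time exactly as far as the conditional law of the time depends on
  the first step. The weight \<open>min a b\<close> compensates the division by the probabilities \<open>a\<close>, \<open>b\<close> of the site at the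
  two times, since \<open>min a b * (a + b) \<le> 2 * a * b\<close>.
\<close>

lemma overlap_bound_pointwise:
  assumes \<delta>: "0 < \<delta>"
  shows "min (p (Suc m) y) (p (Suc m + k) y) * \<bar>posterior g (Suc m) y - posterior g (Suc m + k) y\<bar>
    \<le> 2 * \<delta> * (p m (- g + y) + p (m + k) (- g + y)) + 2 / \<delta> * gap k m g y"
proof -
  define a where "a = p (Suc m) y"
  define b where "b = p (Suc m + k) y"
  define c where "c = p m (- g + y)"
  define d where "d = p (m + k) (- g + y)"
  define q where "q = p 1 g"
  have nn: "0 \<le> a" "0 \<le> b" "0 \<le> c" "0 \<le> d" "0 \<le> q" "q \<le> 1" by (simp_all add: a_def b_def c_def d_def q_def)
  define e where "e = c / (c + d) - a / (a + b)"
  have eq: "gap k m g y = q * ((c + d) * e\<^sup>2)" by (simp add: gap_def a_def b_def c_def d_def q_def e_def)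
  have 1: "min a b * \<bar>q * c / a - q * d / b\<bar> \<le> 2 * (q * ((c + d) * \<bar>e\<bar>))"
  proof (cases "a = 0 \<or> b = 0")
    case True
    then show ?thesis using nn by auto
  next
    case False
    then have ab: "0 < a" "0 < b" using nn by auto
    have id: "q * c / a - q * d / b = q * (c * b - d * a) / (a * b)" using ab by (simp add: field_simps)
    have ring_id: "x * (u - v) * z = (x * u) * z - x * (v * z)" for x u v z :: real by algebra
    have ce: "(c + d) * e * (a + b) = c * b - d * a"
    proof (cases "c + d = 0")
      case True
      then have "c = 0 \<and> d = 0" using nn by (simp add: add_nonneg_eq_0_iff)
      then show ?thesis by simp
    next
      case False
      have "(c + d) * e * (a + b) = ((c + d) * (c / (c + d))) * (a + b) - (c + d) * ((a / (a + b)) * (a + b))"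
        unfolding e_def by (rule ring_id)
      also have "(c + d) * (c / (c + d)) = c" using False by simp
      also have "(a / (a + b)) * (a + b) = a" using ab by simp
      finally show ?thesis by (simp add: algebra_simps)
    qed
    have "min a b * \<bar>q * c / a - q * d / b\<bar> = q * ((c + d) * \<bar>e\<bar>) * (min a b * (a + b) / (a * b))"
      unfolding id ce[symmetric] using nn ab by (simp add: abs_mult)
    also have "min a b * (a + b) / (a * b) \<le> 2"
    proof -
      have "min a b * (a + b) \<le> 2 * (a * b)"
        using ab by (cases "a \<le> b") (auto simp: min_def algebra_simps mult_left_mono mult_right_mono)
      then show ?thesis using ab by (simp add: field_simps)
    qed
    finally show ?thesis using nn by (simp add: mult_left_mono)
  qed
  have "\<bar>e\<bar> \<le> \<delta> + e\<^sup>2 / \<delta>" by (rule abs_le_square[OF \<delta>])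
  then have "q * ((c + d) * \<bar>e\<bar>) \<le> q * ((c + d) * (\<delta> + e\<^sup>2 / \<delta>))"
    using nn by (intro mult_left_mono) auto
  also have "\<dots> = q * ((c + d) * \<delta>) + gap k m g y / \<delta>" by (simp add: eq algebra_simps)
  also have "q * ((c + d) * \<delta>) \<le> 1 * ((c + d) * \<delta>)" using nn \<delta> by (intro mult_right_mono) auto
  finally have "2 * (q * ((c + d) * \<bar>e\<bar>)) \<le> 2 * \<delta> * (c + d) + 2 / \<delta> * gap k m g y" by (simp add: algebra_simps)
  with 1 have "min a b * \<bar>q * c / a - q * d / b\<bar> \<le> 2 * \<delta> * (c + d) + 2 / \<delta> * gap k m g y" by linarith
  then show ?thesis by (simp add: a_def b_def c_def d_def q_def posterior_def)
qed

text \<open>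
  The posterior asymptotically ignores the time, on the common part of the laws at times \<open>m\<close> and \<open>m + k\<close>.
\<close>

lemma overlap_tendsto_0:
  "(\<lambda>m. \<integral>\<^sup>+y. ennreal (min (p m y) (p (m + k) y) * \<bar>posterior g m y - posterior g (m + k) y\<bar>) \<partial>count_space UNIV) \<longlonglongrightarrow> 0"
  (is "?O \<longlonglongrightarrow> 0")
proof -
  let ?C = "count_space (UNIV :: 'g set)"
  let ?Q = "\<lambda>m. \<integral>\<^sup>+y. \<integral>\<^sup>+g. ennreal (gap k m g y) \<partial>?C \<partial>?C"
  have bound: "?O (Suc m) \<le> ennreal (4 * \<delta>) + ennreal (2 / \<delta>) * ?Q m" if \<delta>: "0 < \<delta>" for m \<delta>
  proof -
    have "?O (Suc m) \<le> (\<integral>\<^sup>+y. ennreal (2 * \<delta>) * (ennreal (p m (- g + y)) + ennreal (p (m + k) (- g + y))) + ennreal (2 / \<delta>) * ennreal (gap k m g y) \<partial>?C)"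
    proof (rule nn_integral_mono)
      fix y
      have "ennreal (min (p (Suc m) y) (p (Suc m + k) y) * \<bar>posterior g (Suc m) y - posterior g (Suc m + k) y\<bar>)
        \<le> ennreal (2 * \<delta> * (p m (- g + y) + p (m + k) (- g + y)) + 2 / \<delta> * gap k m g y)"
        by (rule ennreal_leI) (rule overlap_bound_pointwise[OF \<delta>])
      also have "\<dots> = ennreal (2 * \<delta>) * (ennreal (p m (- g + y)) + ennreal (p (m + k) (- g + y))) + ennreal (2 / \<delta>) * ennreal (gap k m g y)"
        using \<delta> by (simp add: ennreal_mult[symmetric] ennreal_plus[symmetric] del: ennreal_plus)
      finally show "ennreal (min (p (Suc m) y) (p (Suc m + k) y) * \<bar>posterior g (Suc m) y - posterior g (Suc m + k) y\<bar>)
        \<le> ennreal (2 * \<delta>) * (ennreal (p m (- g + y)) + ennreal (p (m + k) (- g + y))) + ennreal (2 / \<delta>) * ennreal (gap k m g y)" .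
    qed
    also have "\<dots> = ennreal (2 * \<delta>) * ((\<integral>\<^sup>+y. ennreal (p m (- g + y)) \<partial>?C) + (\<integral>\<^sup>+y. ennreal (p (m + k) (- g + y)) \<partial>?C)) + ennreal (2 / \<delta>) * (\<integral>\<^sup>+y. ennreal (gap k m g y) \<partial>?C)"
      by (simp add: nn_integral_add nn_integral_cmult)
    also have "\<dots> = ennreal (2 * \<delta>) * 2 + ennreal (2 / \<delta>) * (\<integral>\<^sup>+y. ennreal (gap k m g y) \<partial>?C)"
      using nn_integral_translate[of "\<lambda>y. ennreal (p m y)" g] nn_integral_translate[of "\<lambda>y. ennreal (p (m + k) y)" g]
      by (simp add: nn_integral_p one_add_one)
    also have "\<dots> \<le> ennreal (4 * \<delta>) + ennreal (2 / \<delta>) * ?Q m"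
    proof (rule add_mono)
      show "ennreal (2 * \<delta>) * 2 \<le> ennreal (4 * \<delta>)"
        using \<delta> by (simp add: ennreal_mult[symmetric] ennreal_numeral[symmetric] del: ennreal_numeral)
      show "ennreal (2 / \<delta>) * (\<integral>\<^sup>+y. ennreal (gap k m g y) \<partial>?C) \<le> ennreal (2 / \<delta>) * ?Q m"
        by (intro mult_left_mono nn_integral_mono nn_integral_ge_point) auto
    qed
    finally show ?thesis .
  qed
  have "(\<lambda>m. ?O (Suc m)) \<longlonglongrightarrow> 0"
  proof (rule order_tendstoI)
    fix e :: ennreal assume "0 < e"
    then obtain r where r: "0 < r" "ennreal r < e" 
      by (metis dense ennreal_cases ennreal_less_zero_iff less_top order_less_trans top.not_eq_extremum)
    \<comment> \<open>the two parts of the bound are then at most half of r each\<close>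
    define \<delta> where "\<delta> = r / 8"
    have \<delta>: "0 < \<delta>" using r by (simp add: \<delta>_def)
    have "\<forall>\<^sub>F m in sequentially. ?Q m < ennreal (r * \<delta> / 4)"
      using gap_tendsto_0[of k] r \<delta> by (intro order_tendstoD) auto
    then show "\<forall>\<^sub>F m in sequentially. ?O (Suc m) < e"
    proof eventually_elim
      case (elim m)
      have "ennreal (4 * \<delta>) + ennreal (2 / \<delta>) * ?Q m \<le> ennreal (4 * \<delta>) + ennreal (2 / \<delta>) * ennreal (r * \<delta> / 4)"
        using elim by (intro add_left_mono mult_left_mono) auto
      also have "\<dots> = ennreal r"
        using \<delta> r by (simp add: ennreal_mult[symmetric] ennreal_plus[symmetric] \<delta>_def del: ennreal_plus)
      finally show ?case using bound[OF \<delta>, of m] r(2) by (meson le_less_trans order_trans)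
    qed
  qed simp
  then show ?thesis by (rule LIMSEQ_imp_Suc)
qed

lemma measurable_posterior: "(\<lambda>x. posterior g n (x m)) \<in> borel_measurable P"
  by (rule measurable_compose[OF measurable_coord_P]) simp

text \<open>
  The second moments of a reversed martingale decrease, hence converge, and their differences are the
  squared \<open>L\<^sup>2\<close> distances.
\<close>

lemma posterior_L1_cauchy:
  assumes e: "0 < e"
  shows "\<exists>N\<ge>1. \<forall>i\<ge>N. \<forall>j\<ge>N. (\<integral>x. \<bar>posterior g i (x i) - posterior g j (x j)\<bar> \<partial>P) < e"
proof -
  define E where "E n = (\<integral>x. (posterior g (Suc n) (x (Suc n)))\<^sup>2 \<partial>P)" for n
  have E_diff: "E i - E j = (\<integral>x. (posterior g (Suc i) (x (Suc i)) - posterior g (Suc j) (x (Suc j)))\<^sup>2 \<partial>P)" if "i \<le> j" for i j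
    using posterior_L2[of "Suc i" "Suc j" g] that by (simp add: E_def)
  have "0 \<le> E i - E j" if "i \<le> j" for i j unfolding E_diff[OF that] by simp
  then have "decseq E" by (simp add: decseq_def)
  moreover have "0 \<le> E i" for i unfolding E_def by simp
  ultimately obtain L where "E \<longlonglongrightarrow> L" using decseq_convergent by metis
  then have "Cauchy E" by (rule LIMSEQ_imp_Cauchy)
  then obtain N where N: "\<And>i j. i \<ge> N \<Longrightarrow> j \<ge> N \<Longrightarrow> \<bar>E i - E j\<bar> < e\<^sup>2 / 4"
    using e by (metis (no_types, lifting) Cauchy_def dist_real_def divide_pos_pos zero_less_numeral zero_less_power)
  have *: "(\<integral>x. \<bar>posterior g (Suc i) (x (Suc i)) - posterior g (Suc j) (x (Suc j))\<bar> \<partial>P) < e" if "N \<le> i" "i \<le> j" for i j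
  proof -
    let ?d = "\<lambda>x. posterior g (Suc i) (x (Suc i)) - posterior g (Suc j) (x (Suc j))"
    have d: "integrable P ?d" by (intro Bochner_Integration.integrable_diff integrable_posterior) auto
    have d1: "\<bar>?d x\<bar> \<le> 1" for x
      using posterior_le_1[of "Suc i" g "x (Suc i)"] posterior_le_1[of "Suc j" g "x (Suc j)"]
        posterior_nonneg[of g "Suc i" "x (Suc i)"] posterior_nonneg[of g "Suc j" "x (Suc j)"] unfolding abs_le_iff by linarith
    have d2: "integrable P (\<lambda>x. (?d x)\<^sup>2)"
      by (rule P.integrable_const_bound[where B = 1])
        (use d d1 in \<open>auto simp: abs_square_le_1 intro!: borel_measurable_power\<close>)
    have "(\<integral>x. \<bar>?d x\<bar> \<partial>P) \<le> (\<integral>x. e / 2 + (?d x)\<^sup>2 / (e / 2) \<partial>P)"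
      by (rule integral_mono) (use d d2 e abs_le_square[of "e / 2"] in auto)
    also have "\<dots> = e / 2 + (E i - E j) / (e / 2)"
      using d2 by (simp add: E_diff[OF that(2)] P.prob_space[simplified])
    also have "\<dots> < e / 2 + (e\<^sup>2 / 4) / (e / 2)"
      using N[of i j] that e by (intro add_strict_left_mono divide_strict_right_mono) linarith+
    also have "\<dots> = e" using e by (simp add: power2_eq_square field_simps)
    finally show ?thesis .
  qed
  have "(\<integral>x. \<bar>posterior g i (x i) - posterior g j (x j)\<bar> \<partial>P) < e" if le: "Suc N \<le> i" "Suc N \<le> j" for i j
  proof -
    obtain i' where i': "i = Suc i'" "N \<le> i'" using le(1) by (cases i) auto
    obtain j' where j': "j = Suc j'" "N \<le> j'" using le(2) by (cases j) auto
    note ij = i' j'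
    show ?thesis
    proof (cases "i' \<le> j'")
      case True then show ?thesis using *[of i' j'] ij by simp
    next
      case False then show ?thesis using *[of j' i'] ij by (simp add: abs_minus_commute)
    qed
  qed
  then show ?thesis by (intro exI[of _ "Suc N"]) auto
qed

lemma posterior_subseq_exists: "\<exists>r. strict_mono r \<and> (AE x in P. convergent (\<lambda>i. posterior g (r i) (x (r i))))"
proof -
  let ?s = "\<lambda>n x. posterior g (Suc n) (x (Suc n))"
  have int: "integrable P (?s n)" for n by (rule integrable_posterior) simp
  have "\<exists>N. \<forall>i\<ge>N. \<forall>j\<ge>N. (\<integral>x. norm (?s i x - ?s j x) \<partial>P) < e" if e: "0 < e" for e
  proof -
    obtain N where "\<forall>i\<ge>N. \<forall>j\<ge>N. (\<integral>x. \<bar>posterior g i (x i) - posterior g j (x j)\<bar> \<partial>P) < e"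
      using posterior_L1_cauchy[OF e, of g] by blast
    then show ?thesis by (intro exI[of _ N]) simp
  qed
  then obtain r where r: "strict_mono r" "AE x in P. Cauchy (\<lambda>i. ?s (r i) x)"
    using cauchy_L1_AE_cauchy_subseq[of P ?s, OF int] by blast
  show ?thesis
    by (rule exI[of _ "\<lambda>i. Suc (r i)"])
      (use r in \<open>auto simp: strict_mono_def Cauchy_convergent_iff elim: eventually_mono\<close>)
qed

definition posterior_subseq :: "'g \<Rightarrow> nat \<Rightarrow> nat" where
  "posterior_subseq g = (SOME r. strict_mono r \<and> (AE x in P. convergent (\<lambda>i. posterior g (r i) (x (r i)))))"

lemma strict_mono_posterior_subseq: "strict_mono (posterior_subseq g)"
  and AE_posterior_subseq: "AE x in P. convergent (\<lambda>i. posterior g (posterior_subseq g i) (x (posterior_subseq g i)))"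
  using someI_ex[OF posterior_subseq_exists[of g]] unfolding posterior_subseq_def by auto

text \<open>
  The limit of the posterior, seen by a path that is taken to start at time \<open>n\<close>. A fixed subsequence of
  times yields almost sure convergence.
\<close>

definition Z :: "'g \<Rightarrow> nat \<Rightarrow> (nat \<Rightarrow> 'g) \<Rightarrow> real" where
  "Z g n z = lim (\<lambda>i. posterior g (posterior_subseq g i) (z (posterior_subseq g i - n)))"

lemma Z_measurable [measurable]: "Z g n \<in> borel_measurable P"
  unfolding Z_def by (rule borel_measurable_lim_metric) (rule measurable_posterior)

lemma Z_shift:
  assumes "convergent (\<lambda>i. posterior g (posterior_subseq g i) (x (posterior_subseq g i)))"
  shows "Z g n (\<lambda>i. x (n + i)) = Z g 0 x"
proof -
  have 0: "(\<lambda>i. posterior g (posterior_subseq g i) (x (posterior_subseq g i))) \<longlonglongrightarrow> Z g 0 x"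
    using assms by (simp add: Z_def convergent_LIMSEQ_iff)
  have "\<forall>\<^sub>F i in sequentially. posterior g (posterior_subseq g i) (x (n + (posterior_subseq g i - n))) = posterior g (posterior_subseq g i) (x (posterior_subseq g i))"
    using eventually_ge_at_top[of n]
  proof eventually_elim
    case (elim i)
    have "n \<le> posterior_subseq g i" using elim strict_mono_imp_increasing[OF strict_mono_posterior_subseq, of i g] by linarith
    then show ?case by simp
  qed
  then have "(\<lambda>i. posterior g (posterior_subseq g i) (x (n + (posterior_subseq g i - n)))) \<longlonglongrightarrow> Z g 0 x"
    using 0 by (simp add: tendsto_cong)
  then show ?thesis unfolding Z_def[of g n] by (rule limI)
qed

lemma Z_bounds: "AE x in P. 0 \<le> Z g 0 x \<and> Z g 0 x \<le> 1"
  using AE_posterior_subseq[of g]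
proof eventually_elim
  case (elim x)
  have l: "(\<lambda>i. posterior g (posterior_subseq g i) (x (posterior_subseq g i))) \<longlonglongrightarrow> Z g 0 x"
    using elim by (simp add: Z_def convergent_LIMSEQ_iff)
  have "\<exists>N. \<forall>i\<ge>N. posterior g (posterior_subseq g i) (x (posterior_subseq g i)) \<le> 1"
  proof (intro exI allI impI)
    fix i :: nat assume "1 \<le> i"
    then show "posterior g (posterior_subseq g i) (x (posterior_subseq g i)) \<le> 1"
      using strict_mono_imp_increasing[OF strict_mono_posterior_subseq, of i g] by (intro posterior_le_1) linarith
  qed
  with l show ?case by (auto intro: LIMSEQ_le_const LIMSEQ_le_const2)
qed

lemma integrable_Z: "integrable P (Z g 0)"
  by (rule P.integrable_const_bound[where B = 1]) (use Z_bounds[of g] in \<open>auto elim: eventually_mono\<close>)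

lemma posterior_tendsto_Z: "(\<lambda>m. \<integral>x. \<bar>posterior g m (x m) - Z g 0 x\<bar> \<partial>P) \<longlonglongrightarrow> 0"
proof (rule LIMSEQ_I)
  fix e :: real assume e: "0 < e"
  obtain N where N: "1 \<le> N" "\<And>i j. i \<ge> N \<Longrightarrow> j \<ge> N \<Longrightarrow> (\<integral>x. \<bar>posterior g i (x i) - posterior g j (x j)\<bar> \<partial>P) < e / 2"
    using posterior_L1_cauchy[of "e / 2" g] e by auto
  have "(\<integral>x. \<bar>posterior g m (x m) - Z g 0 x\<bar> \<partial>P) \<le> e / 2" if m: "N \<le> m" for m
  proof (rule LIMSEQ_le_const2)
    show "(\<lambda>i. \<integral>x. \<bar>posterior g m (x m) - posterior g (posterior_subseq g (i + 1)) (x (posterior_subseq g (i + 1)))\<bar> \<partial>P) \<longlonglongrightarrow> (\<integral>x. \<bar>posterior g m (x m) - Z g 0 x\<bar> \<partial>P)"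
    proof (rule integral_dominated_convergence[where w = "\<lambda>_. 2"])
      show "AE x in P. (\<lambda>i. \<bar>posterior g m (x m) - posterior g (posterior_subseq g (i + 1)) (x (posterior_subseq g (i + 1)))\<bar>) \<longlonglongrightarrow> \<bar>posterior g m (x m) - Z g 0 x\<bar>"
        using AE_posterior_subseq[of g]
      proof eventually_elim
        case (elim x)
        have "(\<lambda>i. posterior g (posterior_subseq g i) (x (posterior_subseq g i))) \<longlonglongrightarrow> Z g 0 x"
          using elim by (simp add: Z_def convergent_LIMSEQ_iff)
        then have "(\<lambda>i. posterior g (posterior_subseq g (i + 1)) (x (posterior_subseq g (i + 1)))) \<longlonglongrightarrow> Z g 0 x"
          by (rule LIMSEQ_ignore_initial_segment)
        then show ?case by (intro tendsto_intros)
      qed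
      fix i
      have "1 \<le> posterior_subseq g (i + 1)" using strict_mono_imp_increasing[OF strict_mono_posterior_subseq, of "i + 1" g] by linarith
      then show "AE x in P. norm \<bar>posterior g m (x m) - posterior g (posterior_subseq g (i + 1)) (x (posterior_subseq g (i + 1)))\<bar> \<le> 2"
        using m N(1) by (intro AE_I2) (smt (verit) order_trans posterior_le_1 posterior_nonneg real_norm_def)
    qed (auto intro!: borel_measurable_abs borel_measurable_diff measurable_posterior)
    show "\<exists>M. \<forall>i\<ge>M. (\<integral>x. \<bar>posterior g m (x m) - posterior g (posterior_subseq g (i + 1)) (x (posterior_subseq g (i + 1)))\<bar> \<partial>P) \<le> e / 2"
    proof (intro exI allI impI)
      fix i assume "N \<le> i"
      then have "N \<le> posterior_subseq g (i + 1)" using strict_mono_imp_increasing[OF strict_mono_posterior_subseq, of "i + 1" g] by linarith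
      then show "(\<integral>x. \<bar>posterior g m (x m) - posterior g (posterior_subseq g (i + 1)) (x (posterior_subseq g (i + 1)))\<bar> \<partial>P) \<le> e / 2"
        using N(2)[OF m] by (simp add: less_imp_le)
    qed
  qed
  then show "\<exists>N. \<forall>m\<ge>N. norm ((\<integral>x. \<bar>posterior g m (x m) - Z g 0 x\<bar> \<partial>P) - 0) < e"
    using e by (intro exI[of _ N]) fastforce
qed

lemma posterior_tendsto_Z_nn: "(\<lambda>m. \<integral>\<^sup>+x. ennreal \<bar>posterior g m (x m) - Z g 0 x\<bar> \<partial>P) \<longlonglongrightarrow> 0"
proof -
  have "\<forall>\<^sub>F m in sequentially. (\<integral>\<^sup>+x. ennreal \<bar>posterior g m (x m) - Z g 0 x\<bar> \<partial>P) = ennreal (\<integral>x. \<bar>posterior g m (x m) - Z g 0 x\<bar> \<partial>P)"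
    using eventually_ge_at_top[of 1]
  proof eventually_elim
    case (elim m)
    then show ?case
      by (intro nn_integral_eq_integral integrable_abs Bochner_Integration.integrable_diff integrable_posterior integrable_Z) auto
  qed
  moreover have "(\<lambda>m. ennreal (\<integral>x. \<bar>posterior g m (x m) - Z g 0 x\<bar> \<partial>P)) \<longlonglongrightarrow> ennreal 0"
    by (intro tendsto_ennrealI posterior_tendsto_Z)
  ultimately show ?thesis by (simp add: tendsto_cong)
qed

lemma measurable_translate_P: "(\<lambda>x i. y + x i) \<in> P \<rightarrow>\<^sub>M P"
  using measurable_translate[of y] by (simp add: measurable_cong_sets[OF sets_P sets_P])

lemma posterior_tendsto_Z_from:
  assumes y: "0 < p n y"
  shows "(\<lambda>m. \<integral>\<^sup>+x. ennreal \<bar>posterior g (m + n) (y + x m) - Z g n (\<lambda>i. y + x i)\<bar> \<partial>P) \<longlonglongrightarrow> 0"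
proof -
  have Zm: "(\<lambda>x. Z g n (\<lambda>i. y + x i)) \<in> borel_measurable P"
    by (rule measurable_compose[OF measurable_translate_P Z_measurable])
  have postm: "(\<lambda>x. posterior g (m + n) (y + x m)) \<in> borel_measurable P" for m
    by (rule measurable_compose[OF measurable_coord_P]) simp
  have le: "ennreal (p n y) * (\<integral>\<^sup>+x. ennreal \<bar>posterior g (m + n) (y + x m) - Z g n (\<lambda>i. y + x i)\<bar> \<partial>P)
     \<le> (\<integral>\<^sup>+x. ennreal \<bar>posterior g (m + n) (x (m + n)) - Z g 0 x\<bar> \<partial>P)" for m
  proof -
    have "ennreal (p n y) * (\<integral>\<^sup>+x. ennreal \<bar>posterior g (m + n) (y + x m) - Z g n (\<lambda>i. y + x i)\<bar> \<partial>P)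
      = (\<integral>\<^sup>+x. ennreal \<bar>posterior g (m + n) (y + restart n x m) - Z g n (\<lambda>i. y + restart n x i)\<bar> * indicator (cylinder n y) x \<partial>P)"
      by (rule nn_integral_restart_cylinder[symmetric]) (use Zm postm in measurable)
    also have "\<dots> \<le> (\<integral>\<^sup>+x. ennreal \<bar>posterior g (m + n) (x (m + n)) - Z g 0 x\<bar> \<partial>P)"
    proof (rule nn_integral_mono_AE)
      show "AE x in P. ennreal \<bar>posterior g (m + n) (y + restart n x m) - Z g n (\<lambda>i. y + restart n x i)\<bar> * indicator (cylinder n y) x
        \<le> ennreal \<bar>posterior g (m + n) (x (m + n)) - Z g 0 x\<bar>"
        using AE_posterior_subseq[of g]
      proof eventually_elim
        case (elim x)
        show ?case
        proof (cases "x n = y")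
          case True
          then have eq: "y + restart n x i = x (n + i)" for i
            by (simp add: restart_def add.assoc[symmetric])
          show ?thesis using Z_shift[OF elim, of n] True by (simp add: eq cylinder_def add.commute)
        qed (simp add: cylinder_def)
      qed
    qed
    finally show ?thesis .
  qed
  have h0: "(\<lambda>m. \<integral>\<^sup>+x. ennreal \<bar>posterior g (m + n) (x (m + n)) - Z g 0 x\<bar> \<partial>P) \<longlonglongrightarrow> 0"
    by (rule LIMSEQ_ignore_initial_segment[OF posterior_tendsto_Z_nn])
  have "(\<lambda>m. ennreal (p n y) * (\<integral>\<^sup>+x. ennreal \<bar>posterior g (m + n) (y + x m) - Z g n (\<lambda>i. y + x i)\<bar> \<partial>P)) \<longlonglongrightarrow> 0"
    by (rule tendsto_sandwich[OF _ _ tendsto_const h0]) (use le in auto)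
  then have "(\<lambda>m. ennreal (1 / p n y) * (ennreal (p n y) * (\<integral>\<^sup>+x. ennreal \<bar>posterior g (m + n) (y + x m) - Z g n (\<lambda>i. y + x i)\<bar> \<partial>P))) \<longlonglongrightarrow> ennreal (1 / p n y) * 0"
    by (intro ennreal_tendsto_cmult) auto
  moreover have "ennreal (1 / p n y) * (ennreal (p n y) * c) = c" for c
    using y by (simp add: mult.assoc[symmetric] ennreal_mult[symmetric])
  ultimately show ?thesis by simp
qed

lemma overlap_from:
  assumes y: "0 < p n y" "0 < p (n + k) y"
  shows "(\<lambda>m. \<integral>\<^sup>+x. ennreal \<bar>posterior g (m + n) (y + x m) - posterior g (m + (n + k)) (y + x m)\<bar> \<partial>P) \<longlonglongrightarrow> 0"
proof -
  \<comment> \<open>the law at time m of the walk started at y is at most 1 / c times both laws\<close>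
  define c where "c = min (p n y) (p (n + k) y)"
  have c: "0 < c" using y by (simp add: c_def)
  let ?d = "\<lambda>m z. \<bar>posterior g (m + n) z - posterior g (m + (n + k)) z\<bar>"
  let ?O = "\<lambda>m. \<integral>\<^sup>+z. ennreal (min (p m z) (p (m + k) z) * \<bar>posterior g m z - posterior g (m + k) z\<bar>) \<partial>count_space UNIV"
  have le: "ennreal c * (\<integral>\<^sup>+x. ennreal (?d m (y + x m)) \<partial>P) \<le> ?O (m + n)" for m
  proof -
    have "(\<integral>\<^sup>+x. ennreal (?d m (y + x m)) \<partial>P) = (\<integral>\<^sup>+u. (\<integral>\<^sup>+x. ennreal (?d m (y + u)) * indicator (cylinder m u) x \<partial>P) \<partial>count_space UNIV)"
      by (rule nn_integral_split) simp
    also have "\<dots> = (\<integral>\<^sup>+u. ennreal (?d m (y + u) * p m (- y + (y + u))) \<partial>count_space UNIV)"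
      by (simp add: nn_integral_cmult emeasure_cylinder ennreal_mult add.assoc[symmetric])
    also have "\<dots> = (\<integral>\<^sup>+z. ennreal (?d m z * p m (- y + z)) \<partial>count_space UNIV)"
      using nn_integral_translate[of "\<lambda>u. ennreal (?d m (y + u) * p m (- y + (y + u)))" y]
      by (simp add: add.assoc[symmetric])
    finally have "ennreal c * (\<integral>\<^sup>+x. ennreal (?d m (y + x m)) \<partial>P) = (\<integral>\<^sup>+z. ennreal (c * (?d m z * p m (- y + z))) \<partial>count_space UNIV)"
      using c by (simp add: nn_integral_cmult[symmetric] ennreal_mult[symmetric])
    also have "\<dots> \<le> ?O (m + n)"
    proof (intro nn_integral_mono ennreal_leI)
      fix z
      have cancel: "y + (- y + z) = z" by (simp add: add.assoc[symmetric])
      have order: "n + k + m = m + n + k" by simp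
      have "p n y * p m (- y + z) \<le> p (m + n) z"
        using p_add_ge[of n y m "- y + z"] unfolding cancel add.commute[of n m] .
      moreover have "p (n + k) y * p m (- y + z) \<le> p (m + n + k) z"
        using p_add_ge[of "n + k" y m "- y + z"] unfolding cancel order .
      moreover have "c * p m (- y + z) \<le> p n y * p m (- y + z)" "c * p m (- y + z) \<le> p (n + k) y * p m (- y + z)"
        by (auto intro!: mult_right_mono simp: c_def)
      ultimately have "c * p m (- y + z) \<le> min (p (m + n) z) (p (m + n + k) z)" by simp
      then have "(c * p m (- y + z)) * ?d m z \<le> min (p (m + n) z) (p (m + n + k) z) * ?d m z"
        by (intro mult_right_mono) auto
      then show "c * (?d m z * p m (- y + z)) \<le> min (p (m + n) z) (p (m + n + k) z) * \<bar>posterior g (m + n) z - posterior g (m + n + k) z\<bar>"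
        by (simp add: mult_ac add.assoc)
    qed
    finally show ?thesis .
  qed
  have h0: "(\<lambda>m. ?O (m + n)) \<longlonglongrightarrow> 0" by (rule LIMSEQ_ignore_initial_segment[OF overlap_tendsto_0])
  have "(\<lambda>m. ennreal c * (\<integral>\<^sup>+x. ennreal (?d m (y + x m)) \<partial>P)) \<longlonglongrightarrow> 0"
    by (rule tendsto_sandwich[OF _ _ tendsto_const h0]) (use le in auto)
  then have "(\<lambda>m. ennreal (1 / c) * (ennreal c * (\<integral>\<^sup>+x. ennreal (?d m (y + x m)) \<partial>P))) \<longlonglongrightarrow> ennreal (1 / c) * 0"
    by (intro ennreal_tendsto_cmult) auto
  moreover have "ennreal (1 / c) * (ennreal c * u) = u" for u
    using c by (simp add: mult.assoc[symmetric] ennreal_mult[symmetric])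
  ultimately show ?thesis by simp
qed

text \<open>
  If a site \<open>y\<close> can be reached at the times \<open>n\<close> and \<open>n + k\<close>, the law of the walk started at \<open>y\<close> is, at
  each later time, dominated by multiples of both laws in the overlap estimate. So the posteriors computed with the two
  time labels have the same limit.
\<close>

lemma Z_agree:
  assumes y: "0 < p n y" "0 < p (n + k) y"
  shows "AE x in P. Z g n (\<lambda>i. y + x i) = Z g (n + k) (\<lambda>i. y + x i)"
proof -
  let ?Z = "\<lambda>n x. Z g n (\<lambda>i. y + x i)" and ?W = "\<lambda>j m x. posterior g j (y + x m)"
  have [measurable]: "?Z n \<in> borel_measurable P" for n
    by (rule measurable_compose[OF measurable_translate_P Z_measurable])
  have [measurable]: "?W j m \<in> borel_measurable P" for j m
    by (rule measurable_compose[OF measurable_coord_P]) simp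
  have le: "(\<integral>\<^sup>+x. ennreal \<bar>?Z n x - ?Z (n + k) x\<bar> \<partial>P) \<le>
    (\<integral>\<^sup>+x. ennreal \<bar>?W (m + n) m x - ?Z n x\<bar> \<partial>P) + (\<integral>\<^sup>+x. ennreal \<bar>?W (m + n) m x - ?W (m + (n + k)) m x\<bar> \<partial>P)
      + (\<integral>\<^sup>+x. ennreal \<bar>?W (m + (n + k)) m x - ?Z (n + k) x\<bar> \<partial>P)" for m
  proof -
    have "(\<integral>\<^sup>+x. ennreal \<bar>?Z n x - ?Z (n + k) x\<bar> \<partial>P) \<le>
      (\<integral>\<^sup>+x. ennreal \<bar>?W (m + n) m x - ?Z n x\<bar> + ennreal \<bar>?W (m + n) m x - ?W (m + (n + k)) m x\<bar>
      + ennreal \<bar>?W (m + (n + k)) m x - ?Z (n + k) x\<bar> \<partial>P)"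
      by (rule nn_integral_mono) (auto simp: ennreal_plus[symmetric] simp del: ennreal_plus intro!: ennreal_leI)
    then show ?thesis by (simp add: nn_integral_add)
  qed
  have "(\<lambda>m. (\<integral>\<^sup>+x. ennreal \<bar>?W (m + n) m x - ?Z n x\<bar> \<partial>P) + (\<integral>\<^sup>+x. ennreal \<bar>?W (m + n) m x - ?W (m + (n + k)) m x\<bar> \<partial>P)
      + (\<integral>\<^sup>+x. ennreal \<bar>?W (m + (n + k)) m x - ?Z (n + k) x\<bar> \<partial>P)) \<longlonglongrightarrow> 0 + 0 + 0"
    by (intro tendsto_add posterior_tendsto_Z_from overlap_from y)
  then have "(\<integral>\<^sup>+x. ennreal \<bar>?Z n x - ?Z (n + k) x\<bar> \<partial>P) \<le> 0"
    by (intro LIMSEQ_le_const) (use le in auto)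
  then have "(\<integral>\<^sup>+x. ennreal \<bar>?Z n x - ?Z (n + k) x\<bar> \<partial>P) = 0" by simp
  then have "AE x in P. ennreal \<bar>?Z n x - ?Z (n + k) x\<bar> = 0"
    by (rule nn_integral_0_iff_AE[THEN iffD1, rotated]) measurable
  then show ?thesis by eventually_elim (simp add: ennreal_eq_0_iff)
qed

lemma Z_agree_along:
  "AE x in P. \<forall>m n. 0 < p n (x m) \<longrightarrow> Z g n (\<lambda>i. x (m + i)) = Z g m (\<lambda>i. x (m + i))"
proof -
  have 1: "AE z in P. Z g n (\<lambda>i. y + z i) = Z g m (\<lambda>i. y + z i)" if "0 < p n y" "0 < p m y" for n m y
  proof (cases "n \<le> m")
    case True
    then show ?thesis using Z_agree[of n y "m - n" g] that by simp
  next
    case False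
    then have "AE z in P. Z g m (\<lambda>i. y + z i) = Z g n (\<lambda>i. y + z i)" using Z_agree[of m y "n - m" g] that by simp
    then show ?thesis by eventually_elim simp
  qed
  have "AE x in P. 0 < p n (x m) \<longrightarrow> Z g n (\<lambda>i. x (m + i)) = Z g m (\<lambda>i. x (m + i))" for m n
  proof (rule AE_at_coord[where R = "\<lambda>y x. 0 < p n y \<longrightarrow> Z g n (\<lambda>i. x (m + i)) = Z g m (\<lambda>i. x (m + i))"])
    fix y
    show "AE x in P. x m = y \<longrightarrow> 0 < p n y \<longrightarrow> Z g n (\<lambda>i. x (m + i)) = Z g m (\<lambda>i. x (m + i))"
    proof (cases "0 < p n y \<and> 0 < p m y")
      case True
      have "AE x in P. Z g n (\<lambda>i. y + restart m x i) = Z g m (\<lambda>i. y + restart m x i)"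
        by (rule AE_restart, rule 1) (use True in auto)
      then show ?thesis
        by eventually_elim (auto simp: restart_def add.assoc[symmetric])
    next
      case False
      then show ?thesis using AE_p_pos[of m] by (auto elim!: eventually_mono)
    qed
  qed
  then show ?thesis by (simp add: AE_all_countable)
qed

text \<open>
  A shift-invariant version of the limit. The supremum over all time labels that the current
  position admits, and the upper limit over the current time, make the invariance hold for every path; along
  almost every path of the walk all the values involved are equal.
\<close>

definition Zinv :: "'g \<Rightarrow> (nat \<Rightarrow> 'g) \<Rightarrow> ennreal" where
  "Zinv g z = limsup (\<lambda>m. SUP n. if 0 < p n (z m) then ennreal (Z g n (\<lambda>i. z (m + i))) else 0)"

lemma Zinv_shift: "Zinv g (time_shift z) = Zinv g z"
proof -
  have "Zinv g (time_shift z) = limsup (\<lambda>m. SUP n. if 0 < p n (z (m + 1)) then ennreal (Z g n (\<lambda>i. z (m + 1 + i))) else 0)"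
    by (simp add: Zinv_def time_shift_def)
  also have "\<dots> = Zinv g z"
    unfolding Zinv_def by (rule limsup_shift)
  finally show ?thesis .
qed

lemma Zinv_measurable [measurable]: "Zinv g \<in> borel_measurable P"
proof -
  have "(\<lambda>z i. z (m + i)) \<in> P \<rightarrow>\<^sub>M P" for m
    using measurable_into_path_space[of "\<lambda>z i. z (m + i)" P, OF measurable_coord_P]
    by (simp add: measurable_cong_sets[OF refl sets_P])
  note [measurable] = measurable_compose[OF this Z_measurable]
  have [measurable]: "Measurable.pred P (\<lambda>z. 0 < p n (z m))" for n m
    by (rule measurable_compose[OF measurable_coord_P]) simp
  show ?thesis unfolding Zinv_def by measurable
qed

lemma Zinv_eq: "AE x in P. Zinv g x = ennreal (Z g 0 x)"
proof -
  have "AE x in P. \<forall>m. 0 < p m (x m)" using AE_p_pos by (simp add: AE_all_countable)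
  then show ?thesis using Z_agree_along[of g] AE_posterior_subseq[of g]
  proof eventually_elim
    case (elim x)
    have "(SUP n. if 0 < p n (x m) then ennreal (Z g n (\<lambda>i. x (m + i))) else 0) = ennreal (Z g 0 x)" for m
    proof (rule antisym)
      show "(SUP n. if 0 < p n (x m) then ennreal (Z g n (\<lambda>i. x (m + i))) else 0) \<le> ennreal (Z g 0 x)"
        using elim(2) Z_shift[OF elim(3), of m] by (intro SUP_least) auto
      show "ennreal (Z g 0 x) \<le> (SUP n. if 0 < p n (x m) then ennreal (Z g n (\<lambda>i. x (m + i))) else 0)"
        using elim(1) Z_shift[OF elim(3), of m] by (intro SUP_upper2[of m]) auto
    qed
    then show ?case by (simp add: Zinv_def Limsup_const)
  qed
qed

end

context conditioned_walk begin

text \<open>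
  Given the position at time \<open>n\<close>, a set in \<open>F\<close> only depends on the restarted path, so it cannot
  distinguish the indicator of the first step from its posterior.
\<close>

lemma posterior_on_F:
  assumes A: "A \<in> sets F" and n: "1 \<le> n"
  shows "(\<integral>\<^sup>+x. ennreal (posterior g n (x n)) * indicator A x \<partial>P) = (\<integral>\<^sup>+x. indicator (cylinder 1 g) x * indicator A x \<partial>P)"
proof -
  obtain A' where A': "\<And>y. A' y \<in> sets F" and ae: "AE x in P. x \<in> A \<longleftrightarrow> restart n x \<in> A' (x n)"
    using restart_sections[OF A] by blast
  have "(\<integral>\<^sup>+x. ennreal (posterior g n (x n)) * indicator A x \<partial>P)
      = (\<integral>\<^sup>+x. ennreal (posterior g n (x n)) * indicator (A' (x n)) (restart n x) \<partial>P)"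
    by (rule nn_integral_cong_AE) (use ae in \<open>eventually_elim, simp add: indicator_def\<close>)
  also have "\<dots> = (\<integral>\<^sup>+x. indicator (cylinder 1 g) x * indicator (A' (x n)) (restart n x) \<partial>P)"
    by (rule posterior_integral_restart[OF n, of "\<lambda>y. indicator (A' y)"]) (use sets_F_P[OF A'] in simp)
  also have "\<dots> = (\<integral>\<^sup>+x. indicator (cylinder 1 g) x * indicator A x \<partial>P)"
    by (rule nn_integral_cong_AE) (use ae in \<open>eventually_elim, simp add: indicator_def\<close>)
  finally show ?thesis .
qed

lemma Z_integral:
  assumes A: "A \<in> sets F"
  shows "(\<integral>\<^sup>+x. ennreal (Z g 0 x) * indicator A x \<partial>P) = (\<integral>\<^sup>+x. indicator (cylinder 1 g) x * indicator A x \<partial>P)"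
proof -
  have AP: "A \<in> sets P" by (rule sets_F_P[OF A])
  have iA: "integrable P (\<lambda>x. u x * indicator A x)" if "integrable P u" for u :: "_ \<Rightarrow> real"
    using integrable_mult_indicator[OF AP that] by (simp add: mult.commute)
  have nn: "(\<integral>\<^sup>+x. ennreal (u x) * indicator A x \<partial>P) = ennreal (\<integral>x. u x * indicator A x \<partial>P)"
    if "integrable P u" "AE x in P. 0 \<le> u x" for u :: "_ \<Rightarrow> real"
  proof -
    have "(\<integral>\<^sup>+x. ennreal (u x) * indicator A x \<partial>P) = (\<integral>\<^sup>+x. ennreal (u x * indicator A x) \<partial>P)"
      by (rule nn_integral_cong) (simp add: indicator_def)
    also have "\<dots> = ennreal (\<integral>x. u x * indicator A x \<partial>P)"
      by (rule nn_integral_eq_integral[OF iA[OF that(1)]]) (use that(2) in \<open>eventually_elim, simp\<close>)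
    finally show ?thesis .
  qed
  let ?c = "\<integral>x. posterior g 1 (x 1) * indicator A x \<partial>P"
  have const: "(\<integral>x. posterior g (Suc n) (x (Suc n)) * indicator A x \<partial>P) = ?c" for n
  proof -
    have "ennreal (\<integral>x. posterior g (Suc n) (x (Suc n)) * indicator A x \<partial>P) = ennreal ?c"
      using posterior_on_F[OF A, of "Suc n" g] posterior_on_F[OF A, of 1 g]
        nn[OF integrable_posterior[of "Suc n" g]] nn[OF integrable_posterior[of 1 g]] by simp
    then show ?thesis by (subst (asm) ennreal_inj) (auto intro!: integral_nonneg_AE)
  qed
  have "(\<lambda>n. \<integral>x. posterior g (Suc n) (x (Suc n)) * indicator A x \<partial>P) \<longlonglongrightarrow> (\<integral>x. Z g 0 x * indicator A x \<partial>P)"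
  proof (rule LIM_zero_cancel, rule Lim_null_comparison)
    show "(\<lambda>n. \<integral>x. \<bar>posterior g (Suc n) (x (Suc n)) - Z g 0 x\<bar> \<partial>P) \<longlonglongrightarrow> 0"
      using LIMSEQ_Suc[OF posterior_tendsto_Z[of g]] .
    show "\<forall>\<^sub>F n in sequentially. norm ((\<integral>x. posterior g (Suc n) (x (Suc n)) * indicator A x \<partial>P) - (\<integral>x. Z g 0 x * indicator A x \<partial>P))
      \<le> (\<integral>x. \<bar>posterior g (Suc n) (x (Suc n)) - Z g 0 x\<bar> \<partial>P)"
    proof (rule always_eventually, rule allI)
      fix n
      let ?W = "\<lambda>x. posterior g (Suc n) (x (Suc n))"
      have W: "integrable P ?W" by (rule integrable_posterior) simp
      have "(\<integral>x. ?W x * indicator A x \<partial>P) - (\<integral>x. Z g 0 x * indicator A x \<partial>P) = (\<integral>x. ?W x * indicator A x - Z g 0 x * indicator A x \<partial>P)"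
        by (rule Bochner_Integration.integral_diff[symmetric, OF iA[OF W] iA[OF integrable_Z]])
      also have "norm \<dots> \<le> (\<integral>x. norm (?W x * indicator A x - Z g 0 x * indicator A x) \<partial>P)"
        by (rule integral_norm_bound)
      also have "\<dots> \<le> (\<integral>x. \<bar>?W x - Z g 0 x\<bar> \<partial>P)"
        by (rule integral_mono)
          (use iA[OF W] iA[OF integrable_Z] W integrable_Z in \<open>auto simp: indicator_def\<close>)
      finally show "norm ((\<integral>x. ?W x * indicator A x \<partial>P) - (\<integral>x. Z g 0 x * indicator A x \<partial>P)) \<le> (\<integral>x. \<bar>?W x - Z g 0 x\<bar> \<partial>P)" .
    qed
  qed
  then have "?c = (\<integral>x. Z g 0 x * indicator A x \<partial>P)" unfolding const by (simp add: LIMSEQ_const_iff)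
  then show ?thesis
    using nn[OF integrable_Z, of g] Z_bounds[of g] posterior_on_F[OF A, of 1 g] nn[OF integrable_posterior[of 1 g]]
    by (auto elim: eventually_mono)
qed

end

text \<open>
  Maximality is used through the shift-invariant sets, because it is by invariance that the limit of
  the posterior of the first step is recognised as \<open>F\<close>-measurable.
\<close>

locale maximal_conditioned_walk = conditioned_walk +
  assumes invariant_sets: "\<And>A. A \<in> sets P \<Longrightarrow> time_shift -` A = A \<Longrightarrow> A \<in> sets F"
begin

lemma Zinv_measurable_F: "Zinv g \<in> borel_measurable F"
proof (rule measurableI)
  fix B :: "ennreal set" assume B: "B \<in> sets borel"
  have "Zinv g -` B \<in> sets F"
  proof (rule invariant_sets)
    show "Zinv g -` B \<in> sets P" using measurable_sets[OF Zinv_measurable B] by simp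
    show "time_shift -` (Zinv g -` B) = Zinv g -` B" by (auto simp: Zinv_shift)
  qed
  then show "Zinv g -` B \<inter> space F \<in> sets F" by simp
qed simp

lemma cp_eq_Z: "AE x in P. cp 1 g x = Z g 0 x"
proof -
  have "AE x in P. Zinv g x = cpe 1 g x"
    unfolding cpe_def
  proof (rule cond.nn_cond_exp_charact[OF _ _ Zinv_measurable_F])
    fix A assume A: "A \<in> sets F"
    have "(\<integral>\<^sup>+x\<in>A. Zinv g x \<partial>P) = (\<integral>\<^sup>+x. ennreal (Z g 0 x) * indicator A x \<partial>P)"
      by (rule nn_integral_cong_AE) (use Zinv_eq[of g] in \<open>eventually_elim, simp\<close>)
    then show "(\<integral>\<^sup>+x\<in>A. indicator (cylinder 1 g) x \<partial>P) = (\<integral>\<^sup>+x\<in>A. Zinv g x \<partial>P)"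
      using Z_integral[OF A, of g] by simp
  qed simp
  then show ?thesis using Zinv_eq[of g] Z_bounds[of g]
    by eventually_elim (metis cp_def enn2real_ennreal)
qed

lemma first_step_posterior_tendsto:
  "(\<lambda>m. \<integral>\<^sup>+x. ennreal \<bar>posterior (x 1) (Suc m) (x (Suc m)) - \<phi> 1 x\<bar> \<partial>P) \<longlonglongrightarrow> 0"
proof -
  let ?u = "\<lambda>m g. \<integral>\<^sup>+x. ennreal \<bar>posterior g (Suc m) (x (Suc m)) - cp 1 g x\<bar> * indicator (cylinder 1 g) x \<partial>P"
  have eq: "(\<integral>\<^sup>+x. ennreal \<bar>posterior (x 1) (Suc m) (x (Suc m)) - \<phi> 1 x\<bar> \<partial>P) = (\<integral>\<^sup>+g. ?u m g \<partial>count_space UNIV)" for m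
    unfolding \<phi>_def
    by (rule nn_integral_split[of "\<lambda>g x. ennreal \<bar>posterior g (Suc m) (x (Suc m)) - cp 1 g x\<bar>"])
      (intro measurable_compose[OF _ measurable_ennreal] borel_measurable_abs borel_measurable_diff measurable_posterior cp_meas_P)
  have "(\<lambda>m. \<integral>\<^sup>+g. ?u m g \<partial>count_space UNIV) \<longlonglongrightarrow> (\<integral>\<^sup>+g. 0 \<partial>count_space (UNIV :: 'a set))"
  proof (rule nn_integral_dominated_convergence[where w = "\<lambda>g. ennreal (p 1 g)"])
    show "(\<integral>\<^sup>+g. ennreal (p 1 g) \<partial>count_space UNIV) < \<infinity>" by (simp add: nn_integral_p del: One_nat_def)
    show "AE g in count_space UNIV. ?u m g \<le> ennreal (p 1 g)" for m
    proof (rule AE_I2)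
      fix g
      have "?u m g \<le> (\<integral>\<^sup>+x. indicator (cylinder 1 g) x \<partial>P)"
      proof (rule nn_integral_mono_AE)
        show "AE x in P. ennreal \<bar>posterior g (Suc m) (x (Suc m)) - cp 1 g x\<bar> * indicator (cylinder 1 g) x \<le> indicator (cylinder 1 g) x"
          using cp_le_1[of 1 g]
        proof eventually_elim
          case (elim x)
          have "\<bar>posterior g (Suc m) (x (Suc m)) - cp 1 g x\<bar> \<le> 1"
            using elim posterior_le_1[of "Suc m" g "x (Suc m)"] posterior_nonneg[of g "Suc m" "x (Suc m)"] cp_nonneg[of 1 g x]
            unfolding abs_le_iff by linarith
          then show ?case by (simp add: indicator_def)
        qed
      qed
      then show "?u m g \<le> ennreal (p 1 g)" by (simp add: emeasure_cylinder del: One_nat_def)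
    qed
    show "AE g in count_space UNIV. (\<lambda>m. ?u m g) \<longlonglongrightarrow> 0"
    proof (rule AE_I2)
      fix g
      have le: "?u m g \<le> (\<integral>\<^sup>+x. ennreal \<bar>posterior g (Suc m) (x (Suc m)) - Z g 0 x\<bar> \<partial>P)" for m
        by (rule nn_integral_mono_AE) (use cp_eq_Z[of g] in \<open>eventually_elim, simp add: indicator_def\<close>)
      show "(\<lambda>m. ?u m g) \<longlonglongrightarrow> 0"
        by (rule tendsto_sandwich[OF _ _ tendsto_const LIMSEQ_Suc[OF posterior_tendsto_Z_nn[of g]]]) (use le in auto)
    qed
  qed auto
  then show ?thesis unfolding eq by simp
qed

text \<open>
  Taking means, the conditional entropy of the first step given the position at time \<open>n + 1\<close> is
  \<open>H 1 + H n - H (n + 1)\<close>.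
\<close>

lemma minus_ln_posterior:
  "AE x in P. - ln (posterior (x 1) (Suc n) (x (Suc n))) = info 1 x + info n (restart 1 x) - info (Suc n) x"
  using AE_p_pos[of 1] AE_restart[OF AE_p_pos[of n], of 1] AE_p_pos[of "Suc n"]
proof eventually_elim
  case (elim x)
  have "restart 1 x n = - x 1 + x (Suc n)" by (simp add: restart_def)
  then have "posterior (x 1) (Suc n) (x (Suc n)) = p 1 (x 1) * p n (restart 1 x n) / p (Suc n) (x (Suc n))"
    by (simp add: posterior_def)
  then show ?case using elim by (simp add: info_def ln_div ln_mult)
qed

lemma integral_posterior:
  "integrable P (\<lambda>x. - ln (posterior (x 1) (Suc n) (x (Suc n))))"
  "(\<integral>x. - ln (posterior (x 1) (Suc n) (x (Suc n))) \<partial>P) = H 1 + H n - H (Suc n)"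
proof -
  have m: "(\<lambda>x. - ln (posterior (x 1) (Suc n) (x (Suc n)))) \<in> borel_measurable P"
    by (rule measurable_at_coord[of "\<lambda>g x. - ln (posterior g (Suc n) (x (Suc n)))"])
      (rule measurable_compose[OF measurable_posterior], simp)
  have i: "integrable P (\<lambda>x. info 1 x + info n (restart 1 x) - info (Suc n) x)"
    by (intro Bochner_Integration.integrable_diff Bochner_Integration.integrable_add integrable_info integrable_restart)
  show "integrable P (\<lambda>x. - ln (posterior (x 1) (Suc n) (x (Suc n))))"
    by (rule integrable_cong_AE_imp[OF i m]) (use minus_ln_posterior[of n] in \<open>eventually_elim, simp\<close>)
  have "(\<integral>x. - ln (posterior (x 1) (Suc n) (x (Suc n))) \<partial>P) = (\<integral>x. info 1 x + info n (restart 1 x) - info (Suc n) x \<partial>P)"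
    by (rule integral_cong_AE[OF m borel_measurable_integrable[OF i] minus_ln_posterior])
  also have "\<dots> = H 1 + H n - H (Suc n)"
    by (simp add: integrable_info integrable_restart integral_restart H_def)
  finally show "(\<integral>x. - ln (posterior (x 1) (Suc n) (x (Suc n))) \<partial>P) = H 1 + H n - H (Suc n)" .
qed

text \<open>
  Otherwise, along a subsequence, the conditional entropy of the first step given the position would stay below
  its conditional entropy given \<open>F\<close> by \<open>e\<close>. But along a further subsequence the posterior of the first step
  converges almost surely to its conditional probability given \<open>F\<close>, so Fatou's lemma gives a contradiction.
\<close>

lemma entropy_increment_le:
  assumes e: "0 < e"
  shows "\<forall>\<^sub>F n in sequentially. H (Suc n) - H n \<le> D 1 + e"
proof (rule ccontr)
  assume "\<not> ?thesis"
  then obtain r :: "nat \<Rightarrow> nat" where r: "strict_mono r" "\<And>n. \<not> H (Suc (r n)) - H (r n) \<le> D 1 + e"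
    using not_eventually_sequentiallyD by blast
  let ?w = "\<lambda>n x. posterior (x 1) (Suc n) (x (Suc n))"
  have wm: "?w n \<in> borel_measurable P" for n
    by (rule measurable_at_coord[of "\<lambda>g x. posterior g (Suc n) (x (Suc n))"]) (rule measurable_posterior)
  have small: "(\<integral>x. - ln (?w (r n) x) \<partial>P) \<le> (\<integral>x. cond_info 1 x \<partial>P) - e" for n
    using r(2)[of n] unfolding integral_posterior(2) by (simp add: D_def)
  have w01: "0 \<le> ?w n x" "?w n x \<le> 1" for n x by (auto intro!: posterior_le_1)
  have \<phi>i: "integrable P (\<phi> 1)"
    by (rule P.integrable_const_bound[where B = 1])
      (use \<phi>_le_1[of 1] \<phi>_pos[of 1] in \<open>auto elim!: eventually_elim2\<close>)
  have wi: "integrable P (?w n)" for n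
    by (rule P.integrable_const_bound[where B = 1]) (use w01 wm in auto)
  have di: "integrable P (\<lambda>x. ?w (r n) x - \<phi> 1 x)" for n
    by (intro Bochner_Integration.integrable_diff wi \<phi>i)
  have "(\<lambda>n. \<integral>x. norm (?w (r n) x - \<phi> 1 x) \<partial>P) \<longlonglongrightarrow> 0"
  proof -
    have "(\<lambda>n. \<integral>\<^sup>+x. ennreal \<bar>?w (r n) x - \<phi> 1 x\<bar> \<partial>P) \<longlonglongrightarrow> 0"
      using LIMSEQ_subseq_LIMSEQ[OF first_step_posterior_tendsto r(1)] by (simp add: comp_def)
    moreover have "(\<integral>\<^sup>+x. ennreal \<bar>?w (r n) x - \<phi> 1 x\<bar> \<partial>P) = ennreal (\<integral>x. norm (?w (r n) x - \<phi> 1 x) \<partial>P)" for n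
      using di[of n] by (subst nn_integral_eq_integral) auto
    ultimately have "(\<lambda>n. ennreal (\<integral>x. norm (?w (r n) x - \<phi> 1 x) \<partial>P)) \<longlonglongrightarrow> ennreal 0" by simp
    then show ?thesis by (subst (asm) tendsto_ennreal_iff) auto
  qed
  then obtain q where q: "strict_mono q" "AE x in P. (\<lambda>n. ?w (r (q n)) x - \<phi> 1 x) \<longlonglongrightarrow> 0"
    using tendsto_L1_AE_subseq[of P "\<lambda>n x. ?w (r n) x - \<phi> 1 x", OF di] by blast
  have lim: "AE x in P. (\<lambda>n. ennreal (- ln (?w (r (q n)) x))) \<longlonglongrightarrow> ennreal (cond_info 1 x)"
    using q(2) \<phi>_pos[of 1]
  proof eventually_elim
    case (elim x)
    have "(\<lambda>n. ?w (r (q n)) x) \<longlonglongrightarrow> \<phi> 1 x" using elim(1) by (rule LIM_zero_cancel)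
    then show ?case unfolding cond_info_def using elim(2) by (intro tendsto_ennrealI tendsto_intros) auto
  qed
  have nn: "0 \<le> - ln (?w n x)" for n x
    using w01(1)[of x n] w01(2)[of x n] by (cases "?w n x = 0") (auto simp: ln_le_zero_iff less_le)
  have le: "(\<integral>\<^sup>+x. ennreal (- ln (?w (r (q n)) x)) \<partial>P) \<le> ennreal ((\<integral>x. cond_info 1 x \<partial>P) - e)" for n
    using nn_integral_eq_integral[OF integral_posterior(1)[of "r (q n)"]] nn small[of "q n"] by (simp add: ennreal_leI)
  have "ennreal (\<integral>x. cond_info 1 x \<partial>P) = (\<integral>\<^sup>+x. ennreal (cond_info 1 x) \<partial>P)"
    by (rule nn_integral_eq_integral[OF integrable_cond_info cond_info_nonneg, symmetric])
  also have "\<dots> = (\<integral>\<^sup>+x. liminf (\<lambda>n. ennreal (- ln (?w (r (q n)) x))) \<partial>P)"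
    by (rule nn_integral_cong_AE) (use lim in \<open>eventually_elim, simp add: lim_imp_Liminf\<close>)
  also have "\<dots> \<le> liminf (\<lambda>n. \<integral>\<^sup>+x. ennreal (- ln (?w (r (q n)) x)) \<partial>P)"
    by (rule nn_integral_liminf) (use wm in measurable)
  also have "\<dots> \<le> liminf (\<lambda>n::nat. ennreal ((\<integral>x. cond_info 1 x \<partial>P) - e))"
    by (rule Liminf_mono) (use le in auto)
  also have "\<dots> = ennreal ((\<integral>x. cond_info 1 x \<partial>P) - e)" by (simp add: Liminf_const)
  finally have "(\<integral>x. cond_info 1 x \<partial>P) \<le> max 0 ((\<integral>x. cond_info 1 x \<partial>P) - e)"
    using e by (auto simp add: ennreal_le_iff2 max_def split: if_splits)
  moreover have "0 \<le> (\<integral>x. cond_info 1 x \<partial>P)" by (rule integral_nonneg_AE[OF cond_info_nonneg])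
  moreover have "0 \<le> (\<integral>x. - ln (?w (r 0) x) \<partial>P)" by (rule integral_nonneg_AE) (use nn in simp)
  ultimately show False using e small[of 0] by (auto simp: max_def split: if_splits)
qed

text \<open>
  Summing the increments bounds \<open>H n\<close> by \<open>n * (D 1 + e / 2)\<close> up to a constant, while the mean of
  \<open>cond_info n\<close> is \<open>H n - n * D 1\<close>.
\<close>

theorem maximal_imp_zero_rate: "(\<lambda>n. (\<integral>x. cond_info n x \<partial>P) / real n) \<longlonglongrightarrow> 0"
proof (rule LIMSEQ_I)
  fix e :: real assume e: "0 < e"
  obtain N where N: "\<And>n. n \<ge> N \<Longrightarrow> H (Suc n) - H n \<le> D 1 + e / 2"
    using entropy_increment_le[of "e / 2"] e by (auto simp: eventually_sequentially)
  have grow: "H (N + j) \<le> H N + real j * (D 1 + e / 2)" for j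
  proof (induction j)
    case (Suc j)
    have "real (Suc j) * (D 1 + e / 2) = real j * (D 1 + e / 2) + (D 1 + e / 2)" by (simp add: distrib_right)
    then show ?case using Suc N[of "N + j"] by simp
  qed simp
  define C where "C = \<bar>H N\<bar> + real N * \<bar>D 1\<bar>"
  obtain M :: nat where M: "2 * C / e < real M" using reals_Archimedean2 by blast
  have "(\<integral>x. cond_info n x \<partial>P) / real n < e" if n: "n \<ge> max N (Suc M)" for n
  proof -
    define j where "j = n - N"
    have nj: "n = N + j" using n by (simp add: j_def)
    have "(\<integral>x. cond_info n x \<partial>P) = H n - real n * D 1" using D_eq[of n] by (simp add: D_def)
    also have "\<dots> \<le> H N + real j * (e / 2) - real N * D 1" using grow[of j] by (simp add: nj algebra_simps)
    also have "\<dots> \<le> C + real n * (e / 2)"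
    proof -
      have "real j * (e / 2) \<le> real n * (e / 2)" using e by (intro mult_right_mono) (auto simp: nj)
      moreover have "- (real N * D 1) \<le> real N * \<bar>D 1\<bar>" by (metis abs_ge_minus_self abs_mult abs_of_nat)
      ultimately show ?thesis by (simp add: C_def)
    qed
    finally have 1: "(\<integral>x. cond_info n x \<partial>P) \<le> C + real n * (e / 2)" .
    have "2 * C / e < real n" using M n by linarith
    then have "C < real n * (e / 2)" using e by (simp add: field_simps)
    with 1 have "(\<integral>x. cond_info n x \<partial>P) < real n * e" by linarith
    then show ?thesis using n by (simp add: field_simps)
  qed
  moreover have "0 \<le> (\<integral>x. cond_info n x \<partial>P)" for n by (rule integral_nonneg_AE[OF cond_info_nonneg])
  ultimately show "\<exists>N. \<forall>n\<ge>N. norm ((\<integral>x. cond_info n x \<partial>P) / real n - 0) < e"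
    by (intro exI[of _ "max N (Suc M)"]) simp
qed

end

section \<open>The sigma-algebra of the Poisson boundary\<close>

text \<open>
  The sets that agree almost everywhere with a preimage under \<open>q\<close>. Working modulo null sets allows \<open>q\<close> to be
  measurable only for the completion of \<open>M\<close>.
\<close>

definition pullback_algebra :: "'a measure \<Rightarrow> 'b measure \<Rightarrow> ('a \<Rightarrow> 'b) \<Rightarrow> 'a measure" where
  "pullback_algebra M N q = sigma (space M) {A \<in> sets M. \<exists>D\<in>sets N. AE x in M. x \<in> A \<longleftrightarrow> q x \<in> D}"

lemma space_pullback_algebra [simp]: "space (pullback_algebra M N q) = space M"
  by (simp add: pullback_algebra_def space_measure_of_conv)

lemma sets_pullback_algebra:
  assumes q: "\<And>x. x \<in> space M \<Longrightarrow> q x \<in> space N"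
  shows "sets (pullback_algebra M N q) = {A \<in> sets M. \<exists>D\<in>sets N. AE x in M. x \<in> A \<longleftrightarrow> q x \<in> D}"
proof -
  let ?S = "{A \<in> sets M. \<exists>D\<in>sets N. AE x in M. x \<in> A \<longleftrightarrow> q x \<in> D}"
  have "sigma_algebra (space M) ?S"
    unfolding sigma_algebra_iff2
  proof (intro conjI ballI allI impI)
    show "?S \<subseteq> Pow (space M)" using sets.sets_into_space by auto
    show "{} \<in> ?S" by (auto intro!: bexI[of _ "{}"])
    fix A assume "A \<in> ?S"
    then obtain D where D: "A \<in> sets M" "D \<in> sets N" "AE x in M. x \<in> A \<longleftrightarrow> q x \<in> D" by auto
    have ae: "AE x in M. x \<in> space M - A \<longleftrightarrow> q x \<in> space N - D"
      using D(3) AE_space by eventually_elim (use q in auto)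
    show "space M - A \<in> ?S"
      using ae sets.compl_sets[OF D(1)] sets.compl_sets[OF D(2)] by blast
  next
    fix A :: "nat \<Rightarrow> 'a set" assume "range A \<subseteq> ?S"
    then have A: "A i \<in> ?S" for i by auto
    have "\<exists>D. \<forall>i. D i \<in> sets N \<and> (AE x in M. x \<in> A i \<longleftrightarrow> q x \<in> D i)"
      by (rule choice) (use A in blast)
    then obtain D where D: "\<And>i. D i \<in> sets N" "\<And>i. AE x in M. x \<in> A i \<longleftrightarrow> q x \<in> D i" by blast
    have "AE x in M. \<forall>i. x \<in> A i \<longleftrightarrow> q x \<in> D i" unfolding AE_all_countable using D(2) by blast
    then have "AE x in M. x \<in> (\<Union>i. A i) \<longleftrightarrow> q x \<in> (\<Union>i. D i)" by eventually_elim auto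
    then show "(\<Union>i. A i) \<in> ?S" using A D(1) by (auto intro!: bexI[of _ "\<Union>i. D i"])
  qed
  then show ?thesis unfolding pullback_algebra_def by (rule sigma_algebra.sets_measure_of_eq)
qed

lemma subalgebra_pullback:
  "(\<And>x. x \<in> space M \<Longrightarrow> q x \<in> space N) \<Longrightarrow> subalgebra M (pullback_algebra M N q)"
  by (auto simp: subalgebra_def sets_pullback_algebra)

lemma partition_proj_eq:
  assumes "partition_on X \<xi>" "C \<in> \<xi>" "\<gamma> \<in> C"
  shows "partition_proj \<xi> \<gamma> = C"
  unfolding partition_proj_def
proof (rule the_equality)
  show "C \<in> \<xi> \<and> \<gamma> \<in> C" using assms by simp
  fix C' assume "C' \<in> \<xi> \<and> \<gamma> \<in> C'"
  then show "C' = C" using partition_onD2[OF assms(1)] assms(2,3) by (auto simp: disjoint_def)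
qed

lemma partition_proj_in:
  assumes "partition_on X \<xi>" "\<gamma> \<in> X"
  shows "partition_proj \<xi> \<gamma> \<in> \<xi>" "\<gamma> \<in> partition_proj \<xi> \<gamma>"
proof -
  obtain C where "C \<in> \<xi>" "\<gamma> \<in> C" using partition_onD1[OF assms(1)] assms(2) by auto
  then show "partition_proj \<xi> \<gamma> \<in> \<xi>" "\<gamma> \<in> partition_proj \<xi> \<gamma>" using partition_proj_eq[OF assms(1)] by auto
qed

lemma partition_proj_mem_iff:
  assumes "partition_on X \<xi>" "\<gamma> \<in> X" "D \<subseteq> \<xi>"
  shows "partition_proj \<xi> \<gamma> \<in> D \<longleftrightarrow> \<gamma> \<in> \<Union>D"
proof
  assume "\<gamma> \<in> \<Union>D"
  then obtain C where "C \<in> D" "\<gamma> \<in> C" by auto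
  then show "partition_proj \<xi> \<gamma> \<in> D" using partition_proj_eq[OF assms(1), of C \<gamma>] assms(3) by auto
qed (use partition_proj_in(2)[OF assms(1,2)] in auto)

lemma quotient_sigma_algebra:
  assumes part: "partition_on (space M) \<xi>"
  shows "sigma_algebra \<xi> {D. D \<subseteq> \<xi> \<and> \<Union>D \<in> sets M}"
  unfolding sigma_algebra_iff2
proof (intro conjI ballI allI impI)
  fix D assume "D \<in> {D. D \<subseteq> \<xi> \<and> \<Union>D \<in> sets M}"
  then have D: "D \<subseteq> \<xi>" "\<Union>D \<in> sets M" by auto
  have "\<Union>(\<xi> - D) = space M - \<Union>D"
    using partition_proj_mem_iff[OF part _ D(1)] partition_proj_mem_iff[OF part, of _ "\<xi> - D"]
      partition_proj_in[OF part] partition_onD1[OF part] by blast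
  then show "\<xi> - D \<in> {D. D \<subseteq> \<xi> \<and> \<Union>D \<in> sets M}" using D by auto
next
  fix A :: "nat \<Rightarrow> 'a set set" assume A: "range A \<subseteq> {D. D \<subseteq> \<xi> \<and> \<Union>D \<in> sets M}"
  have "\<Union>(\<Union>i. A i) = (\<Union>i. \<Union>(A i))" by auto
  also have "\<dots> \<in> sets M" using A by (intro sets.countable_UN) auto
  finally show "(\<Union>i. A i) \<in> {D. D \<subseteq> \<xi> \<and> \<Union>D \<in> sets M}" using A by auto
qed auto

lemma
  assumes part: "partition_on (space M) \<xi>"
  shows sets_quotient_measure: "sets (quotient_measure M \<xi>) = {D. D \<subseteq> \<xi> \<and> \<Union>D \<in> sets M}"
    and space_quotient_measure: "space (quotient_measure M \<xi>) = \<xi>"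
    and measurable_partition_proj: "partition_proj \<xi> \<in> M \<rightarrow>\<^sub>M quotient_measure M \<xi>"
    and distr_partition_proj: "distr M (quotient_measure M \<xi>) (partition_proj \<xi>) = quotient_measure M \<xi>"
    and emeasure_quotient_measure: "D \<in> sets (quotient_measure M \<xi>) \<Longrightarrow> emeasure (quotient_measure M \<xi>) D = emeasure M (\<Union>D)"
proof -
  note alg = quotient_sigma_algebra[OF part]
  let ?S = "sigma \<xi> {D. D \<subseteq> \<xi> \<and> \<Union>D \<in> sets M}"
  have s: "sets ?S = {D. D \<subseteq> \<xi> \<and> \<Union>D \<in> sets M}" by (rule sigma_algebra.sets_measure_of_eq[OF alg])
  have sp: "space ?S = \<xi>" by (simp add: space_measure_of_conv)
  have vim: "partition_proj \<xi> -` D \<inter> space M = \<Union>D" if "D \<subseteq> \<xi>" for D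
    using partition_proj_mem_iff[OF part _ that] partition_onD1[OF part] that by blast
  have m: "partition_proj \<xi> \<in> M \<rightarrow>\<^sub>M ?S"
  proof (rule measurableI)
    show "partition_proj \<xi> x \<in> space ?S" if "x \<in> space M" for x using partition_proj_in(1)[OF part that] by (simp add: sp)
    show "partition_proj \<xi> -` D \<inter> space M \<in> sets M" if "D \<in> sets ?S" for D using that vim by (auto simp: s)
  qed
  show 1: "sets (quotient_measure M \<xi>) = {D. D \<subseteq> \<xi> \<and> \<Union>D \<in> sets M}" by (simp add: quotient_measure_def s)
  show "space (quotient_measure M \<xi>) = \<xi>" by (simp add: quotient_measure_def sp)
  show "partition_proj \<xi> \<in> M \<rightarrow>\<^sub>M quotient_measure M \<xi>"
    using m by (simp add: quotient_measure_def)
  show "distr M (quotient_measure M \<xi>) (partition_proj \<xi>) = quotient_measure M \<xi>"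
    by (rule measure_eqI) (use m in \<open>auto simp: quotient_measure_def emeasure_distr\<close>)
  assume "D \<in> sets (quotient_measure M \<xi>)"
  then show "emeasure (quotient_measure M \<xi>) D = emeasure M (\<Union>D)"
    using m vim[of D] by (simp add: 1 quotient_measure_def emeasure_distr s)
qed

locale poisson_walk = finite_entropy_walk \<mu> for \<mu> :: "'a::{group_add,countable} pmf" +
  fixes \<Gamma> :: "'b measure" and bnd :: "(nat \<Rightarrow> 'a) \<Rightarrow> 'b" and act :: "'a \<Rightarrow> 'b \<Rightarrow> 'b"
  assumes poisson: "poisson_boundary \<mu> \<Gamma> bnd act"
begin

definition \<nu> :: "'b measure" where "\<nu> = harmonic_measure \<mu> \<Gamma> bnd"

lemma \<nu>_eq: "\<nu> = completion (distr (completion P) \<Gamma> bnd)"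
  by (simp add: \<nu>_def harmonic_measure_def boundary_measure_def walk_measure_def)

lemma space_\<nu> [simp]: "space \<nu> = space \<Gamma>"
  by (simp add: \<nu>_eq)

lemma sets_counting: "sets (counting_walk_measure \<mu>) = sets path_space"
  by (simp add: counting_walk_measure_def markov_measure_def)

lemma translate_completion:
  assumes "S \<in> sets (completion (counting_walk_measure \<mu>))"
  shows "{x. (\<lambda>n. g + x n) \<in> S} \<in> sets (completion P)"
proof -
  obtain S0 N N' where S: "S = S0 \<union> N" "N \<subseteq> N'" "N' \<in> null_sets (counting_walk_measure \<mu>)" "S0 \<in> sets (counting_walk_measure \<mu>)"
    using assms by (rule sets_completionE)
  have "S0 \<in> sets path_space" using S(4) by (simp add: sets_counting)
  then have "(\<lambda>x n. g + x n) -` S0 \<inter> space path_space \<in> sets path_space"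
    by (rule measurable_sets[OF measurable_translate])
  then have 1: "{x. (\<lambda>n. g + x n) \<in> S0} \<in> sets P" by (simp add: sets_P vimage_def)
  have "AE x in counting_walk_measure \<mu>. x \<notin> N" using AE_not_in[OF S(3)] by eventually_elim (use S(2) in auto)
  then have "AE x in P. \<not> (\<lambda>n. g + x n) \<in> N" by (rule AE_P_counting)
  then have "Measurable.pred (completion P) (\<lambda>x. (\<lambda>n. g + x n) \<in> N)" by (rule sets_completion_AE)
  then have 2: "{x. (\<lambda>n. g + x n) \<in> N} \<in> sets (completion P)" by (simp add: pred_def)
  have "{x. (\<lambda>n. g + x n) \<in> S} = {x. (\<lambda>n. g + x n) \<in> S0} \<union> {x. (\<lambda>n. g + x n) \<in> N}" by (auto simp: S(1))
  then show ?thesis using 1 2 by auto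
qed

lemma translate_0 [simp]: "(\<lambda>n. 0 + x n) = (x :: nat \<Rightarrow> 'a)" by simp

lemma bnd_measurable: "bnd \<in> completion P \<rightarrow>\<^sub>M \<Gamma>"
proof (rule measurableI)
  have m: "bnd \<in> completion (counting_walk_measure \<mu>) \<rightarrow>\<^sub>M \<Gamma>" using poisson by (simp add: poisson_boundary_def)
  have sp: "space (counting_walk_measure \<mu>) = UNIV" by (simp add: counting_walk_measure_def markov_measure_def)
  show "bnd x \<in> space \<Gamma>" for x using measurable_space[OF m, of x] by (simp add: sp)
  show "bnd -` D \<inter> space (completion P) \<in> sets (completion P)" if "D \<in> sets \<Gamma>" for D
    using translate_completion[OF measurable_sets[OF m that], of 0] by (simp add: sp vimage_def)
qed

lemma bnd_in_space [simp]: "bnd x \<in> space \<Gamma>"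
  using measurable_space[OF bnd_measurable, of x] by simp

lemma version:
  assumes "{x. R x} \<in> sets (completion P)"
  shows "\<exists>A\<in>sets P. AE x in P. x \<in> A \<longleftrightarrow> R x"
proof -
  obtain S N N' where S: "{x. R x} = S \<union> N" "N \<subseteq> N'" "N' \<in> null_sets P" "S \<in> sets P"
    using assms by (rule sets_completionE)
  have "AE x in P. x \<in> S \<longleftrightarrow> R x"
    using AE_not_in[OF S(3)] by eventually_elim (use S(1,2) in blast)
  then show ?thesis using S(4) by blast
qed

lemma act_measurable: "act g \<in> \<Gamma> \<rightarrow>\<^sub>M \<Gamma>"
  using poisson by (simp add: poisson_boundary_def)

lemma act_in_space [simp]: "\<gamma> \<in> space \<Gamma> \<Longrightarrow> act g \<gamma> \<in> space \<Gamma>"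
  using measurable_space[OF act_measurable] by auto

lemma act_inverse: "\<gamma> \<in> space \<Gamma> \<Longrightarrow> act (- g) (act g \<gamma>) = \<gamma>"
  using poisson unfolding poisson_boundary_def by (metis left_minus)

text \<open>
  Up to null sets, an event about the boundary point is shift-invariant. On \<open>{x. x a = g}\<close> the
  path shifted by \<open>a\<close> is the restarted path translated by \<open>g\<close>, and equivariance of the boundary map applies.
\<close>

lemma bnd_restart:
  assumes D: "D \<in> sets \<Gamma>"
  shows "AE x in P. bnd x \<in> D \<longleftrightarrow> act (x a) (bnd (restart a x)) \<in> D"
proof -
  obtain A where A: "A \<in> shift_invariant_sets \<mu>" "AE x in counting_walk_measure \<mu>. bnd x \<in> D \<longleftrightarrow> x \<in> A"
    using poisson D unfolding poisson_boundary_def by blast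
  have inv: "x \<in> A \<longleftrightarrow> (\<lambda>n. x (a + n)) \<in> A" for x :: "nat \<Rightarrow> 'a" and a
  proof (induction a)
    case (Suc a)
    have "(\<lambda>n. x (a + n)) \<in> A \<longleftrightarrow> time_shift (\<lambda>n. x (a + n)) \<in> A"
      using A(1) unfolding shift_invariant_sets_def by blast
    then show ?case using Suc by (simp add: time_shift_def)
  qed simp
  have 1: "AE x in P. bnd x \<in> D \<longleftrightarrow> x \<in> A" using AE_P_counting[OF A(2), of 0] by simp
  have 2: "AE x in P. act g (bnd x) \<in> D \<longleftrightarrow> (\<lambda>n. g + x n) \<in> A" for g
  proof -
    have "AE x in counting_walk_measure \<mu>. bnd (\<lambda>n. g + x n) = act g (bnd x)"
      using poisson by (simp add: poisson_boundary_def)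
    from AE_P_counting[OF this, of 0] have "AE x in P. bnd (\<lambda>n. g + x n) = act g (bnd x)" by simp
    then show ?thesis using AE_P_counting[OF A(2), of g] by eventually_elim simp
  qed
  show ?thesis
  proof (rule AE_at_coord[where R = "\<lambda>g x. bnd x \<in> D \<longleftrightarrow> act g (bnd (restart a x)) \<in> D"])
    fix g
    show "AE x in P. x a = g \<longrightarrow> (bnd x \<in> D \<longleftrightarrow> act g (bnd (restart a x)) \<in> D)"
      using 1 AE_restart[OF 2[of g], of a]
    proof eventually_elim
      case (elim x)
      show ?case
      proof
        assume "x a = g"
        then have "(\<lambda>n. g + restart a x n) = (\<lambda>n. x (a + n))" by (auto simp: restart_def add.assoc[symmetric])
        then show "bnd x \<in> D \<longleftrightarrow> act g (bnd (restart a x)) \<in> D" using elim inv[of x a] by simp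
      qed
    qed
  qed
qed

lemma version_bnd: "D \<in> sets \<Gamma> \<Longrightarrow> \<exists>A\<in>sets P. AE x in P. x \<in> A \<longleftrightarrow> bnd x \<in> D"
  using measurable_sets[OF bnd_measurable, of D] by (intro version) (simp add: vimage_def)

definition J where "J = pullback_algebra P \<Gamma> bnd"

lemma sets_J: "sets J = {A \<in> sets P. \<exists>D\<in>sets \<Gamma>. AE x in P. x \<in> A \<longleftrightarrow> bnd x \<in> D}"
  unfolding J_def by (rule sets_pullback_algebra) simp

sublocale J: maximal_conditioned_walk \<mu> J
proof
  show "subalgebra P J" unfolding J_def by (rule subalgebra_pullback) simp
next
  fix A a g assume "A \<in> sets J" "0 < p a g"
  then obtain D where D: "D \<in> sets \<Gamma>" "AE x in P. x \<in> A \<longleftrightarrow> bnd x \<in> D" by (auto simp: sets_J)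
  have D': "act g -` D \<inter> space \<Gamma> \<in> sets \<Gamma>" by (rule measurable_sets[OF act_measurable D(1)])
  obtain A' where A': "A' \<in> sets P" "AE x in P. x \<in> A' \<longleftrightarrow> bnd x \<in> act g -` D \<inter> space \<Gamma>" using version_bnd[OF D'] by blast
  have "AE x in P. x a = g \<longrightarrow> (x \<in> A \<longleftrightarrow> restart a x \<in> A')"
    using D(2) bnd_restart[OF D(1), of a] AE_restart[OF A'(2), of a] by eventually_elim auto
  moreover have "A' \<in> sets J" unfolding sets_J using A' D' by blast
  ultimately show "\<exists>A'\<in>sets J. AE x in P. x a = g \<longrightarrow> (x \<in> A \<longleftrightarrow> restart a x \<in> A')" by blast
next
  fix A' a g assume "A' \<in> sets J" "0 < p a g"
  then obtain D' where D': "D' \<in> sets \<Gamma>" "AE x in P. x \<in> A' \<longleftrightarrow> bnd x \<in> D'" by (auto simp: sets_J)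
  have D: "act (- g) -` D' \<inter> space \<Gamma> \<in> sets \<Gamma>" by (rule measurable_sets[OF act_measurable D'(1)])
  obtain A where A: "A \<in> sets P" "AE x in P. x \<in> A \<longleftrightarrow> bnd x \<in> act (- g) -` D' \<inter> space \<Gamma>" using version_bnd[OF D] by blast
  have "AE x in P. x a = g \<longrightarrow> (x \<in> A \<longleftrightarrow> restart a x \<in> A')"
    using A(2) bnd_restart[OF D, of a] AE_restart[OF D'(2), of a] by eventually_elim (auto simp: act_inverse)
  moreover have "A \<in> sets J" unfolding sets_J using A D by blast
  ultimately show "\<exists>A\<in>sets J. AE x in P. x a = g \<longrightarrow> (x \<in> A \<longleftrightarrow> restart a x \<in> A')" by blast
next
  fix A assume A: "A \<in> sets P" "time_shift -` A = A"
  then have "A \<in> shift_invariant_sets \<mu>" by (simp add: shift_invariant_sets_def sets_P sets_counting)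
  then obtain D where D: "D \<in> sets \<Gamma>" "AE x in counting_walk_measure \<mu>. bnd x \<in> D \<longleftrightarrow> x \<in> A"
    using poisson unfolding poisson_boundary_def by blast
  have "AE x in P. x \<in> A \<longleftrightarrow> bnd x \<in> D" using AE_P_counting[OF D(2), of 0] by eventually_elim simp
  then show "A \<in> sets J" using A D(1) by (auto simp: sets_J)
qed

lemma null_\<Gamma>_iff:
  assumes "N \<in> sets \<Gamma>"
  shows "N \<in> null_sets (distr (completion P) \<Gamma> bnd) \<longleftrightarrow> (AE x in P. bnd x \<notin> N)"
proof -
  have "N \<in> null_sets (distr (completion P) \<Gamma> bnd) \<longleftrightarrow> (AE \<gamma> in distr (completion P) \<Gamma> bnd. \<gamma> \<notin> N)"
    using assms by (subst AE_iff_null_sets) auto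
  also have "\<dots> \<longleftrightarrow> (AE x in completion P. bnd x \<notin> N)"
    using assms by (subst AE_distr_iff[OF bnd_measurable]) (auto simp: Collect_neg_eq Int_def intro!: sets.sets_Collect_neg)
  also have "\<dots> \<longleftrightarrow> (AE x in P. bnd x \<notin> N)" by (rule AE_completion_iff)
  finally show ?thesis .
qed

lemma sets_\<nu>E:
  assumes "E \<in> sets \<nu>"
  obtains D N where "D \<in> sets \<Gamma>" "N \<in> sets \<Gamma>" "AE x in P. bnd x \<notin> N" "\<And>\<gamma>. \<gamma> \<notin> N \<Longrightarrow> \<gamma> \<in> E \<longleftrightarrow> \<gamma> \<in> D"
proof -
  obtain S N N' where S: "E = S \<union> N" "N \<subseteq> N'" "N' \<in> null_sets (distr (completion P) \<Gamma> bnd)" "S \<in> sets (distr (completion P) \<Gamma> bnd)"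
    using assms unfolding \<nu>_eq by (rule sets_completionE)
  have N': "N' \<in> sets \<Gamma>" using S(3) by (metis null_setsD2 sets_distr)
  show ?thesis
    by (rule that[of S N']) (use S N' null_\<Gamma>_iff[OF N'] in auto)
qed

lemma sets_\<nu>I:
  assumes "E \<subseteq> space \<Gamma>" "D \<in> sets \<Gamma>" "N \<in> sets \<Gamma>" "AE x in P. bnd x \<notin> N" "\<And>\<gamma>. \<gamma> \<notin> N \<Longrightarrow> \<gamma> \<in> E \<longleftrightarrow> \<gamma> \<in> D"
  shows "E \<in> sets \<nu>"
  unfolding \<nu>_eq
proof (rule sets_completionI[of E "D - N" "E \<inter> N" N])
  show "N \<in> null_sets (distr (completion P) \<Gamma> bnd)" using assms(3,4) by (simp add: null_\<Gamma>_iff)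
qed (use assms in auto)

lemma sets_\<Gamma>_\<nu>: "D \<in> sets \<Gamma> \<Longrightarrow> D \<in> sets \<nu>"
  by (simp add: \<nu>_eq)

lemma null_\<nu>I:
  assumes E: "E \<in> sets \<nu>" and ae: "AE x in P. bnd x \<notin> E"
  shows "E \<in> null_sets \<nu>"
proof -
  obtain D N where D: "D \<in> sets \<Gamma>" "N \<in> sets \<Gamma>" "AE x in P. bnd x \<notin> N" "\<And>\<gamma>. \<gamma> \<notin> N \<Longrightarrow> \<gamma> \<in> E \<longleftrightarrow> \<gamma> \<in> D"
    using E by (rule sets_\<nu>E) blast
  have "AE x in P. bnd x \<notin> D \<union> N" using ae D(3) by eventually_elim (use D(4) in auto)
  then have "D \<union> N \<in> null_sets (distr (completion P) \<Gamma> bnd)" using D(1,2) by (simp add: null_\<Gamma>_iff)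
  then show ?thesis unfolding \<nu>_eq null_sets_completion_iff2 using D(4) by blast
qed

lemma AE_\<nu>_bnd:
  assumes "AE \<gamma> in \<nu>. R \<gamma>"
  shows "AE x in P. R (bnd x)"
proof -
  have "AE \<gamma> in distr (completion P) \<Gamma> bnd. R \<gamma>" using assms unfolding \<nu>_eq by (simp add: AE_completion_iff)
  then have "AE x in completion P. R (bnd x)" by (rule AE_distrD[OF bnd_measurable])
  then show ?thesis by (simp add: AE_completion_iff)
qed

lemma version_\<nu>:
  assumes "E \<in> sets \<nu>"
  shows "\<exists>D\<in>sets \<Gamma>. \<exists>A\<in>sets P. (AE x in P. x \<in> A \<longleftrightarrow> bnd x \<in> E) \<and> (AE x in P. x \<in> A \<longleftrightarrow> bnd x \<in> D)"
proof -
  obtain D N where D: "D \<in> sets \<Gamma>" "N \<in> sets \<Gamma>" "AE x in P. bnd x \<notin> N" "\<And>\<gamma>. \<gamma> \<notin> N \<Longrightarrow> \<gamma> \<in> E \<longleftrightarrow> \<gamma> \<in> D"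
    using assms by (rule sets_\<nu>E) blast
  obtain A where A: "A \<in> sets P" "AE x in P. x \<in> A \<longleftrightarrow> bnd x \<in> D" using version_bnd[OF D(1)] by blast
  have "AE x in P. x \<in> A \<longleftrightarrow> bnd x \<in> E" using A(2) D(3) by eventually_elim (use D(4) in auto)
  then show ?thesis using A D(1) by blast
qed

lemma bnd_restart_\<nu>:
  assumes E: "E \<in> sets \<nu>"
  shows "AE x in P. bnd x \<in> E \<longleftrightarrow> act (x a) (bnd (restart a x)) \<in> E"
proof -
  obtain D N where D: "D \<in> sets \<Gamma>" "N \<in> sets \<Gamma>" "AE x in P. bnd x \<notin> N" "\<And>\<gamma>. \<gamma> \<notin> N \<Longrightarrow> \<gamma> \<in> E \<longleftrightarrow> \<gamma> \<in> D"
    using E by (rule sets_\<nu>E) blast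
  show ?thesis using bnd_restart[OF D(1), of a] bnd_restart[OF D(2), of a] D(3)
    by eventually_elim (use D(4) in auto)
qed

text \<open>
  The translate of the harmonic measure by a site that the walk can reach is absolutely continuous with respect to the
  harmonic measure, so preimages of null sets are null sets. This may fail for other group elements.
\<close>

lemma act_vimage_\<nu>:
  assumes E: "E \<in> sets \<nu>" and pos: "0 < p a g"
  shows "act g -` E \<inter> space \<Gamma> \<in> sets \<nu>"
proof -
  obtain D N where D: "D \<in> sets \<Gamma>" "N \<in> sets \<Gamma>" "AE x in P. bnd x \<notin> N" "\<And>\<gamma>. \<gamma> \<notin> N \<Longrightarrow> \<gamma> \<in> E \<longleftrightarrow> \<gamma> \<in> D"
    using E by (rule sets_\<nu>E) blast
  let ?N = "act g -` N \<inter> space \<Gamma>"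
  have N': "?N \<in> sets \<Gamma>" by (rule measurable_sets[OF act_measurable D(2)])
  obtain B where B: "B \<in> sets P" "AE x in P. x \<in> B \<longleftrightarrow> bnd x \<in> ?N" using version_bnd[OF N'] by blast
  have vB: "restart a -` B \<in> sets P" using measurable_sets[OF measurable_restart_P B(1), of a] by simp
  have "AE x in P. x \<notin> cylinder a g \<inter> restart a -` B"
    using AE_restart[OF B(2), of a] bnd_restart[OF D(2), of a] D(3)
    by eventually_elim (auto simp: cylinder_def)
  then have "emeasure P (cylinder a g \<inter> restart a -` B) = 0"
    using vB AE_iff_null_sets[of "cylinder a g \<inter> restart a -` B" P] cylinder_sets by auto
  then have "ennreal (p a g) * emeasure P B = 0"
    using emeasure_restart[OF cylinder_sets determined_by_past_cylinder[OF order_refl] B(1), of a g]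
    by (simp add: emeasure_cylinder)
  then have "B \<in> null_sets P" using pos B(1) by auto
  then have "AE x in P. x \<notin> B" by (rule AE_not_in)
  then have ae: "AE x in P. bnd x \<notin> ?N" using B(2) by eventually_elim simp
  show ?thesis
    by (rule sets_\<nu>I[OF _ measurable_sets[OF act_measurable D(1), of g] N' ae]) (use D(4) in auto)
qed

end

section \<open>Boundary quotients and conditional measures\<close>

locale boundary_quotient = poisson_walk +
  fixes \<xi> :: "'b set set" and \<kappa> :: "'b set \<Rightarrow> (nat \<Rightarrow> 'a::{group_add,countable}) measure"
  assumes partition: "partition_on (space \<nu>) \<xi>"
    and invariant: "invariant_partition act \<xi>"
    and cond_meas: "conditional_measures P (quotient_measure \<nu> \<xi>) (partition_proj \<xi> \<circ> bnd) \<kappa>"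
begin

abbreviation "Q \<equiv> quotient_measure \<nu> \<xi>"

definition q :: "(nat \<Rightarrow> 'a) \<Rightarrow> 'b set" where "q x = partition_proj \<xi> (bnd x)"

lemmas sets_Q = sets_quotient_measure[OF partition]
  and space_Q = space_quotient_measure[OF partition]
  and emeasure_Q = emeasure_quotient_measure[OF partition]

lemma q_in [simp]: "q x \<in> \<xi>"
  unfolding q_def by (rule partition_proj_in(1)[OF partition]) simp

lemma q_mem_iff: "D \<subseteq> \<xi> \<Longrightarrow> q x \<in> D \<longleftrightarrow> bnd x \<in> \<Union>D"
  unfolding q_def by (rule partition_proj_mem_iff[OF partition]) simp_all

lemma \<kappa>_prob: "C \<in> \<xi> \<Longrightarrow> prob_space (\<kappa> C)" and \<kappa>_sets: "C \<in> \<xi> \<Longrightarrow> sets (\<kappa> C) = sets P"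
  using cond_meas by (auto simp: conditional_measures_def space_Q)

lemma \<kappa>_measurable: "A \<in> sets P \<Longrightarrow> (\<lambda>C. emeasure (\<kappa> C) A) \<in> borel_measurable Q"
  and \<kappa>_integral: "A \<in> sets P \<Longrightarrow> emeasure P A = (\<integral>\<^sup>+C. emeasure (\<kappa> C) A \<partial>Q)"
  using cond_meas by (auto simp: conditional_measures_def)

lemma \<kappa>_fibre: "AE C in Q. AE x in \<kappa> C. q x = C"
  using cond_meas by (simp add: conditional_measures_def q_def)

lemma AE_Q_P: "AE C in Q. R C \<Longrightarrow> AE x in P. R (q x)"
proof -
  assume "AE C in Q. R C"
  then have "AE C in distr \<nu> Q (partition_proj \<xi>). R C" by (simp only: distr_partition_proj[OF partition])
  then have "AE \<gamma> in \<nu>. R (partition_proj \<xi> \<gamma>)" by (rule AE_distrD[OF measurable_partition_proj[OF partition]])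
  then show "AE x in P. R (q x)" unfolding q_def by (rule AE_\<nu>_bnd)
qed

lemma AE_P_\<kappa>:
  assumes "AE x in P. R x"
  shows "AE C in Q. AE x in \<kappa> C. R x"
proof -
  obtain N where N: "{x \<in> space P. \<not> R x} \<subseteq> N" "emeasure P N = 0" "N \<in> sets P" using assms by (rule AE_E)
  have "(\<integral>\<^sup>+C. emeasure (\<kappa> C) N \<partial>Q) = 0" using N by (simp add: \<kappa>_integral[symmetric])
  then have "AE C in Q. emeasure (\<kappa> C) N = 0"
    by (rule nn_integral_0_iff_AE[THEN iffD1, rotated]) (rule \<kappa>_measurable[OF N(3)])
  then show ?thesis using AE_space
  proof eventually_elim
    case (elim C)
    have "N \<in> null_sets (\<kappa> C)" using elim N(3) \<kappa>_sets[of C] by (auto simp: space_Q)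
    then have "AE x in \<kappa> C. x \<notin> N" by (rule AE_not_in)
    then show ?case by eventually_elim (use N(1) in auto)
  qed
qed

lemma AE_Q_I:
  assumes D: "{C \<in> \<xi>. R C} \<in> sets Q" and ae: "AE x in P. R (q x)"
  shows "AE C in Q. R C"
proof -
  have D': "\<xi> - {C \<in> \<xi>. R C} \<in> sets Q" using sets.compl_sets[OF D] by (simp add: space_Q)
  have "\<Union>(\<xi> - {C \<in> \<xi>. R C}) \<in> null_sets \<nu>"
  proof (rule null_\<nu>I)
    show "\<Union>(\<xi> - {C \<in> \<xi>. R C}) \<in> sets \<nu>" using D' by (simp add: sets_Q)
    have "q x \<in> \<xi> - {C \<in> \<xi>. R C} \<longleftrightarrow> bnd x \<in> \<Union>(\<xi> - {C \<in> \<xi>. R C})" for x by (rule q_mem_iff) auto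
    with ae show "AE x in P. bnd x \<notin> \<Union>(\<xi> - {C \<in> \<xi>. R C})" by (auto elim!: eventually_mono)
  qed
  then have "\<xi> - {C \<in> \<xi>. R C} \<in> null_sets Q"
    by (intro null_setsI D') (simp only: emeasure_Q[OF D'] null_setsD1)
  then have "AE C in Q. C \<notin> \<xi> - {C \<in> \<xi>. R C}" by (rule AE_not_in)
  then show ?thesis using AE_space by eventually_elim (auto simp: space_Q)
qed

lemma nn_integral_Q:
  assumes u: "u \<in> borel_measurable Q"
  shows "(\<integral>\<^sup>+C. u C \<partial>Q) = (\<integral>\<^sup>+x. u (q x) \<partial>P)"
proof -
  let ?d = "distr (completion P) \<Gamma> bnd"
  have m: "(\<lambda>\<gamma>. u (partition_proj \<xi> \<gamma>)) \<in> borel_measurable \<nu>"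
    by (rule measurable_compose[OF measurable_partition_proj[OF partition] u])
  obtain v where v: "v \<in> borel_measurable ?d" "AE \<gamma> in ?d. u (partition_proj \<xi> \<gamma>) = v \<gamma>"
    using completion_ex_borel_measurable m unfolding \<nu>_eq by blast
  have v\<Gamma>: "v \<in> borel_measurable \<Gamma>" using v(1) by simp
  have "(\<integral>\<^sup>+C. u C \<partial>Q) = (\<integral>\<^sup>+C. u C \<partial>distr \<nu> Q (partition_proj \<xi>))"
    by (simp only: distr_partition_proj[OF partition])
  also have "\<dots> = (\<integral>\<^sup>+\<gamma>. u (partition_proj \<xi> \<gamma>) \<partial>\<nu>)"
    by (rule nn_integral_distr[OF measurable_partition_proj[OF partition]]) (simp add: u)
  also have "\<dots> = (\<integral>\<^sup>+\<gamma>. u (partition_proj \<xi> \<gamma>) \<partial>?d)" by (simp add: \<nu>_eq nn_integral_completion)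
  also have "\<dots> = (\<integral>\<^sup>+\<gamma>. v \<gamma> \<partial>?d)" by (rule nn_integral_cong_AE[OF v(2)])
  also have "\<dots> = (\<integral>\<^sup>+x. v (bnd x) \<partial>completion P)" by (rule nn_integral_distr[OF bnd_measurable]) (simp add: v\<Gamma>)
  also have "\<dots> = (\<integral>\<^sup>+x. u (q x) \<partial>completion P)"
    by (rule nn_integral_cong_AE) (use AE_distrD[OF bnd_measurable v(2)] in \<open>eventually_elim, simp add: q_def\<close>)
  finally show ?thesis by (simp add: nn_integral_completion)
qed

definition F where "F = pullback_algebra P Q q"

lemma sets_F: "sets F = {A \<in> sets P. \<exists>D\<in>sets Q. AE x in P. x \<in> A \<longleftrightarrow> q x \<in> D}"
  unfolding F_def by (rule sets_pullback_algebra) (simp add: space_Q)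

lemma version_Q:
  assumes "D \<in> sets Q"
  shows "\<exists>A\<in>sets F. AE x in P. x \<in> A \<longleftrightarrow> q x \<in> D"
proof -
  have D: "D \<subseteq> \<xi>" "\<Union>D \<in> sets \<nu>" using assms by (auto simp: sets_Q)
  obtain A where A: "A \<in> sets P" "AE x in P. x \<in> A \<longleftrightarrow> bnd x \<in> \<Union>D" using version_\<nu>[OF D(2)] by blast
  have "AE x in P. x \<in> A \<longleftrightarrow> q x \<in> D" using A(2) by (simp add: q_mem_iff[OF D(1)])
  then show ?thesis using A(1) assms unfolding sets_F by blast
qed

lemma sets_F_J: "sets F \<subseteq> sets J"
proof
  fix A assume "A \<in> sets F"
  then obtain D where D: "A \<in> sets P" "D \<in> sets Q" "AE x in P. x \<in> A \<longleftrightarrow> q x \<in> D" by (auto simp: sets_F)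
  have D': "D \<subseteq> \<xi>" "\<Union>D \<in> sets \<nu>" using D(2) by (auto simp: sets_Q)
  obtain E B where E: "E \<in> sets \<Gamma>" "AE x in P. x \<in> B \<longleftrightarrow> bnd x \<in> \<Union>D" "AE x in P. x \<in> B \<longleftrightarrow> bnd x \<in> E"
    using version_\<nu>[OF D'(2)] by blast
  have "AE x in P. x \<in> A \<longleftrightarrow> bnd x \<in> E"
    using D(3) E(2,3) by eventually_elim (use q_mem_iff[OF D'(1)] in auto)
  then show "A \<in> sets J" using D(1) E(1) unfolding sets_J by blast
qed

definition translate_classes :: "'a \<Rightarrow> 'b set set \<Rightarrow> 'b set set" where
  "translate_classes g D = {C \<in> \<xi>. act g ` C \<in> D}"

lemma Union_translate_classes:
  assumes D: "D \<subseteq> \<xi>"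
  shows "\<Union>(translate_classes g D) = act g -` \<Union>D \<inter> space \<Gamma>"
proof (intro equalityI subsetI)
  fix \<gamma> assume "\<gamma> \<in> \<Union>(translate_classes g D)"
  then show "\<gamma> \<in> act g -` \<Union>D \<inter> space \<Gamma>"
    using partition_onD1[OF partition] by (auto simp: translate_classes_def)
next
  fix \<gamma> assume \<gamma>: "\<gamma> \<in> act g -` \<Union>D \<inter> space \<Gamma>"
  then have sp: "\<gamma> \<in> space \<nu>" by simp
  let ?C = "partition_proj \<xi> \<gamma>"
  have C: "?C \<in> \<xi>" "\<gamma> \<in> ?C" using partition_proj_in[OF partition sp] by auto
  have gC: "act g ` ?C \<in> \<xi>" using invariant C(1) by (simp add: invariant_partition_def)
  obtain C' where C': "C' \<in> D" "act g \<gamma> \<in> C'" using \<gamma> by auto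
  have "partition_proj \<xi> (act g \<gamma>) = C'" by (rule partition_proj_eq[OF partition]) (use C' D in auto)
  moreover have "partition_proj \<xi> (act g \<gamma>) = act g ` ?C" by (rule partition_proj_eq[OF partition gC]) (use C in auto)
  ultimately show "\<gamma> \<in> \<Union>(translate_classes g D)" using C C' by (auto simp: translate_classes_def)
qed

lemma q_translate_iff:
  assumes D: "D \<subseteq> \<xi>"
  shows "q x \<in> translate_classes g D \<longleftrightarrow> act g (bnd x) \<in> \<Union>D"
proof -
  have "translate_classes g D \<subseteq> \<xi>" by (auto simp: translate_classes_def)
  then show ?thesis using Union_translate_classes[OF D, of g] by (simp only: q_mem_iff) simp
qed

text \<open>
  The classes that \<open>g\<close> maps into \<open>D\<close> describe the restarted path.
\<close>

lemma F_trace_restart: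
  assumes A: "A \<in> sets F" and pos: "0 < p a g"
  shows "\<exists>A'\<in>sets F. AE x in P. x a = g \<longrightarrow> (x \<in> A \<longleftrightarrow> restart a x \<in> A')"
proof -
  obtain D where D: "D \<in> sets Q" "AE x in P. x \<in> A \<longleftrightarrow> q x \<in> D" using A by (auto simp: sets_F)
  have D': "D \<subseteq> \<xi>" "\<Union>D \<in> sets \<nu>" using D(1) by (auto simp: sets_Q)
  have "translate_classes g D \<in> sets Q"
    using act_vimage_\<nu>[OF D'(2) pos] Union_translate_classes[OF D'(1), of g] by (auto simp: sets_Q translate_classes_def)
  then obtain A' where A': "A' \<in> sets F" "AE x in P. x \<in> A' \<longleftrightarrow> q x \<in> translate_classes g D" using version_Q by blast
  have "AE x in P. x a = g \<longrightarrow> (x \<in> A \<longleftrightarrow> restart a x \<in> A')"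
    using D(2) AE_restart[OF A'(2), of a] bnd_restart_\<nu>[OF D'(2), of a]
    by eventually_elim (use q_mem_iff[OF D'(1)] q_translate_iff[OF D'(1), of _ g] in auto)
  then show ?thesis using A'(1) by blast
qed

text \<open>
  The fibres on which the conditional probability of \<open>B\<close> vanishes contain almost no point of \<open>B\<close>.
\<close>

lemma \<kappa>_pos:
  assumes B: "B \<in> sets P"
  shows "AE x in P. x \<in> B \<longrightarrow> 0 < emeasure (\<kappa> (q x)) B"
proof -
  let ?D = "{C \<in> \<xi>. emeasure (\<kappa> C) B = 0}"
  have "(\<lambda>C. emeasure (\<kappa> C) B) -` {0} \<inter> space Q \<in> sets Q" by (rule measurable_sets[OF \<kappa>_measurable[OF B]]) simp
  then have D: "?D \<in> sets Q" by (simp add: space_Q vimage_def Int_def conj_commute)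
  obtain A where A: "A \<in> sets F" "AE x in P. x \<in> A \<longleftrightarrow> q x \<in> ?D" using version_Q[OF D] by blast
  have AP: "A \<in> sets P" using A(1) by (simp add: sets_F)
  have "AE C in Q. emeasure (\<kappa> C) (B \<inter> A) = 0"
    using AE_P_\<kappa>[OF A(2)] \<kappa>_fibre AE_space
  proof eventually_elim
    case (elim C)
    then have C: "C \<in> \<xi>" by (simp add: space_Q)
    have s: "B \<in> sets (\<kappa> C)" "A \<in> sets (\<kappa> C)" using B AP \<kappa>_sets[OF C] by auto
    show ?case
    proof (cases "emeasure (\<kappa> C) B = 0")
      case True
      then show ?thesis using emeasure_mono[of "B \<inter> A" B "\<kappa> C"] s by simp
    next
      case False
      have "AE x in \<kappa> C. x \<notin> B \<inter> A" using elim(1,2) by eventually_elim (use False C in auto)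
      then show ?thesis using s AE_iff_null_sets[of "B \<inter> A" "\<kappa> C"] by auto
    qed
  qed
  then have "emeasure P (B \<inter> A) = 0"
    using B AP by (subst \<kappa>_integral) (auto simp: nn_integral_cong_AE)
  then have "AE x in P. x \<notin> B \<inter> A" using B AP by (intro AE_not_in) auto
  then show ?thesis using A(2) by eventually_elim (auto simp: less_le zero_less_iff_neq_zero)
qed

text \<open>
  The natural candidate, the set \<open>T\<close> of the classes that \<open>-g\<close> maps into \<open>D'\<close>, need not be measurable:
  \<open>-g\<close> may be a group element that the walk cannot reach, and then its action need not respect null sets. The
  conditional measures provide a substitute. Almost every \<open>\<kappa> C\<close> lives on one fibre, so it
  gives the event \<open>L\<close> that \<open>x a = g\<close> and that the restarted path lies in \<open>A'\<close> either no mass or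
  the mass of \<open>{x. x a = g}\<close>, according to whether \<open>C\<close> belongs to \<open>T\<close>. The classes with
  \<open>\<kappa> C L > 0\<close> form a measurable set that agrees with \<open>T\<close> wherever the walk can be at \<open>g\<close> at time \<open>a\<close>.
\<close>

lemma F_restart_trace:
  assumes A': "A' \<in> sets F" and pos: "0 < p a g"
  shows "\<exists>A\<in>sets F. AE x in P. x a = g \<longrightarrow> (x \<in> A \<longleftrightarrow> restart a x \<in> A')"
proof -
  obtain D' where D': "A' \<in> sets P" "D' \<in> sets Q" "AE x in P. x \<in> A' \<longleftrightarrow> q x \<in> D'" using A' by (auto simp: sets_F)
  have D'': "D' \<subseteq> \<xi>" "\<Union>D' \<in> sets \<nu>" using D'(2) by (auto simp: sets_Q)
  define L where "L = cylinder a g \<inter> restart a -` A'"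
  have L: "L \<in> sets P" unfolding L_def using measurable_sets[OF measurable_restart_P D'(1), of a] by auto
  let ?T = "translate_classes (- g) D'"
  have trace: "AE x in P. x a = g \<longrightarrow> (restart a x \<in> A' \<longleftrightarrow> q x \<in> ?T)"
  proof -
    obtain E N where E: "E \<in> sets \<Gamma>" "N \<in> sets \<Gamma>" "AE x in P. bnd x \<notin> N" "\<And>\<gamma>. \<gamma> \<notin> N \<Longrightarrow> \<gamma> \<in> \<Union>D' \<longleftrightarrow> \<gamma> \<in> E"
      using D''(2) by (rule sets_\<nu>E) blast
    have *: "AE x in P. x a = g \<longrightarrow> (act (- g) (bnd x) \<in> B \<longleftrightarrow> bnd (restart a x) \<in> B)" if "B \<in> sets \<Gamma>" for B
      using bnd_restart[OF measurable_sets[OF act_measurable that, of "- g"], of a]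
      by eventually_elim (auto simp: act_inverse)
    show ?thesis
      using *[OF E(1)] *[OF E(2)] AE_restart[OF E(3), of a] AE_restart[OF D'(3), of a]
    proof eventually_elim
      case (elim x)
      show ?case
      proof
        assume xa: "x a = g"
        have "restart a x \<in> A' \<longleftrightarrow> bnd (restart a x) \<in> \<Union>D'" using elim(4) q_mem_iff[OF D''(1)] by simp
        also have "\<dots> \<longleftrightarrow> bnd (restart a x) \<in> E" using E(4) elim(3) by blast
        also have "\<dots> \<longleftrightarrow> act (- g) (bnd x) \<in> E" using elim(1) xa by simp
        also have "\<dots> \<longleftrightarrow> act (- g) (bnd x) \<in> \<Union>D'" using E(4)[of "act (- g) (bnd x)"] elim(2,3) xa by simp
        also have "\<dots> \<longleftrightarrow> q x \<in> ?T" by (rule q_translate_iff[OF D''(1), symmetric])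
        finally show "restart a x \<in> A' \<longleftrightarrow> q x \<in> ?T" .
      qed
    qed
  qed
  let ?D = "{C \<in> \<xi>. 0 < emeasure (\<kappa> C) L}"
  have "(\<lambda>C. emeasure (\<kappa> C) L) -` {0<..} \<inter> space Q \<in> sets Q" by (rule measurable_sets[OF \<kappa>_measurable[OF L]]) simp
  then have D: "?D \<in> sets Q" by (simp add: space_Q vimage_def Int_def conj_commute)
  obtain A where A: "A \<in> sets F" "AE x in P. x \<in> A \<longleftrightarrow> q x \<in> ?D" using version_Q[OF D] by blast
  have "AE C in Q. 0 < emeasure (\<kappa> C) L \<longleftrightarrow> 0 < emeasure (\<kappa> C) (cylinder a g) \<and> C \<in> ?T"
    using AE_P_\<kappa>[OF trace] \<kappa>_fibre AE_space
  proof eventually_elim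
    case (elim C)
    then have C: "C \<in> \<xi>" by (simp add: space_Q)
    have s: "L \<in> sets (\<kappa> C)" "cylinder a g \<in> sets (\<kappa> C)" using L \<kappa>_sets[OF C] by auto
    have "AE x in \<kappa> C. x \<in> L \<longleftrightarrow> x \<in> cylinder a g \<and> C \<in> ?T"
      using elim(1,2) by eventually_elim (auto simp: L_def cylinder_def)
    then have "emeasure (\<kappa> C) L = emeasure (\<kappa> C) (if C \<in> ?T then cylinder a g else {})"
      by (intro emeasure_eq_AE) (use s in auto)
    then show ?case by (cases "C \<in> ?T") auto
  qed
  then have "AE x in P. 0 < emeasure (\<kappa> (q x)) L \<longleftrightarrow> 0 < emeasure (\<kappa> (q x)) (cylinder a g) \<and> q x \<in> ?T"
    by (rule AE_Q_P)
  then have "AE x in P. x a = g \<longrightarrow> (x \<in> A \<longleftrightarrow> restart a x \<in> A')"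
    using trace A(2) \<kappa>_pos[OF cylinder_sets[of a g]] by eventually_elim (auto simp: cylinder_def)
  then show ?thesis using A(1) by blast
qed

sublocale F: conditioned_walk \<mu> F
proof
  show "subalgebra P F" unfolding F_def by (rule subalgebra_pullback) (simp add: space_Q)
qed (fact F_trace_restart F_restart_trace)+

sublocale nested: nested_walks \<mu> F J
  by unfold_locales (rule sets_F_J)

lemma version_function:
  fixes u :: "_ \<Rightarrow> ennreal"
  assumes u: "u \<in> borel_measurable Q"
  shows "\<exists>v\<in>borel_measurable F. AE x in P. v x = u (q x)"
  using u
proof (induction rule: borel_measurable_induct)
  case (cong f g)
  then have "f (q x) = g (q x)" for x by (simp add: space_Q)
  with cong show ?case by simp
next
  case (set D)
  obtain A where A: "A \<in> sets F" "AE x in P. x \<in> A \<longleftrightarrow> q x \<in> D" using version_Q[OF set] by blast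
  show ?case by (rule bexI[of _ "indicator A"]) (use A in \<open>auto simp: indicator_def elim: eventually_mono\<close>)
next
  case (mult u c)
  then obtain v where v: "v \<in> borel_measurable F" "AE x in P. v x = u (q x)" by blast
  show ?case by (rule bexI[of _ "\<lambda>x. c * v x"]) (use v in \<open>auto elim: eventually_mono\<close>)
next
  case (add u1 u2)
  then obtain v1 v2 where v: "v1 \<in> borel_measurable F" "AE x in P. v1 x = u1 (q x)"
    "v2 \<in> borel_measurable F" "AE x in P. v2 x = u2 (q x)" by blast
  have "AE x in P. v1 x + v2 x = u1 (q x) + u2 (q x)" using v(2,4) by eventually_elim simp
  then show ?case by (intro bexI[of _ "\<lambda>x. v1 x + v2 x"]) (use v(1,3) in \<open>simp_all add: add.commute\<close>)
next
  case (seq u)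
  have "\<exists>v. \<forall>i. v i \<in> borel_measurable F \<and> (AE x in P. v i x = u i (q x))"
    by (rule choice) (use seq in blast)
  then obtain v where v: "\<And>i. v i \<in> borel_measurable F" "\<And>i. AE x in P. v i x = u i (q x)" by blast
  have "AE x in P. \<forall>i. v i x = u i (q x)" unfolding AE_all_countable using v(2) by blast
  then have "AE x in P. (SUP i. v i x) = (SUP i. u i (q x))" by eventually_elim simp
  then show ?case by (intro bexI[of _ "\<lambda>x. SUP i. v i x"]) (use v(1) in \<open>simp_all add: image_comp comp_def\<close>)
qed

lemma \<kappa>_kernel: "\<kappa> \<in> Q \<rightarrow>\<^sub>M subprob_algebra P"
  by (rule measurable_subprob_algebra)
    (simp_all only: space_Q \<kappa>_sets \<kappa>_measurable prob_space_imp_subprob_space \<kappa>_prob)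

lemma \<kappa>_nn_measurable: "\<psi> \<in> borel_measurable P \<Longrightarrow> (\<lambda>C. \<integral>\<^sup>+x. \<psi> x \<partial>\<kappa> C) \<in> borel_measurable Q"
  by (rule measurable_compose[OF \<kappa>_kernel nn_integral_measurable_subprob_algebra])

lemma \<xi>_nonempty: "\<xi> \<noteq> {}"
  by (metis q_in empty_iff)

lemma P_bind: "P = Q \<bind> \<kappa>"
proof (rule measure_eqI)
  show "sets P = sets (Q \<bind> \<kappa>)" using \<kappa>_sets \<xi>_nonempty by (subst sets_bind[where N = P]) (auto simp: space_Q)
  show "emeasure P A = emeasure (Q \<bind> \<kappa>) A" if "A \<in> sets P" for A
    using that \<xi>_nonempty by (subst emeasure_bind[OF _ \<kappa>_kernel]) (auto simp: space_Q \<kappa>_integral)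
qed

text \<open>
  As the conditional measures live on the fibres, integrating against \<open>\<kappa>\<close> commutes with restricting to sets of \<open>F\<close>.
\<close>

lemma nn_cond_exp_\<kappa>:
  assumes \<psi>: "\<psi> \<in> borel_measurable P"
  shows "AE x in P. (\<integral>\<^sup>+y. \<psi> y \<partial>\<kappa> (q x)) = nn_cond_exp P F \<psi> x"
proof -
  define h where "h C = (\<integral>\<^sup>+y. \<psi> y \<partial>\<kappa> C)" for C
  have hm: "h \<in> borel_measurable Q" unfolding h_def by (rule \<kappa>_nn_measurable[OF \<psi>])
  obtain h' where h': "h' \<in> borel_measurable F" "AE x in P. h' x = h (q x)" using version_function[OF hm] by blast
  have "AE x in P. h' x = nn_cond_exp P F \<psi> x"
  proof (rule F.cond.nn_cond_exp_charact[OF _ \<psi> h'(1)])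
    fix A assume A: "A \<in> sets F"
    then obtain D where D: "A \<in> sets P" "D \<in> sets Q" "AE x in P. x \<in> A \<longleftrightarrow> q x \<in> D" by (auto simp: sets_F)
    have m: "(\<lambda>x. \<psi> x * indicator A x) \<in> borel_measurable P" using \<psi> D(1) by (intro borel_measurable_times_ennreal borel_measurable_indicator)
    have hD: "(\<lambda>C. h C * indicator D C) \<in> borel_measurable Q" using hm D(2) by (intro borel_measurable_times_ennreal borel_measurable_indicator)
    have "(\<integral>\<^sup>+x\<in>A. \<psi> x \<partial>P) = (\<integral>\<^sup>+x. \<psi> x * indicator A x \<partial>(Q \<bind> \<kappa>))" by (simp only: P_bind[symmetric])
    also have "\<dots> = (\<integral>\<^sup>+C. \<integral>\<^sup>+x. \<psi> x * indicator A x \<partial>\<kappa> C \<partial>Q)"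
      by (rule nn_integral_bind[OF m \<kappa>_kernel])
    also have "\<dots> = (\<integral>\<^sup>+C. h C * indicator D C \<partial>Q)"
    proof (rule nn_integral_cong_AE)
      show "AE C in Q. (\<integral>\<^sup>+x. \<psi> x * indicator A x \<partial>\<kappa> C) = h C * indicator D C"
        using AE_P_\<kappa>[OF D(3)] \<kappa>_fibre AE_space
      proof eventually_elim
        case (elim C)
        then have C: "C \<in> \<xi>" by (simp add: space_Q)
        have \<psi>C: "\<psi> \<in> borel_measurable (\<kappa> C)" using \<psi> by (simp add: measurable_cong_sets[OF \<kappa>_sets[OF C] refl])
        have "(\<integral>\<^sup>+x. \<psi> x * indicator A x \<partial>\<kappa> C) = (\<integral>\<^sup>+x. \<psi> x * indicator D C \<partial>\<kappa> C)"
          by (rule nn_integral_cong_AE) (use elim(1,2) in \<open>eventually_elim, simp add: indicator_def\<close>)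
        then show ?case using \<psi>C by (simp add: nn_integral_multc h_def)
      qed
    qed
    also have "\<dots> = (\<integral>\<^sup>+x. h (q x) * indicator D (q x) \<partial>P)" by (rule nn_integral_Q[OF hD])
    also have "\<dots> = (\<integral>\<^sup>+x\<in>A. h' x \<partial>P)"
      by (rule nn_integral_cong_AE) (use h'(2) D(3) in \<open>eventually_elim, simp add: indicator_def\<close>)
    finally show "(\<integral>\<^sup>+x\<in>A. \<psi> x \<partial>P) = (\<integral>\<^sup>+x\<in>A. h' x \<partial>P)" .
  qed
  with h'(2) show ?thesis by eventually_elim (simp add: h_def)
qed

lemma measure_\<kappa>_cylinder: "AE x in P. \<forall>n g. measure (\<kappa> (q x)) (cylinder n g) = F.cp n g x"
proof -
  have "AE x in P. measure (\<kappa> (q x)) (cylinder n g) = F.cp n g x" for n g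
    using nn_cond_exp_\<kappa>[OF borel_measurable_indicator[OF cylinder_sets[of n g]]]
  proof eventually_elim
    case (elim x)
    have "cylinder n g \<in> sets (\<kappa> (q x))" by (simp add: \<kappa>_sets)
    then have "emeasure (\<kappa> (q x)) (cylinder n g) = F.cpe n g x" using elim by (simp add: F.cpe_def)
    then show ?case by (simp add: F.cp_def measure_def)
  qed
  then show ?thesis unfolding AE_all_countable by blast
qed

lemma entropy_rate_\<kappa>: "AE C in Q. AE x in \<kappa> C. \<forall>n. entropy_rate (\<kappa> C) n x = F.cond_info n x / real n"
proof -
  have "AE x in P. \<forall>n. entropy_rate (\<kappa> (q x)) n x = F.cond_info n x / real n"
    using measure_\<kappa>_cylinder
    by eventually_elim (simp add: entropy_rate_def F.cond_info_def F.\<phi>_def)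
  from AE_P_\<kappa>[OF this] \<kappa>_fibre show ?thesis
  proof eventually_elim
    case (elim C)
    show ?case using elim by eventually_elim simp
  qed
qed

lemma zero_entropy_imp_rate:
  assumes "AE C in Q. has_asymptotic_entropy (\<kappa> C) 0"
  shows "AE x in P. (\<lambda>n. F.cond_info n x / real n) \<longlonglongrightarrow> 0"
proof -
  define N where "N = {x. \<not> (\<forall>i::nat. \<exists>m. \<forall>n\<ge>m. \<bar>F.cond_info n x / real n\<bar> < 1 / real (Suc i))}"
  have N_iff: "x \<in> N \<longleftrightarrow> \<not> (\<lambda>n. F.cond_info n x / real n) \<longlonglongrightarrow> 0" for x
  proof -
    have "(\<lambda>n. F.cond_info n x / real n) \<longlonglongrightarrow> 0 \<longleftrightarrow> (\<forall>i::nat. \<exists>m. \<forall>n\<ge>m. \<bar>F.cond_info n x / real n\<bar> < 1 / real (Suc i))"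
    proof
      assume "(\<lambda>n. F.cond_info n x / real n) \<longlonglongrightarrow> 0"
      then show "\<forall>i::nat. \<exists>m. \<forall>n\<ge>m. \<bar>F.cond_info n x / real n\<bar> < 1 / real (Suc i)"
        unfolding LIMSEQ_iff by (auto dest!: spec[of _ "1 / real (Suc _)"])
    next
      assume *: "\<forall>i::nat. \<exists>m. \<forall>n\<ge>m. \<bar>F.cond_info n x / real n\<bar> < 1 / real (Suc i)"
      show "(\<lambda>n. F.cond_info n x / real n) \<longlonglongrightarrow> 0"
      proof (rule LIMSEQ_I)
        fix e :: real assume "0 < e"
        then obtain i :: nat where "1 / real (Suc i) < e" using nat_approx_posE by blast
        then show "\<exists>m. \<forall>n\<ge>m. norm (F.cond_info n x / real n - 0) < e" using *[rule_format, of i] by (auto intro: less_trans)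
      qed
    qed
    then show ?thesis by (simp add: N_def)
  qed
  have NP: "N \<in> sets P"
  proof -
    have "{x \<in> space P. \<not> (\<forall>i::nat. \<exists>m. \<forall>n\<in>{m..}. \<bar>F.cond_info n x / real n\<bar> < 1 / real (Suc i))} \<in> sets P"
      by measurable
    then show ?thesis by (simp add: N_def Ball_def)
  qed
  have "AE C in Q. emeasure (\<kappa> C) N = 0"
    using assms entropy_rate_\<kappa> AE_space
  proof eventually_elim
    case (elim C)
    have "AE x in \<kappa> C. (\<lambda>n. entropy_rate (\<kappa> C) n x) \<longlonglongrightarrow> 0" using elim(1) by (simp add: has_asymptotic_entropy_def)
    then have "AE x in \<kappa> C. x \<notin> N" using elim(2) by eventually_elim (simp add: N_iff)
    then show ?case using NP \<kappa>_sets[of C] elim(3) AE_iff_null_sets[of N "\<kappa> C"] by (auto simp: space_Q)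
  qed
  then have "emeasure P N = 0" using NP by (subst \<kappa>_integral) (auto simp: nn_integral_cong_AE)
  then have "AE x in P. x \<notin> N" using NP by (intro AE_not_in) auto
  then show ?thesis by eventually_elim (simp add: N_iff)
qed

lemma rate_imp_zero_entropy:
  assumes lim: "(\<lambda>n. (\<integral>x. F.cond_info n x \<partial>P) / real n) \<longlonglongrightarrow> 0"
  shows "AE C in Q. has_asymptotic_entropy (\<kappa> C) 0"
proof -
  \<comment> \<open>the entropy of the position at time n under the conditional measure of C\<close>
  let ?I = "\<lambda>n C. \<integral>\<^sup>+x. ennreal (F.cond_info n x) \<partial>\<kappa> C"
  let ?R = "\<lambda>C. (\<forall>n. ?I n C < top) \<and> (\<forall>i::nat. \<exists>m. \<forall>n\<in>{m..}. enn2real (?I n C) / real n < 1 / real (Suc i))"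
  have Im: "?I n \<in> borel_measurable Q" for n by (rule \<kappa>_nn_measurable) simp
  have R: "AE C in Q. ?R C"
  proof (rule AE_Q_I)
    note [measurable] = Im
    have "{C \<in> space Q. ?R C} \<in> sets Q" by measurable
    then show "{C \<in> \<xi>. ?R C} \<in> sets Q" by (simp only: space_Q)
    have "AE x in P. \<forall>n. ?I n (q x) = ennreal (real_cond_exp P F (F.cond_info n) x)"
    proof -
      have "AE x in P. ?I n (q x) = ennreal (real_cond_exp P F (F.cond_info n) x)" for n
        using nn_cond_exp_\<kappa>[of "\<lambda>x. ennreal (F.cond_info n x)"] F.ennreal_real_cond_exp[OF F.integrable_cond_info[of n] F.cond_info_nonneg[of n]]
        by (auto elim: eventually_elim2)
      then show ?thesis unfolding AE_all_countable by blast
    qed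
    moreover have "AE x in P. \<forall>n. 0 \<le> real_cond_exp P F (F.cond_info n) x"
      unfolding AE_all_countable by (intro allI F.cond.real_cond_exp_pos[OF F.cond_info_nonneg]) simp
    ultimately show "AE x in P. ?R (q x)" using F.expected_cond_info_rate_zero[OF lim]
    proof eventually_elim
      case (elim x)
      have "\<exists>m. \<forall>n\<in>{m..}. enn2real (?I n (q x)) / real n < 1 / real (Suc i)" for i
      proof -
        have "\<forall>\<^sub>F n in sequentially. real_cond_exp P F (F.cond_info n) x / real n < 1 / real (Suc i)"
          using elim(3) by (rule order_tendstoD) simp
        then obtain m where m: "\<And>n. n \<ge> m \<Longrightarrow> real_cond_exp P F (F.cond_info n) x / real n < 1 / real (Suc i)"
          by (auto simp: eventually_sequentially)
        show ?thesis
        proof (intro exI ballI)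
          fix n assume "n \<in> {m..}"
          then have n: "m \<le> n" by simp
          have "enn2real (?I n (q x)) = real_cond_exp P F (F.cond_info n) x" using elim(1,2) by simp
          then show "enn2real (?I n (q x)) / real n < 1 / real (Suc i)" using m[OF n] by simp
        qed
      qed
      then show ?case using elim(1) by simp
    qed
  qed
  have "AE x in P. \<forall>n. 0 \<le> F.cond_info n x" unfolding AE_all_countable using F.cond_info_nonneg by blast
  with F.cond_info_rate_zero[OF lim] have "AE x in P. (\<forall>n. 0 \<le> F.cond_info n x) \<and> (\<lambda>n. F.cond_info n x / real n) \<longlonglongrightarrow> 0"
    by eventually_elim simp
  from AE_P_\<kappa>[OF this] R entropy_rate_\<kappa> AE_space show ?thesis
  proof eventually_elim
    case (elim C)
    then have C: "C \<in> \<xi>" by (simp add: space_Q)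
    have cyl: "(\<lambda>x. entropy_rate (\<kappa> C) n x) \<in> borel_measurable (\<kappa> C)" for n
      unfolding measurable_cong_sets[OF \<kappa>_sets[OF C] refl] entropy_rate_def
      by (rule measurable_compose[OF measurable_coord_P]) simp
    have fm: "F.cond_info n \<in> borel_measurable (\<kappa> C)" for n
      unfolding measurable_cong_sets[OF \<kappa>_sets[OF C] refl] by simp
    have f0: "AE x in \<kappa> C. 0 \<le> F.cond_info n x" for n using elim(1) by eventually_elim simp
    have fi: "integrable (\<kappa> C) (F.cond_info n)" for n
      by (rule integrableI_nonneg[OF fm f0]) (use elim(2) in simp)
    have eq: "AE x in \<kappa> C. entropy_rate (\<kappa> C) n x = F.cond_info n x / real n" for n using elim(3) by eventually_elim simp
    have int: "integrable (\<kappa> C) (entropy_rate (\<kappa> C) n)" for n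
      by (rule integrable_cong_AE_imp[of _ "\<lambda>x. F.cond_info n x / real n"]) (use fi cyl eq[of n] in \<open>auto elim: eventually_mono\<close>)
    have val: "(\<integral>x. \<bar>entropy_rate (\<kappa> C) n x - 0\<bar> \<partial>\<kappa> C) = enn2real (?I n C) / real n" for n
    proof -
      have "(\<integral>x. \<bar>entropy_rate (\<kappa> C) n x - 0\<bar> \<partial>\<kappa> C) = (\<integral>x. F.cond_info n x / real n \<partial>\<kappa> C)"
        by (rule integral_cong_AE) (use eq[of n] f0[of n] cyl fm in \<open>auto elim: eventually_elim2\<close>)
      also have "\<dots> = (\<integral>x. F.cond_info n x \<partial>\<kappa> C) / real n" by simp
      also have "(\<integral>x. F.cond_info n x \<partial>\<kappa> C) = enn2real (?I n C)" by (rule integral_eq_nn_integral[OF fm f0])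
      finally show ?thesis .
    qed
    have "(\<lambda>n. enn2real (?I n C) / real n) \<longlonglongrightarrow> 0"
    proof (rule LIMSEQ_I)
      fix e :: real assume "0 < e"
      then obtain i :: nat where i: "1 / real (Suc i) < e" using nat_approx_posE by blast
      obtain m where "\<forall>n\<in>{m..}. enn2real (?I n C) / real n < 1 / real (Suc i)" using elim(2) by blast
      then show "\<exists>m. \<forall>n\<ge>m. norm (enn2real (?I n C) / real n - 0) < e" using i by (intro exI[of _ m]) (auto intro: less_trans)
    qed
    moreover have "AE x in \<kappa> C. (\<lambda>n. entropy_rate (\<kappa> C) n x) \<longlonglongrightarrow> 0" using elim(1,3) by eventually_elim simp
    ultimately show ?case using int val by (simp add: has_asymptotic_entropy_def)
  qed
qed

text \<open>
  The two directions of the entropy criterion meet here: from left to right \<open>F\<close> exhausts \<open>J\<close> by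
  comparison of entropies; from right to left \<open>F\<close> inherits from \<open>J\<close> all shift-invariant sets.
\<close>

theorem zero_entropy_iff:
  "(AE C in Q. has_asymptotic_entropy (\<kappa> C) 0) \<longleftrightarrow> sets F = sets J"
proof
  assume "AE C in Q. has_asymptotic_entropy (\<kappa> C) 0"
  then have lim: "(\<lambda>n. (\<integral>x. F.cond_info n x \<partial>P) / real n) \<longlonglongrightarrow> 0"
    by (intro F.integral_rate_zero zero_entropy_imp_rate)
  have "A \<in> sets F" if A: "A \<in> sets J" for A
  proof -
    obtain B where B: "B \<in> sets F" "AE x in P. x \<in> A \<longleftrightarrow> x \<in> B" using nested.zero_rate_imp_maximal[OF lim A] by blast
    obtain D where D: "D \<in> sets Q" "AE x in P. x \<in> B \<longleftrightarrow> q x \<in> D" using B(1) by (auto simp: sets_F)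
    have "AE x in P. x \<in> A \<longleftrightarrow> q x \<in> D" using B(2) D(2) by eventually_elim simp
    then show ?thesis using A D(1) unfolding sets_F sets_J by blast
  qed
  then show "sets F = sets J" using sets_F_J by blast
next
  assume eq: "sets F = sets J"
  interpret M: maximal_conditioned_walk \<mu> F
    by unfold_locales (use eq J.invariant_sets in blast)
  show "AE C in Q. has_asymptotic_entropy (\<kappa> C) 0"
    by (rule rate_imp_zero_entropy[OF M.maximal_imp_zero_rate])
qed

end

section \<open>Isomorphisms mod 0 and maximality\<close>

lemma iso_mod0_compose:
  assumes f: "iso_mod0 M N f" and g: "iso_mod0 N K g"
  shows "iso_mod0 M K (g \<circ> f)"
proof -
  obtain A B where A: "A \<in> null_sets M" and B: "B \<in> null_sets N" and bf: "bij_betw f (space M - A) (space N - B)"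
    and ef: "\<And>E. E \<subseteq> space M - A \<Longrightarrow> (E \<in> sets M \<longleftrightarrow> f ` E \<in> sets N) \<and> (E \<in> sets M \<longrightarrow> emeasure N (f ` E) = emeasure M E)"
    using f unfolding iso_mod0_def by blast
  obtain A2 B2 where A2: "A2 \<in> null_sets N" and B2: "B2 \<in> null_sets K" and bg: "bij_betw g (space N - A2) (space K - B2)"
    and eg: "\<And>E. E \<subseteq> space N - A2 \<Longrightarrow> (E \<in> sets N \<longleftrightarrow> g ` E \<in> sets K) \<and> (E \<in> sets N \<longrightarrow> emeasure K (g ` E) = emeasure N E)"
    using g unfolding iso_mod0_def by blast
  \<comment> \<open>the points that f maps into the exceptional set of g, and below the image under g of that of f\<close>
  define X where "X = {x \<in> space M - A. f x \<in> A2}"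
  define Y where "Y = g ` ((space N - A2) \<inter> B)"
  have A2s: "A2 \<subseteq> space N" using A2 sets.sets_into_space by auto
  have fX: "f ` X = A2 \<inter> (space N - B)"
    using bf by (auto simp: X_def bij_betw_def)
  have fXs: "f ` X \<in> sets N" unfolding fX using A2 B by auto
  have XA: "X \<subseteq> space M - A" by (auto simp: X_def)
  have X: "X \<in> sets M" "emeasure M X = emeasure N (f ` X)" using ef[OF XA] fXs by simp_all
  have "emeasure N (f ` X) \<le> emeasure N A2" unfolding fX using A2 by (intro emeasure_mono) auto
  then have Xn: "X \<in> null_sets M" using X A2 by (auto intro!: null_setsI)
  have W: "(space N - A2) \<inter> B \<in> sets N" using A2 B by auto
  have "emeasure N ((space N - A2) \<inter> B) \<le> emeasure N B" using B by (intro emeasure_mono) auto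
  then have "emeasure N ((space N - A2) \<inter> B) = 0" using B by auto
  then have Yn: "Y \<in> null_sets K" using eg[of "(space N - A2) \<inter> B"] W by (auto simp: Y_def intro!: null_setsI)
  have b1: "bij_betw f (space M - (A \<union> X)) ((space N - B) - A2)"
  proof -
    have "bij_betw f ((space M - A) - X) ((space N - B) - f ` X)"
      by (rule bij_betw_DiffI[OF bf]) (use bf in \<open>auto simp: X_def bij_betw_def intro: inj_on_subset\<close>)
    moreover have "(space N - B) - f ` X = (space N - B) - A2" unfolding fX by auto
    moreover have "(space M - A) - X = space M - (A \<union> X)" by auto
    ultimately show ?thesis by simp
  qed
  have b2: "bij_betw g ((space N - B) - A2) (space K - (B2 \<union> Y))"
  proof -
    have "bij_betw g ((space N - A2) - (space N - A2) \<inter> B) ((space K - B2) - Y)"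
      unfolding Y_def by (rule bij_betw_DiffI[OF bg]) (use bg in \<open>auto simp: bij_betw_def intro: inj_on_subset\<close>)
    moreover have "(space N - A2) - (space N - A2) \<inter> B = (space N - B) - A2" by auto
    moreover have "(space K - B2) - Y = space K - (B2 \<union> Y)" by auto
    ultimately show ?thesis by simp
  qed
  show ?thesis unfolding iso_mod0_def
  proof (intro bexI conjI allI impI)
    show "bij_betw (g \<circ> f) (space M - (A \<union> X)) (space K - (B2 \<union> Y))" by (rule bij_betw_trans[OF b1 b2])
    show "A \<union> X \<in> null_sets M" using A Xn by auto
    show "B2 \<union> Y \<in> null_sets K" using B2 Yn by auto
    fix E assume E: "E \<subseteq> space M - (A \<union> X)"
    have E1: "E \<subseteq> space M - A" using E by auto
    have fE: "f ` E \<subseteq> space N - A2" using E b1 by (auto simp: bij_betw_def)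
    show "E \<in> sets M \<longleftrightarrow> (g \<circ> f) ` E \<in> sets K" using ef[OF E1] eg[OF fE] by (simp add: image_comp)
    assume "E \<in> sets M"
    then show "emeasure K ((g \<circ> f) ` E) = emeasure M E"
      using ef[OF E1] eg[OF fE] by (simp add: image_comp)
  qed
qed

locale identified_boundary = boundary_quotient +
  fixes lam :: "'c measure" and \<iota> :: "'b set \<Rightarrow> 'c"
  assumes iso: "iso_mod0 Q lam \<iota>"
begin

lemma sets_Q_of_sets_\<nu>_if_iso:
  assumes full: "iso_mod0 \<nu> lam (\<iota> \<circ> partition_proj \<xi>)" and E: "E \<in> sets \<nu>"
  shows "\<exists>D\<in>sets Q. AE x in P. bnd x \<in> E \<longleftrightarrow> q x \<in> D"
proof -
  let ?p = "partition_proj \<xi>"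
  obtain A1 B1 where A1: "A1 \<in> null_sets \<nu>" and b1: "bij_betw (\<iota> \<circ> ?p) (space \<nu> - A1) (space lam - B1)"
    and e1: "\<And>E. E \<subseteq> space \<nu> - A1 \<Longrightarrow> (E \<in> sets \<nu> \<longleftrightarrow> (\<iota> \<circ> ?p) ` E \<in> sets lam)"
    using full unfolding iso_mod0_def by blast
  obtain A2 B2 where A2: "A2 \<in> null_sets Q" and B2: "B2 \<in> null_sets lam" and b2: "bij_betw \<iota> (space Q - A2) (space lam - B2)"
    and e2: "\<And>E. E \<subseteq> space Q - A2 \<Longrightarrow> (E \<in> sets Q \<longleftrightarrow> \<iota> ` E \<in> sets lam)"
    using iso unfolding iso_mod0_def by blast
  define E1 where "E1 = E - A1"
  have E1: "E1 \<subseteq> space \<nu> - A1" "E1 \<in> sets \<nu>" using E A1 sets.sets_into_space[OF E] by (auto simp: E1_def)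
  have iE1: "(\<iota> \<circ> ?p) ` E1 \<in> sets lam" using e1[OF E1(1)] E1(2) by simp
  define D where "D = {C \<in> space Q - A2. \<iota> C \<in> (\<iota> \<circ> ?p) ` E1}"
  have "\<iota> ` D = (\<iota> \<circ> ?p) ` E1 \<inter> (space lam - B2)"
  proof (intro equalityI subsetI)
    fix y assume "y \<in> \<iota> ` D"
    then show "y \<in> (\<iota> \<circ> ?p) ` E1 \<inter> (space lam - B2)" using b2 by (auto simp: D_def bij_betw_def)
  next
    fix y assume y: "y \<in> (\<iota> \<circ> ?p) ` E1 \<inter> (space lam - B2)"
    then obtain C where "C \<in> space Q - A2" "y = \<iota> C" using b2 by (auto simp: bij_betw_def)
    then show "y \<in> \<iota> ` D" using y by (auto simp: D_def)
  qed
  also have "\<dots> \<in> sets lam" using iE1 B2 by auto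
  finally have D: "D \<in> sets Q" using e2[of D] by (auto simp: D_def)
  have a1: "AE x in P. bnd x \<notin> A1" by (rule AE_\<nu>_bnd[OF AE_not_in[OF A1]])
  have a2: "AE x in P. q x \<notin> A2" by (rule AE_Q_P[OF AE_not_in[OF A2]])
  have "AE x in P. bnd x \<in> E \<longleftrightarrow> q x \<in> D"
    using a1 a2
  proof eventually_elim
    case (elim x)
    have sp: "bnd x \<in> space \<nu> - A1" using elim by simp
    have qx: "q x \<in> space Q - A2" using elim by (simp add: space_Q)
    show ?case
    proof
      assume "bnd x \<in> E"
      then have "bnd x \<in> E1" using elim by (simp add: E1_def)
      then have "(\<iota> \<circ> ?p) (bnd x) \<in> (\<iota> \<circ> ?p) ` E1" by (rule imageI)
      then show "q x \<in> D" using qx by (simp add: D_def q_def)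
    next
      assume "q x \<in> D"
      then obtain \<gamma> where \<gamma>: "\<gamma> \<in> E1" "(\<iota> \<circ> ?p) (bnd x) = (\<iota> \<circ> ?p) \<gamma>" by (auto simp: D_def q_def)
      have "\<gamma> \<in> space \<nu> - A1" using \<gamma>(1) E1(1) by blast
      then have "bnd x = \<gamma>" by (rule inj_onD[OF bij_betw_imp_inj_on[OF b1] \<gamma>(2) sp])
      then show "bnd x \<in> E" using \<gamma>(1) by (simp add: E1_def)
    qed
  qed
  then show ?thesis using D by blast
qed

text \<open>
  Two isomorphisms onto \<open>lam\<close>, one of which factors through the quotient, identify the measurable sets upstairs with
  measurable sets of classes.
\<close>

lemma iso_imp_sets_eq:
  assumes "iso_mod0 \<nu> lam (\<iota> \<circ> partition_proj \<xi>)"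
  shows "sets F = sets J"
proof
  show "sets J \<subseteq> sets F"
  proof
    fix A assume "A \<in> sets J"
    then obtain D where D: "A \<in> sets P" "D \<in> sets \<Gamma>" "AE x in P. x \<in> A \<longleftrightarrow> bnd x \<in> D" by (auto simp: sets_J)
    obtain D' where D': "D' \<in> sets Q" "AE x in P. bnd x \<in> D \<longleftrightarrow> q x \<in> D'"
      using sets_Q_of_sets_\<nu>_if_iso[OF assms sets_\<Gamma>_\<nu>[OF D(2)]] by blast
    have "AE x in P. x \<in> A \<longleftrightarrow> q x \<in> D'" using D(3) D'(2) by eventually_elim simp
    then show "A \<in> sets F" using D(1) D'(1) unfolding sets_F by blast
  qed
qed (rule sets_F_J)

lemma lebesgue_\<nu>: "lebesgue_space \<nu>"
  using poisson unfolding \<nu>_def harmonic_measure_def poisson_boundary_def by blast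

text \<open>
  Transport the half-lines with rational end points from the real line to sets \<open>E r\<close> that separate the points of
  the Poisson boundary. Each is a union of classes up to a null set, so outside the countable union of these null sets
  no class contains two points. Completeness of \<open>\<nu>\<close> then gives measurability of images.
\<close>

lemma sets_eq_imp_iso_proj:
  assumes eq: "sets F = sets J"
  shows "iso_mod0 \<nu> Q (partition_proj \<xi>)"
proof -
  let ?p = "partition_proj \<xi>"
  interpret c: complete_measure \<nu> using lebesgue_\<nu> by (simp add: lebesgue_space_def)
  obtain R :: "real measure" and h where R: "sets R = sets borel" "iso_mod0 \<nu> (completion R) h"
    using lebesgue_\<nu> unfolding lebesgue_space_def by blast
  obtain A0 B0 where A0: "A0 \<in> null_sets \<nu>" and B0: "B0 \<in> null_sets (completion R)"
    and b: "bij_betw h (space \<nu> - A0) (space (completion R) - B0)"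
    and e: "\<And>E. E \<subseteq> space \<nu> - A0 \<Longrightarrow> (E \<in> sets \<nu> \<longleftrightarrow> h ` E \<in> sets (completion R))"
    using R(2) unfolding iso_mod0_def by blast
  have spR: "space (completion R) = UNIV" using sets_eq_imp_space_eq[OF R(1)] by simp
  define E where "E r = {\<gamma> \<in> space \<nu> - A0. h \<gamma> \<le> real_of_rat r}" for r
  have E: "E r \<in> sets \<nu>" for r
  proof -
    have "h ` E r = {..real_of_rat r} \<inter> (space (completion R) - B0)"
      using b by (auto simp: E_def bij_betw_def)
    also have "\<dots> \<in> sets (completion R)"
    proof (rule sets.Int)
      have "{..real_of_rat r} \<in> sets R" by (simp add: R(1))
      then show "{..real_of_rat r} \<in> sets (completion R)" by simp
      show "space (completion R) - B0 \<in> sets (completion R)" using B0 by auto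
    qed
    finally show ?thesis using e[of "E r"] by (auto simp: E_def)
  qed
  have "\<exists>D. D \<in> sets Q \<and> (AE x in P. bnd x \<in> E r \<longleftrightarrow> q x \<in> D)" for r
  proof -
    obtain D A where A: "D \<in> sets \<Gamma>" "A \<in> sets P" "AE x in P. x \<in> A \<longleftrightarrow> bnd x \<in> E r" "AE x in P. x \<in> A \<longleftrightarrow> bnd x \<in> D"
      using version_\<nu>[OF E[of r]] by blast
    have "A \<in> sets J" using A(1,2,4) unfolding sets_J by blast
    then obtain D' where D': "D' \<in> sets Q" "AE x in P. x \<in> A \<longleftrightarrow> q x \<in> D'" using eq by (auto simp: sets_F)
    have "AE x in P. bnd x \<in> E r \<longleftrightarrow> q x \<in> D'" using A(3) D'(2) by eventually_elim simp
    then show ?thesis using D'(1) by blast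
  qed
  then have "\<exists>D. \<forall>r. D r \<in> sets Q \<and> (AE x in P. bnd x \<in> E r \<longleftrightarrow> q x \<in> D r)" by (intro choice) blast
  then obtain D where D: "\<And>r. D r \<in> sets Q" "\<And>r. AE x in P. bnd x \<in> E r \<longleftrightarrow> q x \<in> D r" by blast
  have Ds: "D r \<subseteq> \<xi>" "\<Union>(D r) \<in> sets \<nu>" for r using D(1)[of r] by (auto simp: sets_Q)
  define S where "S r = (E r - \<Union>(D r)) \<union> (\<Union>(D r) - E r)" for r
  have S: "S r \<in> null_sets \<nu>" for r
  proof (rule null_\<nu>I)
    show "S r \<in> sets \<nu>" using E Ds by (auto simp: S_def)
    show "AE x in P. bnd x \<notin> S r" using D(2)[of r]
      by eventually_elim (use q_mem_iff[OF Ds(1)] in \<open>auto simp: S_def\<close>)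
  qed
  define N where "N = A0 \<union> (\<Union>r. S r)"
  have N: "N \<in> null_sets \<nu>" unfolding N_def using A0 S by (intro null_sets.Un null_sets_UN') auto
  have inj: "inj_on ?p (space \<nu> - N)"
  proof (rule inj_onI)
    fix \<gamma> \<gamma>' assume g: "\<gamma> \<in> space \<nu> - N" "\<gamma>' \<in> space \<nu> - N" "?p \<gamma> = ?p \<gamma>'"
    have "\<gamma> \<in> E r \<longleftrightarrow> \<gamma>' \<in> E r" for r
    proof -
      have "\<gamma> \<in> E r \<longleftrightarrow> \<gamma> \<in> \<Union>(D r)" "\<gamma>' \<in> E r \<longleftrightarrow> \<gamma>' \<in> \<Union>(D r)" using g(1,2) unfolding N_def S_def by blast+
      moreover have "\<gamma> \<in> \<Union>(D r) \<longleftrightarrow> \<gamma>' \<in> \<Union>(D r)"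
        using partition_proj_mem_iff[OF partition _ Ds(1)[of r], of \<gamma>] partition_proj_mem_iff[OF partition _ Ds(1)[of r], of \<gamma>'] g by simp
      ultimately show ?thesis by simp
    qed
    then have le: "h \<gamma> \<le> real_of_rat r \<longleftrightarrow> h \<gamma>' \<le> real_of_rat r" for r
      using g(1,2) by (auto simp: E_def N_def)
    have "h \<gamma> = h \<gamma>'"
    proof (rule ccontr)
      assume "h \<gamma> \<noteq> h \<gamma>'"
      then consider "h \<gamma> < h \<gamma>'" | "h \<gamma>' < h \<gamma>" by linarith
      then show False
      proof cases
        case 1
        then obtain r where "h \<gamma> < real_of_rat r" "real_of_rat r < h \<gamma>'" using of_rat_dense by blast
        then show False using le[of r] by simp
      next
        case 2
        then obtain r where "h \<gamma>' < real_of_rat r" "real_of_rat r < h \<gamma>" using of_rat_dense by blast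
        then show False using le[of r] by simp
      qed
    qed
    then show "\<gamma> = \<gamma>'" using b g(1,2) by (auto simp: N_def bij_betw_def dest: inj_onD)
  qed
  have sat: "\<gamma> \<in> B" if B: "B \<subseteq> space \<nu> - N" and \<gamma>: "\<gamma> \<in> \<Union>(?p ` B)" "\<gamma> \<notin> N" for B \<gamma>
  proof -
    obtain \<gamma>0 where \<gamma>0: "\<gamma>0 \<in> B" "\<gamma> \<in> ?p \<gamma>0" using \<gamma>(1) by auto
    have C: "?p \<gamma>0 \<in> \<xi>" by (rule partition_proj_in(1)[OF partition]) (use B \<gamma>0 in auto)
    then have "\<gamma> \<in> space \<nu>" using \<gamma>0(2) partition_onD1[OF partition] by blast
    moreover have "?p \<gamma> = ?p \<gamma>0" by (rule partition_proj_eq[OF partition C \<gamma>0(2)])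
    ultimately have "\<gamma> = \<gamma>0" using \<gamma>(2) \<gamma>0(1) B by (intro inj_onD[OF inj]) auto
    then show ?thesis using \<gamma>0 by simp
  qed
  have self: "B \<subseteq> \<Union>(?p ` B)" if "B \<subseteq> space \<nu>" for B
    using partition_proj_in(2)[OF partition] that by blast
  have image_sub: "?p ` B \<subseteq> \<xi>" if "B \<subseteq> space \<nu>" for B
    using partition_proj_in(1)[OF partition] that by blast
  have Bmeas: "(B \<in> sets \<nu> \<longleftrightarrow> ?p ` B \<in> sets Q) \<and> (B \<in> sets \<nu> \<longrightarrow> emeasure Q (?p ` B) = emeasure \<nu> B)"
    if B: "B \<subseteq> space \<nu> - N" for B
  proof -
    have Bs: "B \<subseteq> space \<nu>" using B by auto
    let ?U = "\<Union>(?p ` B)"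
    have U: "?U = B \<union> (?U \<inter> N)" "B = ?U - N" using sat[OF B] self[OF Bs] B by auto
    have M: "?U \<inter> N \<in> null_sets \<nu>" by (rule c.complete2[OF _ N]) auto
    have iff: "B \<in> sets \<nu> \<longleftrightarrow> ?U \<in> sets \<nu>"
    proof
      assume "B \<in> sets \<nu>" then show "?U \<in> sets \<nu>" using M by (subst U(1)) auto
    next
      assume "?U \<in> sets \<nu>" then show "B \<in> sets \<nu>" using N by (subst U(2)) auto
    qed
    have Qiff: "?p ` B \<in> sets Q \<longleftrightarrow> ?U \<in> sets \<nu>" using image_sub[OF Bs] by (simp add: sets_Q)
    have "emeasure Q (?p ` B) = emeasure \<nu> B" if "B \<in> sets \<nu>"
    proof -
      have "emeasure Q (?p ` B) = emeasure \<nu> ?U" using that iff Qiff by (intro emeasure_Q) simp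
      also have "\<dots> = emeasure \<nu> (B \<union> (?U \<inter> N))" using U(1) by simp
      also have "\<dots> = emeasure \<nu> B" by (rule emeasure_Un_null_set[OF that M])
      finally show ?thesis .
    qed
    then show ?thesis using iff Qiff by blast
  qed
  have sN: "space \<nu> - N \<in> sets \<nu>" by (rule sets.compl_sets) (rule null_setsD2[OF N])
  define B where "B = \<xi> - ?p ` (space \<nu> - N)"
  have pQ: "?p ` (space \<nu> - N) \<in> sets Q" using Bmeas[of "space \<nu> - N"] sN by simp
  have B: "B \<in> null_sets Q"
  proof (rule null_setsI)
    show BQ: "B \<in> sets Q" unfolding B_def using sets.compl_sets[OF pQ] by (simp add: space_Q)
    have "\<Union>B \<subseteq> N"
    proof
      fix \<gamma> assume "\<gamma> \<in> \<Union>B"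
      then obtain C where C: "C \<in> \<xi>" "C \<notin> ?p ` (space \<nu> - N)" "\<gamma> \<in> C" by (auto simp: B_def)
      have "?p \<gamma> = C" by (rule partition_proj_eq[OF partition C(1,3)])
      moreover have "\<gamma> \<in> space \<nu>" using C(1,3) partition_onD1[OF partition] by blast
      ultimately show "\<gamma> \<in> N" using C(2) by auto
    qed
    then have "\<Union>B \<in> null_sets \<nu>" by (rule c.complete2[OF _ N])
    then show "emeasure Q B = 0" by (simp only: emeasure_Q[OF BQ] null_setsD1)
  qed
  have bij: "bij_betw ?p (space \<nu> - N) (space Q - B)"
    using inj image_sub[of "space \<nu> - N"] by (auto simp: bij_betw_def space_Q B_def)
  show ?thesis unfolding iso_mod0_def using N B bij Bmeas by blast
qed

theorem iso_iff_sets_eq: "iso_mod0 \<nu> lam (\<iota> \<circ> partition_proj \<xi>) \<longleftrightarrow> sets F = sets J"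
  using iso_imp_sets_eq iso_mod0_compose[OF sets_eq_imp_iso_proj iso] by blast

end

theorem theorem4p6:
  fixes \<mu> :: "'g::{group_add,countable} pmf"
    and \<Gamma> :: "'b measure"
    and bnd :: "(nat \<Rightarrow> 'g) \<Rightarrow> 'b"
    and act :: "'g \<Rightarrow> 'b \<Rightarrow> 'b"
    and \<xi> :: "'b set set"
    and lam :: "'c measure"
    and \<phi> :: "'b set \<Rightarrow> 'c"
    and \<kappa> :: "'b set \<Rightarrow> (nat \<Rightarrow> 'g) measure"
  assumes "has_finite_entropy \<mu>"
    and "poisson_boundary \<mu> \<Gamma> bnd act"
    and "mu_boundary \<mu> \<Gamma> bnd act \<xi> lam \<phi>"
    and "conditional_measures (walk_measure \<mu>)
           (quotient_measure (harmonic_measure \<mu> \<Gamma> bnd) \<xi>) (partition_proj \<xi> \<circ> bnd) \<kappa>"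
  shows "is_the_poisson_boundary \<mu> \<Gamma> bnd \<xi> lam \<phi> \<longleftrightarrow>
         (AE C in quotient_measure (harmonic_measure \<mu> \<Gamma> bnd) \<xi>. has_asymptotic_entropy (\<kappa> C) 0)"
proof -
  interpret W: poisson_walk \<mu> \<Gamma> bnd act
    by unfold_locales (fact assms(1), fact assms(2))
  interpret I: identified_boundary \<mu> \<Gamma> bnd act \<xi> \<kappa> lam \<phi>
    using assms(3,4)
    by unfold_locales (auto simp: mu_boundary_def measurable_partition_def W.\<nu>_def)
  show ?thesis
    using I.iso_iff_sets_eq I.zero_entropy_iff
    unfolding is_the_poisson_boundary_def W.\<nu>_def[symmetric] by simp
qed

end
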